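(* If the environment $W$ is left fixed, then for all $x,y\in(a,b)$ and $t>0$, $$p(t,x,y)=2e^{-W(y)}\sum_{n=1}^{\infty}e^{-\lambda_n t}\phi_n(x)\phi_n(y),$$ where $p(t,x,y)$ is the density function (with respect to Lebesgue measure in $y$) of $X_t$ given $X_0=x$, $X$ being the Brox diffusion killed at $a$ and $b$, and $\{\lambda_n,\phi_n\}_{n=1}^\infty$ are the eigenvalues and eigenfunctions of the generator $L$ of $X$.
   Context: Fix $a<b$ and a realization (environment) $W:\mathbb{R}\to\mathbb{R}$, a continuous path of a two-sided Brownian motion. Scale function: $s(x)=\int_0^x e^{W(y)}dy$; speed measure: $m(A)=\int_A 2e^{-W(y)}dy$. The killed Brox diffusion $X$ is built as follows: let $\bar B$ be a Brownian motion, independent of $W$, killed on hitting $s(a)$ or $s(b)$; let $\bar T_t=\int_0^t e^{-2W(s^{-1}(\bar B_u))}du$ and let $\bar\gamma$ be the inverse of $\bar T$; then $X_t=s^{-1}(\bar B_{\bar\gamma_t})$. The density $p(t,x,\cdot)$ is that of the law of $X_t$ on the event that it has not been killed by time $t$, given $X_0=x$. The generator of $X$ is $Lf(x)=\frac{d}{dm}\frac{d}{ds}f(x)=\frac{e^{W(x)}}{2}\left(e^{-W(x)}f'(x)\right)'$, with domain $D(L)$ consisting of the differentiable functions $f$ on $[a,b]$ with $f(a)=f(b)=0$ and $f'=e^{W}g$ with $g\in C^1$. Eigenvalues $\lambda$ and eigenfunctions $\phi\neq0$ are understood in the sense $L\phi+\lambda\phi=0$, $\phi(a)=\phi(b)=0$.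 The eigenfunctions $\phi_n$ are normalized so that $\{\phi_n\}$ is orthonormal for the inner product $\langle f,g\rangle=\int_a^b f(x)g(x)\,2e^{-W(x)}dx$. *)

theory Defs
  imports "HOL-Probability.Probability"
begin

section \<open>Brownian motion\<close>

text \<open>Brownian motion with index set \<open>T\<close> (containing 0) and value \<open>c\<close> at time 0. With
  \<open>T = {0..}\<close> this is Brownian motion started at \<open>c\<close>; with \<open>T = UNIV\<close> and \<open>c = 0\<close> it is
  two-sided Brownian motion. Every path, not just almost every path, is continuous, so that
  hitting events are measurable without completing \<open>M\<close>.\<close>

definition brownian_motion ::
    "'w measure \<Rightarrow> real set \<Rightarrow> real \<Rightarrow> (real \<Rightarrow> 'w \<Rightarrow> real) \<Rightarrow> bool" where
  "brownian_motion M T c B \<longleftrightarrow>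
     prob_space M \<and>
     (\<forall>t\<in>T. B t \<in> borel_measurable M) \<and>
     (\<forall>\<omega>\<in>space M. B 0 \<omega> = c) \<and>
     (\<forall>\<omega>\<in>space M. continuous_on T (\<lambda>t. B t \<omega>)) \<and>
     (\<forall>r\<in>T. \<forall>t\<in>T. r < t \<longrightarrow>
        distributed M lborel (\<lambda>\<omega>. B t \<omega> - B r \<omega>) (\<lambda>z. ennreal (normal_density 0 (sqrt (t - r)) z))) \<and>
     (\<forall>(n::nat) ts. (\<forall>i\<le>n. ts i \<in> T) \<and> (\<forall>i<n. ts i < ts (Suc i)) \<longrightarrow>
        prob_space.indep_vars M (\<lambda>_. borel) (\<lambda>i \<omega>. B (ts (Suc i)) \<omega> - B (ts i) \<omega>) {..<n})"

section \<open>The killed Brox diffusion in a fixed environment\<close>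

definition scale_fun :: "(real \<Rightarrow> real) \<Rightarrow> real \<Rightarrow> real" where
  "scale_fun W x = (LBINT y=ereal 0..ereal x. exp (W y))"

definition speed_measure :: "(real \<Rightarrow> real) \<Rightarrow> real measure" where
  "speed_measure W = density lborel (\<lambda>y. ennreal (2 * exp (- W y)))"

text \<open>The time interval during which the Brownian path \<open>\<beta>\<close> has not yet been killed, i.e. has
  hit neither \<open>s(a)\<close> nor \<open>s(b)\<close>.\<close>

definition bm_lifetime :: "(real \<Rightarrow> real) \<Rightarrow> real \<Rightarrow> real \<Rightarrow> (real \<Rightarrow> real) \<Rightarrow> real set" where
  "bm_lifetime W a b \<beta> =
     {u. 0 \<le> u \<and> (\<forall>v\<in>{0..u}. \<beta> v \<noteq> scale_fun W a \<and> \<beta> v \<noteq> scale_fun W b)}"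

definition brox_clock :: "(real \<Rightarrow> real) \<Rightarrow> (real \<Rightarrow> real) \<Rightarrow> real \<Rightarrow> real" where
  "brox_clock W \<beta> u = (LBINT v=ereal 0..ereal u. exp (- 2 * W (inv (scale_fun W) (\<beta> v))))"

text \<open>\<open>None\<close> is the cemetery state. The clock is strictly increasing on the lifetime of \<open>\<beta>\<close>, so
  \<open>inv_into\<close> is its inverse there; times the clock does not reach are after the killing time.\<close>

definition killed_brox ::
    "(real \<Rightarrow> real) \<Rightarrow> real \<Rightarrow> real \<Rightarrow> (real \<Rightarrow> 'w \<Rightarrow> real) \<Rightarrow> real \<Rightarrow> 'w \<Rightarrow> real option" where
  "killed_brox W a b B t \<omega> =
     (let \<beta> = (\<lambda>u. B u \<omega>); U = bm_lifetime W a b \<beta>; T = brox_clock W \<beta> in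
      if t \<in> T ` U then Some (inv (scale_fun W) (\<beta> (inv_into U T t))) else None)"

text \<open>\<open>p\<close> is the Lebesgue density on \<open>(a,b)\<close> of the law of \<open>Y\<close> restricted to the event that \<open>Y\<close>
  is alive. Continuity selects the version of the density, so that its values at individual
  points are meaningful.\<close>

definition alive_density ::
    "'w measure \<Rightarrow> real \<Rightarrow> real \<Rightarrow> ('w \<Rightarrow> real option) \<Rightarrow> (real \<Rightarrow> real) \<Rightarrow> bool" where
  "alive_density M a b Y p \<longleftrightarrow>
     {\<omega> \<in> space M. Y \<omega> \<noteq> None} \<in> sets M \<and>
     continuous_on {a<..<b} p \<and> (\<forall>y\<in>{a<..<b}. 0 \<le> p y) \<and>
     distributed (restrict_space M {\<omega> \<in> space M. Y \<omega> \<noteq> None}) lborel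
       (\<lambda>\<omega>. the (Y \<omega>)) (\<lambda>y. indicator {a<..<b} y * ennreal (p y))"

section \<open>The generator and its eigenfunctions\<close>

text \<open>Functions on \<open>[a,b]\<close> are total functions whose values outside \<open>[a,b]\<close> are ignored;
  derivatives are one-sided at the end points.\<close>

definition generator_domain :: "(real \<Rightarrow> real) \<Rightarrow> real \<Rightarrow> real \<Rightarrow> (real \<Rightarrow> real) set" where
  "generator_domain W a b =
     {f. f a = 0 \<and> f b = 0 \<and>
         (\<exists>g g'. (\<forall>x\<in>{a..b}. (f has_real_derivative exp (W x) * g x) (at x within {a..b})) \<and>
                 (\<forall>x\<in>{a..b}. (g has_real_derivative g' x) (at x within {a..b})) \<and>
                 continuous_on {a..b} g')}"

definition generator ::
    "(real \<Rightarrow> real) \<Rightarrow> real \<Rightarrow> real \<Rightarrow> (real \<Rightarrow> real) \<Rightarrow> real \<Rightarrow> real" where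
  "generator W a b f x =
     exp (W x) / 2 *
     vector_derivative
       (\<lambda>y. exp (- W y) * vector_derivative f (at y within {a..b})) (at x within {a..b})"

definition eigenfunction ::
    "(real \<Rightarrow> real) \<Rightarrow> real \<Rightarrow> real \<Rightarrow> real \<Rightarrow> (real \<Rightarrow> real) \<Rightarrow> bool" where
  "eigenfunction W a b \<mu> \<phi> \<longleftrightarrow>
     \<phi> \<in> generator_domain W a b \<and> (\<exists>x\<in>{a..b}. \<phi> x \<noteq> 0) \<and>
     (\<forall>x\<in>{a..b}. generator W a b \<phi> x + \<mu> * \<phi> x = 0)"

definition speed_inner ::
    "(real \<Rightarrow> real) \<Rightarrow> real \<Rightarrow> real \<Rightarrow> (real \<Rightarrow> real) \<Rightarrow> (real \<Rightarrow> real) \<Rightarrow> real" where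
  "speed_inner W a b f g = (LINT x:{a..b}|speed_measure W. f x * g x)"

text \<open>\<open>lam\<close> lists all eigenvalues and \<open>phi\<close> corresponding orthonormal eigenfunctions. All
  eigenvalues are simple (\<open>\<phi>\<close> is determined by \<open>\<phi>(a) = 0\<close> and \<open>e\<^sup>-\<^sup>W\<phi>'\<close> at \<open>a\<close>), so orthogonality
  rules out repetitions and every eigenfunction is a multiple of some \<open>phi n\<close>.
  Indices start at 0.\<close>

definition eigensystem ::
    "(real \<Rightarrow> real) \<Rightarrow> real \<Rightarrow> real \<Rightarrow> (nat \<Rightarrow> real) \<Rightarrow> (nat \<Rightarrow> real \<Rightarrow> real) \<Rightarrow> bool" where
  "eigensystem W a b lam phi \<longleftrightarrow>
     (\<forall>n. eigenfunction W a b (lam n) (phi n)) \<and>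
     range lam = {\<mu>. \<exists>\<phi>. eigenfunction W a b \<mu> \<phi>} \<and>
     (\<forall>m n. speed_inner W a b (phi m) (phi n) = (if m = n then 1 else 0))"

end

theory Submission
  imports Defs "HOL-Complex_Analysis.Great_Picard"
begin

text \<open>The scale function removes the drift. In the coordinate \<open>z = s(x)\<close> the generator is
\<open>f \<mapsto> f'' / r\<close> with \<open>r(z) = 2 e\<^sup>-\<^sup>2\<^sup>W\<close> taken at \<open>s\<inverse>(z)\<close>, because the speed measure
\<open>2 e\<^sup>-\<^sup>W dx\<close> becomes \<open>r dz\<close>. Its eigenfunctions are the modes \<open>-\<psi>'' = \<lambda> r \<psi>\<close> of a vibrating
string with mass density \<open>r\<close>, clamped at \<open>\<alpha> = s(a)\<close> and \<open>\<beta> = s(b)\<close>, and the diffusion is a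
Brownian motion \<open>B\<close>, killed at \<open>\<alpha>\<close> and \<open>\<beta>\<close>, that is read when the clock
\<open>A(u) = \<integral>\<^sub>0\<^sup>u r(B)/2\<close> shows \<open>t\<close>. The theorem is proved for the string and carried back.

The law of the stopped Brownian motion is found from its integrals against the modes. Since
\<open>\<psi>''/2 + \<lambda> (r/2) \<psi> = 0\<close>, the process \<open>e\<^sup>\<lambda>\<^sup>A\<psi>(B)\<close> is a martingale up to the exit from
\<open>(\<alpha>,\<beta>)\<close>; it vanishes at the exit and equals \<open>e\<^sup>\<lambda>\<^sup>t\<psi>(B)\<close> when the clock shows \<open>t\<close>. Hence the
expectation of \<open>\<psi>\<close> at that time, on survival, is \<open>e\<^sup>-\<^sup>\<lambda>\<^sup>t\<psi>(z\<^sub>0)\<close> (\<open>expectation_mode\<close>). The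
martingale property is used in discrete time: on a grid of mesh \<open>\<delta>\<close> the drift of one step is
\<open>o(\<delta>)\<close> by Taylor's formula and the Gaussian moments (\<open>one_step_defect\<close>), the steps add up to
\<open>o(1)\<close>, and the stopped grid values converge along each path (\<open>stopped_path_limit\<close>).

The heat series \<open>q(w) = \<Sum> e\<^sup>-\<^sup>\<lambda>\<^sup>t \<psi>(z\<^sub>0) \<psi>(w)\<close> converges uniformly because \<open>\<Sum> 1/\<lambda>\<^sup>2\<close> is finite
(Bessel's inequality for the Green function), so \<open>q r dw\<close> has the same integrals against all modes
as the law. These integrals determine the measure: two measures with equal ones have Green potentials
with equal mode coefficients, and the potentials then agree because the modes are complete
(\<open>completeness\<close>). Combinations of four Green functions are trapezoids, whose limits are indicators
of intervals (\<open>tail_determined_by_moments\<close>). Completeness is the spectral theorem for the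
Green operator: if a nonzero function were orthogonal to all modes, the normalized iterates of the
operator on it would accumulate, by Arzela and Ascoli, at a function from which a mode missing from
the list can be built.

So the law has density \<open>q r\<close>, and the substitution \<open>z = s(y)\<close> turns it into
\<open>2 e\<^sup>-\<^sup>W\<^sup>(\<^sup>y\<^sup>) q(s(y))\<close>. It is nonnegative as a continuous density of a measure, and continuity
makes it the only version that \<open>alive_density\<close> admits.\<close>

section \<open>The Dirichlet problem of a string\<close>

lemma constant_derivative_interval:
  fixes f :: "real \<Rightarrow> real"
  assumes "\<And>z. z \<in> {a..b} \<Longrightarrow> (f has_real_derivative c) (at z within {a..b})" "z \<in> {a..b}"
  shows "f z = f a + c * (z - a)"
proof -
  have "((\<lambda>w. f w - c * w) has_derivative (\<lambda>_. 0)) (at w within {a..b})" if "w \<in> {a..b}" for w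
  proof -
    have "((\<lambda>w. f w - c * w) has_real_derivative c - c * 1) (at w within {a..b})"
      by (intro DERIV_diff DERIV_cmult DERIV_ident assms that)
    then show ?thesis by (simp add: has_field_derivative_def lambda_zero)
  qed
  then obtain d where "\<And>w. w \<in> {a..b} \<Longrightarrow> f w - c * w = d"
    using has_derivative_zero_constant[of "{a..b}" "\<lambda>w. f w - c * w"] by auto
  from this[of z] this[of a] assms(2) show ?thesis by (auto simp: algebra_simps)
qed

text \<open>The string on \<open>[\<alpha>,\<beta>]\<close> with mass density \<open>r\<close>: the operator \<open>f \<mapsto> - f'' / r\<close> with Dirichlet
conditions, symmetric in the space of square-integrable functions for \<open>r dz\<close>.\<close>

locale dirichlet_string =
  fixes \<alpha> \<beta> :: real and r :: "real \<Rightarrow> real"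
  assumes interval: "\<alpha> < \<beta>"
    and mass_continuous: "continuous_on {\<alpha>..\<beta>} r"
    and mass_pos: "\<And>z. z \<in> {\<alpha>..\<beta>} \<Longrightarrow> 0 < r z"
begin

abbreviation I :: "real set" where "I \<equiv> {\<alpha>..\<beta>}"

definition inner :: "(real \<Rightarrow> real) \<Rightarrow> (real \<Rightarrow> real) \<Rightarrow> real" where
  "inner f g = integral I (\<lambda>z. f z * g z * r z)"

definition poisson :: "(real \<Rightarrow> real) \<Rightarrow> (real \<Rightarrow> real) \<Rightarrow> bool" where
  "poisson f u \<longleftrightarrow> u \<alpha> = 0 \<and> u \<beta> = 0 \<and>
     (\<exists>u'. (\<forall>z\<in>I. (u has_real_derivative u' z) (at z within I)) \<and>
           (\<forall>z\<in>I. (u' has_real_derivative - (f z * r z)) (at z within I)))"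

definition mode :: "real \<Rightarrow> (real \<Rightarrow> real) \<Rightarrow> bool" where
  "mode \<mu> \<psi> \<longleftrightarrow> poisson (\<lambda>z. \<mu> * \<psi> z) \<psi>"

text \<open>Green's function of \<open>- d\<^sup>2/dz\<^sup>2\<close> on \<open>[\<alpha>,\<beta>]\<close>: as a function of either argument it is the tent with
corner at the other one.\<close>

definition green :: "real \<Rightarrow> real \<Rightarrow> real" where
  "green z w = (min z w - \<alpha>) * (\<beta> - max z w) / (\<beta> - \<alpha>)"

definition potential :: "(real \<Rightarrow> real) \<Rightarrow> real \<Rightarrow> real" where
  "potential f z = inner (green z) f"

lemma continuous_on_green: "continuous_on S (green z)"
  unfolding green_def using interval by (intro continuous_intros) auto

lemma green_commute: "green z w = green w z"
  by (simp add: green_def min.commute max.commute)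

text \<open>Combinations of Green functions whose affine parts cancel are continuous and piecewise linear with
prescribed corners; this is how indicators of intervals are approximated later.\<close>

lemma green_eq_affine_minus_hinge:
  "green z w = (w - \<alpha>) * (\<beta> - z) / (\<beta> - \<alpha>) - max 0 (w - z)"
  using interval by (auto simp: green_def min_def max_def field_simps)

lemma green_bounds:
  assumes "z \<in> I" "w \<in> I"
  shows "0 \<le> green z w" "green z w \<le> \<beta> - \<alpha>"
proof -
  show "0 \<le> green z w" using assms interval by (auto simp: green_def)
  have "(min z w - \<alpha>) * (\<beta> - max z w) \<le> (\<beta> - \<alpha>) * (\<beta> - \<alpha>)"
    using assms by (intro mult_mono) auto
  then show "green z w \<le> \<beta> - \<alpha>" using interval by (simp add: green_def field_simps)
qed

lemma green_lipschitz:
  assumes "w \<in> I"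
  shows "\<bar>green z w - green z' w\<bar> \<le> 2 * \<bar>z - z'\<bar>"
proof -
  have "(w - \<alpha>) * (\<beta> - z) / (\<beta> - \<alpha>) - (w - \<alpha>) * (\<beta> - z') / (\<beta> - \<alpha>)
      = (w - \<alpha>) / (\<beta> - \<alpha>) * (z' - z)"
    by (simp add: diff_divide_distrib[symmetric]) (simp add: algebra_simps)
  then have "\<bar>(w - \<alpha>) * (\<beta> - z) / (\<beta> - \<alpha>) - (w - \<alpha>) * (\<beta> - z') / (\<beta> - \<alpha>)\<bar>
      = (w - \<alpha>) / (\<beta> - \<alpha>) * \<bar>z - z'\<bar>"
    using assms interval by (simp add: abs_mult abs_minus_commute)
  also have "\<dots> \<le> 1 * \<bar>z - z'\<bar>"
    using assms interval by (intro mult_right_mono) (auto simp: divide_simps)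
  finally have "\<bar>(w - \<alpha>) * (\<beta> - z) / (\<beta> - \<alpha>) - (w - \<alpha>) * (\<beta> - z') / (\<beta> - \<alpha>)\<bar> \<le> \<bar>z - z'\<bar>" by simp
  moreover have "\<bar>max 0 (w - z) - max 0 (w - z')\<bar> \<le> \<bar>z - z'\<bar>" by auto
  moreover have "\<bar>(p - m) - (p' - m')\<bar> \<le> 2 * d" if "\<bar>p - p'\<bar> \<le> d" "\<bar>m - m'\<bar> \<le> d" for p p' m m' d :: real
    using that by arith
  ultimately show ?thesis
    unfolding green_eq_affine_minus_hinge by blast
qed

lemma weighted_integrable:
  assumes "continuous_on I f" "continuous_on I g"
  shows "(\<lambda>z. f z * g z * r z) integrable_on I"
  by (intro integrable_continuous_real continuous_intros assms mass_continuous)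

lemma inner_commute: "inner f g = inner g f"
  by (simp add: inner_def mult.commute)

lemma inner_cong:
  assumes "\<And>z. z \<in> I \<Longrightarrow> f z = f' z" "\<And>z. z \<in> I \<Longrightarrow> g z = g' z"
  shows "inner f g = inner f' g'"
  unfolding inner_def by (intro Henstock_Kurzweil_Integration.integral_cong) (simp add: assms)

lemma inner_combine:
  assumes "continuous_on I f" "continuous_on I g" "continuous_on I h"
  shows "inner (\<lambda>z. c * f z + d * g z) h = c * inner f h + d * inner g h"
proof -
  have "inner (\<lambda>z. c * f z + d * g z) h
      = integral I (\<lambda>z. c * (f z * h z * r z) + d * (g z * h z * r z))"
    unfolding inner_def by (simp add: algebra_simps)
  also have "\<dots> = c * inner f h + d * inner g h"
    unfolding inner_def
    by (subst Henstock_Kurzweil_Integration.integral_add)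
       (auto intro!: integrable_on_mult_right weighted_integrable assms)
  finally show ?thesis .
qed

lemma inner_scale: "inner (\<lambda>z. c * f z) h = c * inner f h"
  unfolding inner_def by (simp add: mult.assoc)

lemma inner_self_nonneg: "continuous_on I f \<Longrightarrow> 0 \<le> inner f f"
  unfolding inner_def
  by (intro Henstock_Kurzweil_Integration.integral_nonneg weighted_integrable)
     (auto intro!: mult_nonneg_nonneg[OF zero_le_square less_imp_le[OF mass_pos]])

lemma inner_self_eq_0:
  assumes "continuous_on I f" "inner f f = 0" "z \<in> I"
  shows "f z = 0"
proof -
  have "\<forall>z\<in>I. f z * f z * r z = 0"
    using assms(2) unfolding inner_def
    by (subst (asm) integral_eq_0_iff)
       (auto intro!: interval continuous_intros assms mass_continuous mult_nonneg_nonneg[OF zero_le_square less_imp_le[OF mass_pos]])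
  with assms(3) mass_pos[OF assms(3)] show ?thesis by auto
qed

lemma inner_self_combine:
  assumes "continuous_on I f" "continuous_on I g"
  shows "inner (\<lambda>z. c * f z + d * g z) (\<lambda>z. c * f z + d * g z)
     = c\<^sup>2 * inner f f + 2 * c * d * inner f g + d\<^sup>2 * inner g g"
proof -
  have *: "continuous_on I (\<lambda>z. c * f z + d * g z)"
    by (intro continuous_intros assms)
  show ?thesis
    apply (subst inner_combine[OF assms *])
    apply (subst inner_commute, subst inner_combine[OF assms assms(1)])
    apply (subst inner_commute, subst inner_combine[OF assms assms(2)])
    by (simp add: inner_commute[of g f] algebra_simps power2_eq_square)
qed

lemma inner_Cauchy_Schwarz:
  assumes "continuous_on I f" "continuous_on I g"
  shows "(inner f g)\<^sup>2 \<le> inner f f * inner g g"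
proof (cases "inner g g = 0")
  case True
  then have "inner f g = inner f (\<lambda>_. 0)"
    using inner_self_eq_0[OF assms(2)] by (intro inner_cong) auto
  then show ?thesis using True by (simp add: inner_def[of f "\<lambda>_. 0"])
next
  case False
  then have pos: "0 < inner g g" using inner_self_nonneg[OF assms(2)] by simp
  have "0 \<le> inner (\<lambda>z. inner g g * f z + (- inner f g) * g z) (\<lambda>z. inner g g * f z + (- inner f g) * g z)"
    by (intro inner_self_nonneg continuous_intros assms)
  also have "\<dots> = inner g g * (inner f f * inner g g - (inner f g)\<^sup>2)"
    by (subst inner_self_combine[OF assms]) (simp add: algebra_simps power2_eq_square)
  finally show ?thesis using pos by (simp add: zero_le_mult_iff)
qed

lemma poisson_continuous:
  assumes "poisson f u"
  shows "continuous_on I u"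
proof -
  obtain u' where "\<And>z. z \<in> I \<Longrightarrow> (u has_real_derivative u' z) (at z within I)"
    using assms unfolding poisson_def by blast
  then show ?thesis by (rule DERIV_continuous_on)
qed

lemma mode_continuous: "mode \<mu> \<psi> \<Longrightarrow> continuous_on I \<psi>"
  unfolding mode_def by (rule poisson_continuous)

lemma poisson_combine:
  assumes "poisson f u" "poisson g v"
  shows "poisson (\<lambda>z. c * f z + d * g z) (\<lambda>z. c * u z + d * v z)"
proof -
  obtain u' where u':
    "\<And>z. z \<in> I \<Longrightarrow> (u has_real_derivative u' z) (at z within I)"
    "\<And>z. z \<in> I \<Longrightarrow> (u' has_real_derivative - (f z * r z)) (at z within I)"
    using assms(1) unfolding poisson_def by blast
  obtain v' where v':
    "\<And>z. z \<in> I \<Longrightarrow> (v has_real_derivative v' z) (at z within I)"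
    "\<And>z. z \<in> I \<Longrightarrow> (v' has_real_derivative - (g z * r z)) (at z within I)"
    using assms(2) unfolding poisson_def by blast
  note d = u' v'
  show ?thesis
    unfolding poisson_def
  proof (intro conjI exI ballI)
    fix z assume z: "z \<in> I"
    show "((\<lambda>z. c * u z + d * v z) has_real_derivative c * u' z + d * v' z) (at z within I)"
      by (intro DERIV_add DERIV_cmult d z)
    have "((\<lambda>z. c * u' z + d * v' z) has_real_derivative c * - (f z * r z) + d * - (g z * r z)) (at z within I)"
      by (intro DERIV_add DERIV_cmult d z)
    then show "((\<lambda>z. c * u' z + d * v' z) has_real_derivative - ((c * f z + d * g z) * r z)) (at z within I)"
      by (simp add: algebra_simps)
  qed (use assms in \<open>auto simp: poisson_def\<close>)
qed

lemma poisson_cong: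
  assumes "poisson f u" "\<And>z. z \<in> I \<Longrightarrow> f z = g z"
  shows "poisson g u"
proof -
  have "(\<forall>z\<in>I. (u' has_real_derivative - (f z * r z)) (at z within I)) \<longleftrightarrow>
      (\<forall>z\<in>I. (u' has_real_derivative - (g z * r z)) (at z within I))" for u'
    by (rule ball_cong) (auto simp: assms(2))
  then show ?thesis using assms(1) unfolding poisson_def by simp
qed

text \<open>Affine functions that vanish at both ends vanish.\<close>

lemma poisson_zero:
  assumes "poisson f u" "\<And>z. z \<in> I \<Longrightarrow> f z = 0" "z \<in> I"
  shows "u z = 0"
proof -
  have "poisson (\<lambda>_. 0) u" using assms(1,2) by (rule poisson_cong)
  then have bd: "u \<alpha> = 0" "u \<beta> = 0"
    and "\<exists>u'. (\<forall>z\<in>I. (u has_real_derivative u' z) (at z within I)) \<and>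
      (\<forall>z\<in>I. (u' has_real_derivative 0) (at z within I))"
    by (simp_all add: poisson_def)
  then obtain u' where u': "\<And>z. z \<in> I \<Longrightarrow> (u has_real_derivative u' z) (at z within I)"
    "\<And>z. z \<in> I \<Longrightarrow> (u' has_real_derivative 0) (at z within I)"
    by blast
  have "u' w = u' \<alpha>" if "w \<in> I" for w
    using constant_derivative_interval[OF u'(2) that] by simp
  then have "(u has_real_derivative u' \<alpha>) (at w within I)" if "w \<in> I" for w
    using u'(1)[OF that] that by metis
  from constant_derivative_interval[OF this]
  have u: "u w = u' \<alpha> * (w - \<alpha>)" if "w \<in> I" for w
    using that bd by simp
  from u[of \<beta>] bd interval have "u' \<alpha> = 0" by auto
  with u assms(3) show ?thesis by simp
qed

lemma poisson_unique:
  assumes "poisson f u" "poisson f v" "z \<in> I"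
  shows "u z = v z"
  using poisson_zero[OF poisson_combine[OF assms(1,2), of 1 "-1"] _ assms(3)] by simp

text \<open>Green's second identity: \<open>u' v - u v'\<close> has derivative \<open>(u g - f v) r\<close> and vanishes at both ends.\<close>

lemma poisson_adjoint:
  assumes "poisson f u" "poisson g v"
    and "continuous_on I f" "continuous_on I g"
  shows "inner u g = inner f v"
proof -
  obtain u' where u':
    "\<And>z. z \<in> I \<Longrightarrow> (u has_real_derivative u' z) (at z within I)"
    "\<And>z. z \<in> I \<Longrightarrow> (u' has_real_derivative - (f z * r z)) (at z within I)"
    using assms(1) unfolding poisson_def by blast
  obtain v' where v':
    "\<And>z. z \<in> I \<Longrightarrow> (v has_real_derivative v' z) (at z within I)"
    "\<And>z. z \<in> I \<Longrightarrow> (v' has_real_derivative - (g z * r z)) (at z within I)"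
    using assms(2) unfolding poisson_def by blast
  note d = u' v'
  have cu: "continuous_on I u" "continuous_on I v"
    using assms poisson_continuous by auto
  have "((\<lambda>z. u z * g z * r z - f z * v z * r z) has_integral
      ((u' \<beta> * v \<beta> - u \<beta> * v' \<beta>) - (u' \<alpha> * v \<alpha> - u \<alpha> * v' \<alpha>))) I"
  proof (rule fundamental_theorem_of_calculus)
    fix z assume z: "z \<in> I"
    have "((\<lambda>z. u' z * v z - u z * v' z) has_real_derivative
        (- (f z * r z) * v z + v' z * u' z) - (u' z * v' z + - (g z * r z) * u z)) (at z within I)"
      by (intro derivative_intros d z)
    then show "((\<lambda>z. u' z * v z - u z * v' z) has_vector_derivative u z * g z * r z - f z * v z * r z) (at z within I)"
      by (simp add: has_real_derivative_iff_has_vector_derivative algebra_simps)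
  qed (use interval in auto)
  then have "integral I (\<lambda>z. u z * g z * r z - f z * v z * r z) = 0"
    using assms(1,2) by (auto simp: poisson_def intro: integral_unique)
  then show ?thesis
    unfolding inner_def
    by (subst (asm) Henstock_Kurzweil_Integration.integral_diff)
       (auto intro!: weighted_integrable assms cu)
qed

text \<open>Integration by parts turns \<open>\<langle>f, u\<rangle>\<close> into the energy \<open>\<integral> u'\<^sup>2\<close>.\<close>

lemma poisson_energy_nonneg:
  assumes "poisson f u" and "continuous_on I f"
  shows "0 \<le> inner f u"
proof -
  obtain u' where d:
    "\<And>z. z \<in> I \<Longrightarrow> (u has_real_derivative u' z) (at z within I)"
    "\<And>z. z \<in> I \<Longrightarrow> (u' has_real_derivative - (f z * r z)) (at z within I)"
    using assms(1) unfolding poisson_def by blast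
  have cu: "continuous_on I u"  "continuous_on I u'"
    by (rule DERIV_continuous_on[OF d(1)], assumption) (rule DERIV_continuous_on[OF d(2)])
  have "((\<lambda>z. u' z * u' z - f z * u z * r z) has_integral (u' \<beta> * u \<beta> - u' \<alpha> * u \<alpha>)) I"
  proof (rule fundamental_theorem_of_calculus)
    fix z assume z: "z \<in> I"
    have "((\<lambda>z. u' z * u z) has_real_derivative
        (- (f z * r z) * u z + u' z * u' z)) (at z within I)"
      by (intro derivative_intros d z)
    then show "((\<lambda>z. u' z * u z) has_vector_derivative u' z * u' z - f z * u z * r z) (at z within I)"
      by (simp add: has_real_derivative_iff_has_vector_derivative algebra_simps)
  qed (use interval in auto)
  then have "integral I (\<lambda>z. u' z * u' z - f z * u z * r z) = 0"
    using assms(1) by (auto simp: poisson_def intro: integral_unique)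
  then have "inner f u = integral I (\<lambda>z. u' z * u' z)"
    unfolding inner_def
    by (subst (asm) Henstock_Kurzweil_Integration.integral_diff)
       (auto intro!: weighted_integrable integrable_continuous_real continuous_intros assms cu mass_continuous)
  then show ?thesis
    by (simp only:, intro Henstock_Kurzweil_Integration.integral_nonneg)
       (auto intro!: integrable_continuous_real continuous_intros cu)
qed

text \<open>Splitting the Green function at its corner writes the potential as an affine function minus
\<open>\<integral>\<^sub>\<alpha>\<^sup>z (z - w) f r dw\<close>, whose second derivative is \<open>f r\<close>.\<close>

lemma poisson_potential:
  assumes f: "continuous_on I f"
  shows "poisson f (potential f)"
proof -
  define k where "k w = f w * r w" for w
  have k: "continuous_on I k" unfolding k_def by (intro continuous_intros f mass_continuous)
  define C where "C = integral I (\<lambda>w. (\<beta> - w) * k w) / (\<beta> - \<alpha>)"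
  define k1 where "k1 z = integral {\<alpha>..z} k" for z
  define k2 where "k2 z = integral {\<alpha>..z} (\<lambda>w. w * k w)" for z
  have k1: "(k1 has_real_derivative k z) (at z within I)" if "z \<in> I" for z
    unfolding k1_def by (rule integral_has_real_derivative[OF k that])
  have k2: "(k2 has_real_derivative z * k z) (at z within I)" if "z \<in> I" for z
    unfolding k2_def by (rule integral_has_real_derivative[OF _ that]) (intro continuous_intros k)
  have eq: "potential f z = C * (z - \<alpha>) - (z * k1 z - k2 z)" if z: "z \<in> I" for z
  proof -
    have hinge: "((\<lambda>w. max 0 (z - w) * k w) has_integral ((z * k1 z - k2 z) + 0)) I"
    proof (rule has_integral_combine)
      have kz: "continuous_on {\<alpha>..z} k" using continuous_on_subset[OF k] z by auto
      have "((\<lambda>w. z * k w - w * k w) has_integral (z * k1 z - k2 z)) {\<alpha>..z}"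
        unfolding k1_def k2_def
        by (intro has_integral_diff has_integral_mult_right integrable_integral
            integrable_continuous_real continuous_intros kz)
      then show "((\<lambda>w. max 0 (z - w) * k w) has_integral (z * k1 z - k2 z)) {\<alpha>..z}"
        by (rule has_integral_eq[rotated]) (auto simp: max_def algebra_simps)
      show "((\<lambda>w. max 0 (z - w) * k w) has_integral 0) {z..\<beta>}"
        by (rule has_integral_is_0) (auto simp: max_def)
    qed (use z in auto)
    have affine: "((\<lambda>w. (z - \<alpha>) / (\<beta> - \<alpha>) * ((\<beta> - w) * k w)) has_integral
        (z - \<alpha>) / (\<beta> - \<alpha>) * integral I (\<lambda>w. (\<beta> - w) * k w)) I"
      by (intro has_integral_mult_right integrable_integral integrable_continuous_real continuous_intros k)
    have "((\<lambda>w. (z - \<alpha>) / (\<beta> - \<alpha>) * ((\<beta> - w) * k w) - max 0 (z - w) * k w) has_integral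
        (z - \<alpha>) / (\<beta> - \<alpha>) * integral I (\<lambda>w. (\<beta> - w) * k w) - ((z * k1 z - k2 z) + 0)) I"
      by (rule has_integral_diff[OF affine hinge])
    moreover have "(\<lambda>w. (z - \<alpha>) / (\<beta> - \<alpha>) * ((\<beta> - w) * k w) - max 0 (z - w) * k w)
        = (\<lambda>w. green z w * f w * r w)"
      by (simp add: green_commute[of z] green_eq_affine_minus_hinge[of _ z] k_def left_diff_distrib mult.assoc)
    ultimately have "((\<lambda>w. green z w * f w * r w) has_integral
        (z - \<alpha>) / (\<beta> - \<alpha>) * integral I (\<lambda>w. (\<beta> - w) * k w) - (z * k1 z - k2 z)) I" by simp
    then show ?thesis
      by (simp add: potential_def inner_def C_def integral_unique)
  qed
  show ?thesis
    unfolding poisson_def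
  proof (intro conjI exI ballI)
    have "inner (green e) f = inner (\<lambda>_. 0) f" if "e = \<alpha> \<or> e = \<beta>" for e
      using that by (intro inner_cong) (auto simp: green_def min_def max_def)
    then show "potential f \<alpha> = 0" "potential f \<beta> = 0"
      by (auto simp: potential_def inner_def)
  next
    fix z assume z: "z \<in> I"
    have "((\<lambda>z. C * (z - \<alpha>) - (z * k1 z - k2 z)) has_real_derivative
        C * (1 - 0) - ((1 * k1 z + k z * z) - z * k z)) (at z within I)"
      by (intro DERIV_diff DERIV_cmult DERIV_mult DERIV_ident DERIV_const k1 k2 z)
    then have "((\<lambda>z. C * (z - \<alpha>) - (z * k1 z - k2 z)) has_real_derivative (C - k1 z)) (at z within I)"
      by (simp add: algebra_simps)
    then show "(potential f has_real_derivative (C - k1 z)) (at z within I)"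
      by (rule has_field_derivative_transform_within[OF _ zero_less_one z]) (simp add: eq)
    have "((\<lambda>z. C - k1 z) has_real_derivative 0 - k z) (at z within I)"
      by (intro derivative_intros k1 z)
    then show "((\<lambda>z. C - k1 z) has_real_derivative - (f z * r z)) (at z within I)"
      by (simp add: k_def)
  qed
qed

lemma potential_continuous: "continuous_on I f \<Longrightarrow> continuous_on I (potential f)"
  using poisson_potential poisson_continuous by blast

lemma potential_symmetric:
  assumes "continuous_on I f" "continuous_on I g"
  shows "inner (potential f) g = inner f (potential g)"
  using poisson_adjoint[OF poisson_potential poisson_potential] assms by blast

lemma poisson_eq_potential:
  assumes "poisson f u" "continuous_on I f" "z \<in> I"
  shows "u z = potential f z"
  using poisson_unique[OF assms(1) poisson_potential[OF assms(2)] assms(3)] .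

text \<open>The modes are the eigenvectors of the Green operator, with eigenvalues \<open>1/\<mu>\<close>; this direction
lets moments of potentials be computed from moments of modes.\<close>

lemma mode_eq_potential:
  assumes "mode \<mu> \<psi>" "z \<in> I"
  shows "\<psi> z = \<mu> * potential \<psi> z"
proof -
  have c: "continuous_on I (\<lambda>z. \<mu> * \<psi> z)"
    using mode_continuous[OF assms(1)] by (rule continuous_on_mult_left)
  have "poisson (\<lambda>z. \<mu> * \<psi> z) \<psi>" using assms(1) by (simp add: mode_def)
  from poisson_eq_potential[OF this c assms(2)]
  have "\<psi> z = potential (\<lambda>z. \<mu> * \<psi> z) z" .
  also have "\<dots> = \<mu> * potential \<psi> z"
    by (simp add: potential_def inner_commute[of "green z"] inner_scale)
  finally show ?thesis .
qed

lemma potential_eigenvector_mode: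
  assumes "continuous_on I g" "\<kappa> \<noteq> 0" "\<And>z. z \<in> I \<Longrightarrow> potential g z = \<kappa> * g z"
  shows "mode (1 / \<kappa>) (\<lambda>z. potential g z)"
  unfolding mode_def
  by (rule poisson_cong[OF poisson_potential[OF assms(1)]]) (simp add: assms)

lemma mode_eigenvalue_pos:
  assumes "mode \<mu> \<psi>" "z \<in> I" "\<psi> z \<noteq> 0"
  shows "0 < \<mu>"
proof -
  have c: "continuous_on I \<psi>" using assms(1) by (rule mode_continuous)
  have "poisson (\<lambda>z. \<mu> * \<psi> z) \<psi>" using assms(1) by (simp add: mode_def)
  from poisson_energy_nonneg[OF this continuous_on_mult_left[OF c]]
  have "0 \<le> inner (\<lambda>z. \<mu> * \<psi> z) \<psi>" .
  then have "0 \<le> \<mu> * inner \<psi> \<psi>" by (simp add: inner_scale)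
  moreover have "inner \<psi> \<psi> > 0"
    using inner_self_nonneg[OF c] inner_self_eq_0[OF c _ assms(2)] assms(3) by linarith
  ultimately have "0 \<le> \<mu>" by (simp add: zero_le_mult_iff)
  moreover have "\<mu> \<noteq> 0" using mode_eq_potential[OF assms(1,2)] assms(3) by auto
  ultimately show ?thesis by simp
qed

end

lemma continuous_on_Icc_bounded:
  fixes f :: "real \<Rightarrow> real"
  assumes "continuous_on {a..b} f"
  obtains R where "0 < R" "\<And>x. x \<in> {a..b} \<Longrightarrow> \<bar>f x\<bar> \<le> R"
  using compact_imp_bounded[OF compact_continuous_image[OF assms compact_Icc]]
  unfolding bounded_pos by (metis image_eqI real_norm_def)

context dirichlet_string begin

text \<open>Uniqueness for the initial value problem at \<open>\<alpha>\<close>, by Gronwall's argument for \<open>y\<^sup>2 + y'\<^sup>2\<close>.\<close>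

lemma mode_zero_slope:
  assumes y: "\<And>z. z \<in> I \<Longrightarrow> (y has_real_derivative y' z) (at z within I)"
    and y': "\<And>z. z \<in> I \<Longrightarrow> (y' has_real_derivative - (\<mu> * y z * r z)) (at z within I)"
    and init: "y \<alpha> = 0" "y' \<alpha> = 0" and z: "z \<in> I"
  shows "y z = 0"
proof (cases "z = \<alpha>")
  case False
  then have lt: "\<alpha> < z" using z by auto
  obtain R where R: "\<And>w. w \<in> I \<Longrightarrow> \<bar>r w\<bar> \<le> R"
    using continuous_on_Icc_bounded[OF mass_continuous] by blast
  define C where "C = 1 + \<bar>\<mu>\<bar> * R"
  \<comment> \<open>\<open>C\<close> bounds the logarithmic growth rate of \<open>y\<^sup>2 + y'\<^sup>2\<close>, so \<open>e\<close> decreases from 0.\<close>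
  define e where "e w = ((y w)\<^sup>2 + (y' w)\<^sup>2) * exp (- C * w)" for w
  define e' where "e' w = (2 * (y w * y' w) * (1 - \<mu> * r w) - C * ((y w)\<^sup>2 + (y' w)\<^sup>2)) * exp (- C * w)" for w
  have e: "(e has_real_derivative e' w) (at w within {\<alpha>..z})" if "w \<in> {\<alpha>..z}" for w
  proof -
    have w: "w \<in> I" using that z by auto
    have sub: "{\<alpha>..z} \<subseteq> I" using z by auto
    note d = DERIV_subset[OF y[OF w] sub] DERIV_subset[OF y'[OF w] sub]
    show ?thesis
      unfolding e_def e'_def
      by (rule derivative_eq_intros d refl)+ (simp add: algebra_simps power2_eq_square)
  qed
  have "e' w \<le> 0" if "w \<in> {\<alpha>..z}" for w
  proof -
    have w: "w \<in> I" using that z by auto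
    have "\<bar>1 - \<mu> * r w\<bar> \<le> C"
      using mult_left_mono[OF R[OF w], of "\<bar>\<mu>\<bar>"] unfolding C_def by (simp flip: abs_mult)
    moreover have "2 * \<bar>y w * y' w\<bar> \<le> (y w)\<^sup>2 + (y' w)\<^sup>2"
      using sum_squares_bound[of "\<bar>y w\<bar>" "\<bar>y' w\<bar>"] by (simp add: abs_mult)
    ultimately have "\<bar>2 * (y w * y' w)\<bar> * \<bar>1 - \<mu> * r w\<bar> \<le> ((y w)\<^sup>2 + (y' w)\<^sup>2) * C"
      by (intro mult_mono) auto
    then have "2 * (y w * y' w) * (1 - \<mu> * r w) \<le> C * ((y w)\<^sup>2 + (y' w)\<^sup>2)"
      by (metis abs_le_D1 abs_mult mult.commute)
    then show ?thesis unfolding e'_def by (simp add: mult_nonpos_nonneg)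
  qed
  moreover obtain x where "x \<in> {\<alpha><..<z}" "e z - e \<alpha> = e' x * (z - \<alpha>)"
    using mvt_simple[OF lt, of e "\<lambda>w. (*) (e' w)"] e unfolding has_field_derivative_def by auto
  ultimately have "e z \<le> 0"
    using lt by (auto simp: e_def init mult_nonpos_nonneg)
  then have "(y z)\<^sup>2 + (y' z)\<^sup>2 \<le> 0" unfolding e_def by (simp add: mult_le_0_iff)
  then show ?thesis by (simp add: sum_power2_le_zero_iff)
qed (use init in simp)

text \<open>Eigenvalues are simple: a combination of two modes with slope 0 at \<open>\<alpha>\<close> vanishes, so the modes are
proportional, and orthogonal proportional functions cannot both be nonzero.\<close>

lemma mode_simple:
  assumes \<phi>: "mode \<mu> \<phi>" and \<psi>: "mode \<mu> \<psi>" and orth: "inner \<phi> \<psi> = 0"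
    and nz: "w \<in> I" "\<psi> w \<noteq> 0" and z: "z \<in> I"
  shows "\<phi> z = 0"
proof -
  obtain \<phi>' where d\<phi>: "\<And>z. z \<in> I \<Longrightarrow> (\<phi> has_real_derivative \<phi>' z) (at z within I)"
    "\<And>z. z \<in> I \<Longrightarrow> (\<phi>' has_real_derivative - (\<mu> * \<phi> z * r z)) (at z within I)" "\<phi> \<alpha> = 0"
    using \<phi> unfolding mode_def poisson_def by blast
  obtain \<psi>' where d\<psi>: "\<And>z. z \<in> I \<Longrightarrow> (\<psi> has_real_derivative \<psi>' z) (at z within I)"
    "\<And>z. z \<in> I \<Longrightarrow> (\<psi>' has_real_derivative - (\<mu> * \<psi> z * r z)) (at z within I)" "\<psi> \<alpha> = 0"
    using \<psi> unfolding mode_def poisson_def by blast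
  have c: "continuous_on I \<phi>" "continuous_on I \<psi>"
    using \<phi> \<psi> mode_continuous by auto
  have slope: "\<psi>' \<alpha> \<noteq> 0"
    using mode_zero_slope[OF d\<psi>(1,2,3) _ nz(1)] nz(2) by blast
  have zero: "\<psi>' \<alpha> * \<phi> z + (- \<phi>' \<alpha>) * \<psi> z = 0" if "z \<in> I" for z
  proof (rule mode_zero_slope[where \<mu> = \<mu> and y' = "\<lambda>z. \<psi>' \<alpha> * \<phi>' z + (- \<phi>' \<alpha>) * \<psi>' z", OF _ _ _ _ that])
    fix z assume z: "z \<in> I"
    show "((\<lambda>z. \<psi>' \<alpha> * \<phi> z + (- \<phi>' \<alpha>) * \<psi> z) has_real_derivative \<psi>' \<alpha> * \<phi>' z + (- \<phi>' \<alpha>) * \<psi>' z) (at z within I)"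
      by (intro DERIV_add DERIV_cmult d\<phi> d\<psi> z)
    have "((\<lambda>z. \<psi>' \<alpha> * \<phi>' z + (- \<phi>' \<alpha>) * \<psi>' z) has_real_derivative
       \<psi>' \<alpha> * - (\<mu> * \<phi> z * r z) + (- \<phi>' \<alpha>) * - (\<mu> * \<psi> z * r z)) (at z within I)"
      by (intro DERIV_add DERIV_cmult d\<phi> d\<psi> z)
    then show "((\<lambda>z. \<psi>' \<alpha> * \<phi>' z + (- \<phi>' \<alpha>) * \<psi>' z) has_real_derivative
       - (\<mu> * (\<psi>' \<alpha> * \<phi> z + (- \<phi>' \<alpha>) * \<psi> z) * r z)) (at z within I)"
      by (simp add: algebra_simps)
  qed (use d\<phi>(3) d\<psi>(3) in auto)
  have "0 = inner (\<lambda>z. \<psi>' \<alpha> * \<phi> z + (- \<phi>' \<alpha>) * \<psi> z) \<phi>"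
    using inner_cong[of "\<lambda>z. \<psi>' \<alpha> * \<phi> z + (- \<phi>' \<alpha>) * \<psi> z" "\<lambda>_. 0" \<phi> \<phi>] zero by (simp add: inner_def)
  also have "\<dots> = \<psi>' \<alpha> * inner \<phi> \<phi>"
    using orth by (subst inner_combine[OF c c(1)]) (simp add: inner_commute)
  finally have "inner \<phi> \<phi> = 0" using slope by simp
  then show ?thesis by (rule inner_self_eq_0[OF c(1) _ z])
qed

definition mass :: real where "mass = integral I r"

lemma mass_total_pos: "0 < mass"
proof -
  have "0 \<le> mass" unfolding mass_def
    using mass_pos by (intro Henstock_Kurzweil_Integration.integral_nonneg integrable_continuous_real mass_continuous) (auto intro: less_imp_le)
  moreover have "mass \<noteq> 0"
    unfolding mass_def using integral_eq_0_iff[OF mass_continuous interval] mass_pos interval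
    by (metis atLeastAtMost_iff less_eq_real_def order_less_irrefl)
  ultimately show ?thesis by simp
qed

lemma inner_self_bound:
  assumes g: "continuous_on I g" and "\<And>z. z \<in> I \<Longrightarrow> \<bar>g z\<bar> \<le> c"
  shows "inner g g \<le> c\<^sup>2 * mass"
proof -
  have "inner g g \<le> integral I (\<lambda>z. c\<^sup>2 * r z)"
    unfolding inner_def
  proof (rule integral_le[OF weighted_integrable[OF g g]])
    show "(\<lambda>z. c\<^sup>2 * r z) integrable_on I"
      by (intro integrable_continuous_real continuous_intros mass_continuous)
    fix z assume z: "z \<in> I"
    have "\<bar>g z\<bar> * \<bar>g z\<bar> \<le> c * c" using assms(2)[OF z] by (intro mult_mono) auto
    then show "g z * g z * r z \<le> c\<^sup>2 * r z"
      using mass_pos[OF z] by (intro mult_right_mono) (auto simp: power2_eq_square)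
  qed
  also have "\<dots> = c\<^sup>2 * mass" by (simp add: mass_def)
  finally show ?thesis .
qed

lemma green_energy:
  assumes "z \<in> I"
  shows "inner (green z) (green z) \<le> (\<beta> - \<alpha>)\<^sup>2 * mass"
  using green_bounds[OF assms] by (intro inner_self_bound continuous_on_green) auto

text \<open>The Cauchy--Schwarz inequality with a uniform bound for one factor. Applied to a Green function and
to a difference of two of them it bounds potentials and their Lipschitz constants by the norm of
\<open>f\<close> alone, which is the compactness of the Green operator.\<close>

lemma abs_inner_le:
  assumes "continuous_on I f" "continuous_on I g"
    and "\<And>z. z \<in> I \<Longrightarrow> \<bar>g z\<bar> \<le> c" "0 \<le> c"
  shows "\<bar>inner g f\<bar> \<le> c * sqrt (mass * inner f f)"
proof -
  have "(inner g f)\<^sup>2 \<le> inner g g * inner f f" by (rule inner_Cauchy_Schwarz) fact+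
  also have "\<dots> \<le> c\<^sup>2 * mass * inner f f"
    by (intro mult_right_mono inner_self_bound inner_self_nonneg) fact+
  finally have "\<bar>inner g f\<bar> \<le> sqrt (c\<^sup>2 * (mass * inner f f))"
    by (intro real_le_rsqrt) (simp add: mult.assoc)
  also have "\<dots> = c * sqrt (mass * inner f f)" using assms(4) by (simp add: real_sqrt_mult)
  finally show ?thesis .
qed

lemma potential_bound:
  assumes "continuous_on I f" "z \<in> I"
  shows "\<bar>potential f z\<bar> \<le> (\<beta> - \<alpha>) * sqrt (mass * inner f f)"
  unfolding potential_def
  using green_bounds[OF assms(2)] interval
  by (intro abs_inner_le continuous_on_green assms) auto

lemma potential_lipschitz:
  assumes f: "continuous_on I f"
  shows "\<bar>potential f z - potential f z'\<bar> \<le> 2 * \<bar>z - z'\<bar> * sqrt (mass * inner f f)"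
proof -
  have eq: "potential f z - potential f z' = inner (\<lambda>w. 1 * green z w + (- 1) * green z' w) f"
    unfolding potential_def
    by (subst inner_combine) (auto intro!: continuous_on_green f)
  have "\<bar>inner (\<lambda>w. 1 * green z w + (- 1) * green z' w) f\<bar>
      \<le> 2 * \<bar>z - z'\<bar> * sqrt (mass * inner f f)"
    using green_lipschitz by (intro abs_inner_le continuous_intros continuous_on_green f) auto
  then show ?thesis unfolding eq .
qed

lemma uniform_limit_inner:
  assumes h: "\<And>k. continuous_on I (h k)" and l: "continuous_on I l"
    and g: "continuous_on I g"
    and lim: "uniform_limit I h l sequentially"
  shows "(\<lambda>k. inner (h k) g) \<longlonglongrightarrow> inner l g"
proof (rule LIMSEQ_I)
  fix e :: real assume "0 < e"
  define c where "c = e / (2 * (sqrt (mass * inner g g) + 1))"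
  have S: "0 \<le> sqrt (mass * inner g g)"
    using mass_total_pos inner_self_nonneg[OF g] by simp
  have "0 < 2 * (s + 1)" if "0 \<le> s" for s :: real using that by (simp add: add_nonneg_pos)
  from this[OF S]
  have c: "0 < c" unfolding c_def using \<open>0 < e\<close> by (intro divide_pos_pos)
  have "\<forall>\<^sub>F k in sequentially. \<forall>z\<in>I. dist (h k z) (l z) < c"
    using lim c unfolding uniform_limit_iff by blast
  then obtain N where N: "\<And>k z. N \<le> k \<Longrightarrow> z \<in> I \<Longrightarrow> \<bar>h k z - l z\<bar> < c"
    unfolding eventually_sequentially dist_real_def by blast
  show "\<exists>N. \<forall>k\<ge>N. norm (inner (h k) g - inner l g) < e"
  proof (intro exI allI impI)
    fix k assume k: "N \<le> k"
    have eq: "inner (h k) g - inner l g = inner (\<lambda>w. 1 * h k w + (- 1) * l w) g"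
      by (subst inner_combine) (auto intro!: h l g)
    have "\<bar>inner (h k) g - inner l g\<bar> \<le> c * sqrt (mass * inner g g)"
      unfolding eq
      using N[OF k] c by (intro abs_inner_le continuous_intros h l g) (auto intro: less_imp_le)
    also have "\<dots> < e"
    proof -
      have "e / (2 * (s + 1)) * s < e" if "0 \<le> s" for s
      proof -
        have "s / (2 * (s + 1)) < 1" using that by (simp add: divide_less_eq)
        from mult_strict_left_mono[OF this \<open>0 < e\<close>] show ?thesis by simp
      qed
      from this[OF S] show ?thesis unfolding c_def .
    qed
    finally show "norm (inner (h k) g - inner l g) < e" by simp
  qed
qed

end

section \<open>Completeness of the eigenfunctions\<close>

text \<open>An orthonormal sequence of modes in which every eigenvalue occurs. By simplicity of the eigenvalues
every mode is then a multiple of a listed one.\<close>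

locale string_eigensystem = dirichlet_string +
  fixes lam :: "nat \<Rightarrow> real" and psi :: "nat \<Rightarrow> real \<Rightarrow> real"
  assumes modes: "\<And>n. mode (lam n) (psi n)"
    and orthonormal: "\<And>m n. inner (psi m) (psi n) = (if m = n then 1 else 0)"
    and exhaustive: "\<And>\<mu> \<phi> w. mode \<mu> \<phi> \<Longrightarrow> w \<in> I \<Longrightarrow> \<phi> w \<noteq> 0 \<Longrightarrow> \<mu> \<in> range lam"
begin

lemma psi_continuous: "continuous_on I (psi n)"
  using modes by (rule mode_continuous)

lemma psi_nonzero: "\<exists>w\<in>I. psi n w \<noteq> 0"
proof (rule ccontr)
  assume "\<not> ?thesis"
  then have "inner (psi n) (psi n) = inner (\<lambda>_. 0) (psi n)" by (intro inner_cong) auto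
  with orthonormal[of n n] show False by (simp add: inner_def)
qed

lemma lam_pos: "0 < lam n"
  using psi_nonzero[of n] mode_eigenvalue_pos[OF modes] by blast

lemma inner_potential_psi:
  assumes "continuous_on I f"
  shows "inner (potential f) (psi n) = inner f (psi n) / lam n"
proof -
  have "lam n * inner (potential f) (psi n) = inner f (\<lambda>z. lam n * potential (psi n) z)"
    by (simp add: potential_symmetric[OF assms psi_continuous] inner_commute[of f] inner_scale)
  also have "\<dots> = inner f (psi n)"
    by (intro inner_cong) (simp_all add: mode_eq_potential[OF modes, symmetric])
  finally show ?thesis using lam_pos[of n] by (simp add: field_simps)
qed

text \<open>The eigenvalue of such a mode is listed, and simplicity makes the mode a multiple of the listed one,
to which it is orthogonal.\<close>

lemma orthogonal_mode_zero:
  assumes m: "mode \<mu> \<phi>" and orth: "\<And>n. inner \<phi> (psi n) = 0" and z: "z \<in> I"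
  shows "\<phi> z = 0"
proof (rule ccontr)
  assume "\<phi> z \<noteq> 0"
  then obtain n where "\<mu> = lam n" using exhaustive[OF m z] by auto
  moreover obtain w where "w \<in> I" "psi n w \<noteq> 0" using psi_nonzero by blast
  ultimately have "\<phi> z = 0"
    using mode_simple[of \<mu> \<phi> "psi n" w z] m modes[of n] orth z by auto
  with \<open>\<phi> z \<noteq> 0\<close> show False by simp
qed

text \<open>The second derivative of the potential recovers \<open>- f r\<close>.\<close>

lemma potential_inj:
  assumes f: "continuous_on I f" and zero: "\<And>z. z \<in> I \<Longrightarrow> potential f z = 0"
    and z: "z \<in> I"
  shows "f z = 0"
proof -
  obtain u' where d: "\<And>z. z \<in> I \<Longrightarrow> (potential f has_real_derivative u' z) (at z within I)"
    "\<And>z. z \<in> I \<Longrightarrow> (u' has_real_derivative - (f z * r z)) (at z within I)"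
    using poisson_potential[OF f] unfolding poisson_def by blast
  have unique: "D = 0" if w: "w \<in> I" and D: "(g has_real_derivative D) (at w within I)"
    and g: "\<And>z. z \<in> I \<Longrightarrow> g z = 0" for g D w
  proof (rule has_field_derivative_unique)
    show "((\<lambda>_. 0) has_real_derivative D) (at w within I)"
      by (rule has_field_derivative_transform_within[OF D zero_less_one w]) (simp add: g)
    show "at w within I \<noteq> bot" using w interval by (simp add: trivial_limit_within)
  qed simp
  have "u' w = 0" if w: "w \<in> I" for w
    by (rule unique[OF w d(1)[OF w] zero])
  from unique[OF z d(2)[OF z] this] have "f z * r z = 0" by simp
  then show ?thesis using mass_pos[OF z] by simp
qed

lemma inner_scale_right: "inner f (\<lambda>z. c * g z) = c * inner f g"
  using inner_scale[of c g f] by (simp add: inner_commute)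

lemma inner_combine_right:
  assumes "continuous_on I f" "continuous_on I g" "continuous_on I h"
  shows "inner h (\<lambda>z. c * f z + d * g z) = c * inner h f + d * inner h g"
  using inner_combine[OF assms, of c d] by (simp add: inner_commute)

lemma potential_combine:
  assumes "continuous_on I f" "continuous_on I g"
  shows "potential (\<lambda>z. c * f z + d * g z) z = c * potential f z + d * potential g z"
  unfolding potential_def by (rule inner_combine_right[OF assms continuous_on_green])

lemma potential_scale: "potential (\<lambda>w. c * f w) z = c * potential f z"
  unfolding potential_def by (rule inner_scale_right)

text \<open>The spectral theorem for the Green operator \<open>K\<close>, by power iteration. On a nonzero \<open>f\<close> orthogonal to
all modes, the ratios of squared norms of consecutive iterates \<open>K\<^sup>k f\<close> increase to a limit \<open>\<mu>\<close>, and the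
normalized iterates are asymptotic eigenvectors of \<open>K\<^sup>2\<close> for \<open>\<mu>\<close>. They are bounded and
equicontinuous, so a subsequence converges to an exact eigenvector \<open>l\<close> of \<open>K\<^sup>2\<close> of norm 1 that is
orthogonal to all modes. Factoring \<open>K\<^sup>2 - \<mu>\<close> gives an eigenvector of \<open>K\<close>, for \<open>\<surd>\<mu>\<close> or for \<open>-\<surd>\<mu>\<close>:
the first contradicts the list of modes, the second the positivity of eigenvalues.\<close>

lemma completeness:
  assumes f: "continuous_on I f" and orth: "\<And>n. inner f (psi n) = 0" and z: "z \<in> I"
  shows "f z = 0"
proof (rule ccontr)
  assume nz: "f z \<noteq> 0"
  define F where "F k = (potential ^^ k) f" for k
  have FS: "F (Suc k) = potential (F k)" for k by (simp add: F_def)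
  have cF: "continuous_on I (F k)" for k
    by (induction k) (simp_all add: FS potential_continuous, simp add: F_def f)
  have oF: "inner (F k) (psi n) = 0" for k n
    by (induction k) (simp_all add: FS inner_potential_psi cF, simp add: F_def orth)
  have nzF: "\<exists>w\<in>I. F k w \<noteq> 0" for k
  proof (induction k)
    case 0 show ?case using nz z by (auto simp: F_def)
  next
    case (Suc k) then show ?case using potential_inj[OF cF[of k]] by (metis FS)
  qed
  define b where "b k = inner (F k) (F k)" for k
  have bpos: "0 < b k" for k
    using nzF[of k] inner_self_nonneg[OF cF[of k]] inner_self_eq_0[OF cF[of k]]
    unfolding b_def by (metis order_le_less)
  have b1: "inner (F (Suc (Suc k))) (F k) = b (Suc k)" for k
    unfolding b_def FS[of "Suc k"] by (subst potential_symmetric[OF cF cF]) (simp add: FS)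
  define \<rho> where "\<rho> k = b (Suc k) / b k" for k
  have \<rho>pos: "0 < \<rho> k" for k by (simp add: \<rho>_def bpos)
  \<comment> \<open>Cauchy--Schwarz for \<open>\<langle>K\<^sup>2 F\<^sub>k, F\<^sub>k\<rangle> = b\<^sub>k\<^sub>+\<^sub>1\<close>: the norms are log-convex.\<close>
  have "(b (Suc k))\<^sup>2 \<le> b (Suc (Suc k)) * b k" for k
    using inner_Cauchy_Schwarz[OF cF[of "Suc (Suc k)"] cF[of k]] unfolding b1 by (simp add: b_def)
  then have inc: "\<rho> k \<le> \<rho> (Suc k)" for k
    using bpos by (simp add: \<rho>_def field_simps power2_eq_square)
  have "\<rho> k \<le> ((\<beta> - \<alpha>) * mass)\<^sup>2" for k
  proof -
    have "b (Suc k) \<le> ((\<beta> - \<alpha>) * sqrt (mass * b k))\<^sup>2 * mass"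
      unfolding b_def FS by (intro inner_self_bound potential_bound potential_continuous cF)
    also have "\<dots> = ((\<beta> - \<alpha>) * mass)\<^sup>2 * b k"
      using bpos[of k] mass_total_pos by (simp add: power_mult_distrib) (simp add: power2_eq_square)
    finally show ?thesis using bpos[of k] by (simp add: \<rho>_def field_simps)
  qed
  then obtain \<mu> where \<mu>: "\<rho> \<longlonglongrightarrow> \<mu>" and \<mu>ge: "\<And>k. \<rho> k \<le> \<mu>"
    using incseq_convergent[of \<rho> "((\<beta> - \<alpha>) * mass)\<^sup>2"] inc by (auto simp: incseq_Suc_iff)
  have \<mu>pos: "0 < \<mu>" using \<rho>pos[of 0] \<mu>ge[of 0] by linarith
  define \<kappa> where "\<kappa> = sqrt \<mu>"
  have \<kappa>: "0 < \<kappa>" "\<kappa> * \<kappa> = \<mu>" using \<mu>pos by (auto simp: \<kappa>_def)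
  define e where "e k w = (1 / sqrt (b k)) * F k w" for k w
  have ce: "continuous_on I (e k)" for k
    unfolding e_def by (intro continuous_intros cF)
  have ee: "inner (e k) (e k) = 1" for k
    unfolding e_def inner_scale inner_scale_right b_def[symmetric]
    using bpos[of k] by simp
  \<comment> \<open>\<open>D\<^sub>k = K\<^sup>2 e\<^sub>k - \<mu> e\<^sub>k\<close>, the failure of \<open>e\<^sub>k\<close> to be an eigenvector.\<close>
  define D where "D k w = 1 * ((1 / sqrt (b k)) * F (Suc (Suc k)) w) + (- \<mu>) * e k w" for k w
  have cD: "continuous_on I (D k)" for k
    unfolding D_def by (intro continuous_intros cF ce)
  have DD: "inner (D k) (D k) = \<rho> (Suc k) * \<rho> k - 2 * \<mu> * \<rho> k + \<mu>\<^sup>2" for k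
  proof -
    have "inner (D k) (D k) = b (Suc (Suc k)) / b k - 2 * \<mu> * (b (Suc k) / b k) + \<mu>\<^sup>2"
      unfolding D_def
      apply (subst inner_self_combine[OF continuous_on_mult_left[OF cF] ce])
      unfolding ee unfolding e_def inner_scale inner_scale_right b1 b_def[symmetric]
      using bpos[of k] by simp
    then show ?thesis using bpos[of k] bpos[of "Suc k"] by (simp add: \<rho>_def)
  qed
  have DD0: "(\<lambda>k. inner (D k) (D k)) \<longlonglongrightarrow> 0"
  proof -
    have "(\<lambda>k. \<rho> (Suc k) * \<rho> k - 2 * \<mu> * \<rho> k + \<mu>\<^sup>2) \<longlonglongrightarrow> \<mu> * \<mu> - 2 * \<mu> * \<mu> + \<mu>\<^sup>2"
      by (intro tendsto_intros LIMSEQ_Suc \<mu>)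
    then show ?thesis unfolding DD by (simp add: power2_eq_square)
  qed
  have eS: "e (Suc k) w = potential (\<lambda>w. (1 / sqrt (b (Suc k))) * F k w) w" for k w
    unfolding potential_scale e_def FS ..
  define S where "S = sqrt (mass * (1 / \<rho> 0))"
  have S0: "0 \<le> S" unfolding S_def using mass_total_pos \<rho>pos[of 0] by simp
  \<comment> \<open>\<open>e\<^sub>k\<^sub>+\<^sub>1\<close> is the potential of a function whose norm is at most \<open>1/\<surd>\<rho>\<^sub>0\<close>.\<close>
  have preS: "sqrt (mass * inner (\<lambda>w. (1 / sqrt (b (Suc k))) * F k w) (\<lambda>w. (1 / sqrt (b (Suc k))) * F k w)) \<le> S" for k
  proof -
    have "\<rho> 0 \<le> \<rho> k" by (induction k) (use inc order_trans in auto)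
    then have "1 / \<rho> k \<le> 1 / \<rho> 0" using \<rho>pos by (simp add: frac_le)
    moreover have "inner (\<lambda>w. (1 / sqrt (b (Suc k))) * F k w) (\<lambda>w. (1 / sqrt (b (Suc k))) * F k w) = 1 / \<rho> k"
      unfolding inner_scale inner_scale_right b_def[symmetric]
      using bpos[of "Suc k"] by (simp add: \<rho>_def)
    ultimately show ?thesis unfolding S_def
      using mass_total_pos by (intro real_sqrt_le_mono mult_left_mono) auto
  qed
  have bound: "\<bar>e (Suc k) w\<bar> \<le> (\<beta> - \<alpha>) * S" if "w \<in> I" for k w
    unfolding eS
    using potential_bound[OF continuous_on_mult_left[OF cF] that, of "1 / sqrt (b (Suc k))" k]
      mult_left_mono[OF preS[of k], of "\<beta> - \<alpha>"] interval by linarith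
  have lip: "\<bar>e (Suc k) w - e (Suc k) w'\<bar> \<le> 2 * \<bar>w - w'\<bar> * S" for k w w'
    unfolding eS
    by (rule order_trans[OF potential_lipschitz[OF continuous_on_mult_left[OF cF]] mult_left_mono[OF preS]]) simp
  obtain l s where l: "continuous_on I l" and s: "strict_mono (s :: nat \<Rightarrow> nat)"
    and conv: "\<And>\<epsilon>. 0 < \<epsilon> \<Longrightarrow> \<exists>N. \<forall>n x. n \<ge> N \<and> x \<in> I \<longrightarrow> norm (e (Suc (s n)) x - l x) < \<epsilon>"
  proof (rule Arzela_Ascoli[of "I" "\<lambda>k. e (Suc k)" "(\<beta> - \<alpha>) * S"])
    fix x \<epsilon> :: real assume "0 < \<epsilon>"
    have "2 * (S + 1) > 0" using S0 by (simp add: add_nonneg_pos)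
    define d where "d = \<epsilon> / (2 * (S + 1))"
    have d: "0 < d" unfolding d_def using \<open>0 < \<epsilon>\<close> \<open>2 * (S + 1) > 0\<close> by (rule divide_pos_pos)
    have "norm (e (Suc n) x - e (Suc n) y) < \<epsilon>" if "norm (x - y) < d" for n y
    proof -
      have "\<bar>e (Suc n) x - e (Suc n) y\<bar> \<le> 2 * \<bar>x - y\<bar> * S" by (rule lip)
      also have "\<dots> \<le> 2 * \<bar>x - y\<bar> * (S + 1)" by (intro mult_left_mono) auto
      also have "\<dots> < 2 * d * (S + 1)"
        using that S0 by (intro mult_strict_right_mono) auto
      also have "\<dots> = \<epsilon>" unfolding d_def using S0 by (simp add: field_simps)
      finally show ?thesis by simp
    qed
    with d show "\<exists>d>0. \<forall>n y. y \<in> I \<and> norm (x - y) < d \<longrightarrow> norm (e (Suc n) x - e (Suc n) y) < \<epsilon>"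
      by blast
  qed (use bound in auto)
  have ulim: "uniform_limit I (\<lambda>n. e (Suc (s n))) l sequentially"
    unfolding uniform_limit_iff eventually_sequentially dist_norm using conv by blast
  note innerlim = uniform_limit_inner[OF ce l _ ulim]
  have ll: "inner l l = 1"
  proof -
    let ?\<delta> = "\<lambda>n w. 1 * e (Suc (s n)) w + (- 1) * l w"
    have c\<delta>: "continuous_on I (?\<delta> n)" for n by (intro continuous_intros ce l)
    have eq: "inner (?\<delta> n) (?\<delta> n) = 1 - 2 * inner (e (Suc (s n))) l + inner l l" for n
      by (subst inner_self_combine[OF ce l]) (simp add: ee)
    have "(\<lambda>n. inner (?\<delta> n) (?\<delta> n)) \<longlonglongrightarrow> 1 - 2 * inner l l + inner l l"
      unfolding eq by (intro tendsto_intros innerlim l)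
    moreover have "(\<lambda>n. inner (?\<delta> n) (?\<delta> n)) \<longlonglongrightarrow> 0"
    proof (rule LIMSEQ_I)
      fix \<epsilon> :: real assume "0 < \<epsilon>"
      then have "0 < sqrt (\<epsilon> / 2 / mass)" using mass_total_pos by simp
      from conv[OF this] obtain N where
        N: "\<And>n x. N \<le> n \<Longrightarrow> x \<in> I \<Longrightarrow> \<bar>e (Suc (s n)) x - l x\<bar> < sqrt (\<epsilon> / 2 / mass)" by auto
      have "\<bar>inner (?\<delta> n) (?\<delta> n)\<bar> < \<epsilon>" if "N \<le> n" for n
      proof -
        have "inner (?\<delta> n) (?\<delta> n) \<le> (sqrt (\<epsilon> / 2 / mass))\<^sup>2 * mass"
          using N[OF that] by (intro inner_self_bound c\<delta>) (auto intro: less_imp_le)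
        also have "\<dots> < \<epsilon>" using \<open>0 < \<epsilon>\<close> mass_total_pos by simp
        finally show ?thesis using inner_self_nonneg[OF c\<delta>] by simp
      qed
      then show "\<exists>N. \<forall>n\<ge>N. norm (inner (?\<delta> n) (?\<delta> n) - 0) < \<epsilon>" by auto
    qed
    ultimately have "1 - 2 * inner l l + inner l l = 0" by (rule LIMSEQ_unique)
    then show ?thesis by simp
  qed
  have ol: "inner l (psi n) = 0" for n
  proof (rule LIMSEQ_unique)
    show "(\<lambda>k. inner (e (Suc (s k))) (psi n)) \<longlonglongrightarrow> inner l (psi n)" by (rule innerlim[OF psi_continuous])
    show "(\<lambda>k. inner (e (Suc (s k))) (psi n)) \<longlonglongrightarrow> 0"
      by (simp add: e_def[abs_def] inner_scale oF del: times_divide_eq_left)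
  qed
  \<comment> \<open>Testing \<open>D\<^sub>k \<rightarrow> 0\<close> against a function and moving \<open>K\<^sup>2\<close> across shows \<open>d = 0\<close> in the limit.\<close>
  define d where "d w = 1 * potential (potential l) w + (- \<mu>) * l w" for w
  have cd: "continuous_on I d"
    unfolding d_def by (intro continuous_intros potential_continuous l)
  have "inner d \<phi> = 0" if \<phi>: "continuous_on I \<phi>" for \<phi>
  proof -
    let ?t = "\<lambda>w. 1 * potential (potential \<phi>) w + (- \<mu>) * \<phi> w"
    have ct: "continuous_on I ?t"
      by (intro continuous_intros potential_continuous \<phi>)
    have TT: "inner (potential (potential g)) \<phi> = inner g (potential (potential \<phi>))"
      if "continuous_on I g" for g
      by (simp add: potential_symmetric potential_continuous that \<phi>)
    have "inner (D k) \<phi> = inner (e k) ?t" for k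
    proof -
      have "inner (D k) \<phi> = (1 / sqrt (b k)) * inner (F (Suc (Suc k))) \<phi> - \<mu> * inner (e k) \<phi>"
        unfolding D_def by (subst inner_combine[OF continuous_on_mult_left[OF cF] ce \<phi>]) (simp add: inner_scale del: times_divide_eq_left)
      also have "\<dots> = inner (e k) ?t"
        by (subst inner_combine_right) (auto simp: FS TT[OF cF] e_def[abs_def] inner_scale simp del: times_divide_eq_left intro!: potential_continuous \<phi> cF continuous_intros)
      finally show ?thesis .
    qed
    moreover have "(\<lambda>k. inner (D k) \<phi>) \<longlonglongrightarrow> 0"
    proof -
      have "(\<lambda>k. sqrt (inner (D k) (D k) * inner \<phi> \<phi>)) \<longlonglongrightarrow> sqrt (0 * inner \<phi> \<phi>)"
        by (intro tendsto_intros DD0)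
      moreover have "\<bar>inner (D k) \<phi>\<bar> \<le> sqrt (inner (D k) (D k) * inner \<phi> \<phi>)" for k
        using inner_Cauchy_Schwarz[OF cD \<phi>] by (intro real_le_rsqrt) simp
      ultimately show ?thesis
        by (intro Lim_null_comparison[where f = "\<lambda>k. inner (D k) \<phi>"]) auto
    qed
    ultimately have "(\<lambda>k. inner (e k) ?t) \<longlonglongrightarrow> 0" by simp
    from LIMSEQ_subseq_LIMSEQ[OF LIMSEQ_Suc[OF this] s]
    have "(\<lambda>k. inner (e (Suc (s k))) ?t) \<longlonglongrightarrow> 0" by (simp add: o_def)
    from LIMSEQ_unique[OF innerlim[OF ct] this] have "inner l ?t = 0" .
    then have "inner l (potential (potential \<phi>)) - \<mu> * inner l \<phi> = 0"
      by (subst (asm) inner_combine_right) (auto intro!: potential_continuous \<phi> l)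
    then show ?thesis
      unfolding d_def by (subst inner_combine) (auto simp: TT[OF l] intro!: potential_continuous \<phi> l)
  qed
  from this[OF cd] have d0: "d w = 0" if "w \<in> I" for w
    using inner_self_eq_0[OF cd _ that] by simp
  \<comment> \<open>\<open>0 = (K\<^sup>2 - \<kappa>\<^sup>2) l = (K - \<kappa>) g\<close> with \<open>g = (K + \<kappa>) l\<close>.\<close>
  define g where "g w = 1 * potential l w + \<kappa> * l w" for w
  have cg: "continuous_on I g" unfolding g_def by (intro continuous_intros potential_continuous l)
  have Kg: "potential g w = \<kappa> * g w" if "w \<in> I" for w
  proof -
    have "potential g w = 1 * potential (potential l) w + \<kappa> * potential l w"
      unfolding g_def by (rule potential_combine[OF potential_continuous[OF l] l])
    also have "\<dots> = \<kappa> * g w" using d0[OF that] \<kappa>(2) by (simp add: d_def g_def algebra_simps)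
    finally show ?thesis .
  qed
  have "inner g (psi n) = 0" for n
    unfolding g_def inner_combine[OF potential_continuous[OF l] l psi_continuous]
    by (simp add: inner_potential_psi l ol)
  then have "inner (potential g) (psi n) = 0" for n
    by (simp add: inner_potential_psi cg)
  with potential_eigenvector_mode[OF cg _ Kg] \<kappa>(1) orthogonal_mode_zero
  have "potential g w = 0" if "w \<in> I" for w using that by blast
  with Kg \<kappa>(1) have g0: "g w = 0" if "w \<in> I" for w using that by force
  then have Kl: "potential l w = (- \<kappa>) * l w" if "w \<in> I" for w
    using that unfolding g_def by force
  obtain w where w: "w \<in> I" "l w \<noteq> 0"
    using inner_cong[of l "\<lambda>_. 0" l l] ll by (force simp: inner_def)
  have "mode (1 / (- \<kappa>)) (potential l)"
    using potential_eigenvector_mode[OF l _ Kl] \<kappa>(1) by auto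
  from mode_eigenvalue_pos[OF this w(1)] have "0 < 1 / (- \<kappa>)" using Kl[OF w(1)] w(2) \<kappa>(1) by simp
  then show False using \<kappa>(1) by simp
qed

end

section \<open>The heat kernel series\<close>

text \<open>The fourth power absorbs two factors \<open>\<lambda>\<close> from the bounds of the eigenfunctions and leaves the
summable \<open>1/\<lambda>\<^sup>2\<close>.\<close>

lemma exp_minus_le_inverse_power4:
  assumes "0 < (x::real)" shows "exp (- x) \<le> 64 / x ^ 4"
proof -
  have "(x / 2)\<^sup>2 / 2 \<le> exp (x / 2)"
    using exp_lower_Taylor_quadratic[of "x / 2"] assms by simp
  then have "((x / 2)\<^sup>2 / 2)\<^sup>2 \<le> (exp (x / 2))\<^sup>2" by (rule power_mono) simp
  also have "\<dots> = exp x" by (simp add: exp_double[symmetric])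
  finally have "x ^ 4 / 64 \<le> exp x" by (simp add: power_divide eval_nat_numeral field_simps)
  then show ?thesis using assms by (simp add: exp_minus field_simps)
qed

context string_eigensystem begin

text \<open>The remainder after subtracting the first \<open>N\<close> components has nonnegative norm.\<close>

lemma Bessel:
  assumes f: "continuous_on I f"
  shows "(\<Sum>n<N. (inner f (psi n))\<^sup>2) \<le> inner f f"
proof -
  define P where "P N z = f z - (\<Sum>n<N. inner f (psi n) * psi n z)" for N z
  have cP: "continuous_on I (P N)" for N
    unfolding P_def by (intro continuous_intros f psi_continuous)
  have PS: "P (Suc N) = (\<lambda>z. 1 * P N z + (- inner f (psi N)) * psi N z)" for N
    by (rule ext) (simp add: P_def)
  have Ppsi: "inner (P N) (psi m) = (if m < N then 0 else inner f (psi m))" for N m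
  proof (induction N)
    case 0 show ?case by (simp add: P_def[abs_def])
  next
    case (Suc N) then show ?case
      unfolding PS by (subst inner_combine[OF cP psi_continuous psi_continuous]) (auto simp: orthonormal less_Suc_eq)
  qed
  have "inner (P N) (P N) = inner f f - (\<Sum>n<N. (inner f (psi n))\<^sup>2)"
  proof (induction N)
    case 0 show ?case by (simp add: P_def[abs_def])
  next
    case (Suc N) then show ?case
      unfolding PS by (subst inner_self_combine[OF cP psi_continuous]) (simp add: Ppsi orthonormal power2_eq_square)
  qed
  with inner_self_nonneg[OF cP[of N]] show ?thesis by simp
qed

lemma inner_green_psi: "z \<in> I \<Longrightarrow> inner (green z) (psi n) = psi n z / lam n"
  using mode_eq_potential[OF modes, of z n] lam_pos[of n] by (simp add: potential_def field_simps)

text \<open>Bessel's inequality for the Green function, whose coefficients are \<open>\<psi>\<^sub>n(z)/\<lambda>\<^sub>n\<close>. It bounds single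
eigenfunctions by their eigenvalues, and its integral over \<open>z\<close> bounds \<open>\<Sum> 1/\<lambda>\<^sub>n\<^sup>2\<close>.\<close>

lemma psi_over_lam_square_sum:
  assumes "z \<in> I"
  shows "(\<Sum>n<N. (psi n z / lam n)\<^sup>2) \<le> (\<beta> - \<alpha>)\<^sup>2 * mass"
proof -
  have "(\<Sum>n<N. (inner (green z) (psi n))\<^sup>2) \<le> (\<beta> - \<alpha>)\<^sup>2 * mass"
    by (rule order_trans[OF Bessel[OF continuous_on_green] green_energy[OF assms]])
  then show ?thesis unfolding inner_green_psi[OF assms] .
qed

lemma psi_bound:
  assumes "z \<in> I"
  shows "\<bar>psi n z\<bar> \<le> lam n * ((\<beta> - \<alpha>) * sqrt mass)"
proof -
  have "(psi n z / lam n)\<^sup>2 \<le> (\<Sum>k<Suc n. (psi k z / lam k)\<^sup>2)"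
    by (rule member_le_sum) auto
  also have "\<dots> \<le> (\<beta> - \<alpha>)\<^sup>2 * mass" by (rule psi_over_lam_square_sum[OF assms])
  finally have "\<bar>psi n z / lam n\<bar> \<le> sqrt ((\<beta> - \<alpha>)\<^sup>2 * mass)"
    using real_le_rsqrt[of "\<bar>psi n z / lam n\<bar>"] by (simp only: power2_abs)
  then show ?thesis
    using lam_pos[of n] interval by (simp add: real_sqrt_mult abs_divide divide_le_eq mult.commute)
qed

lemma summable_inverse_lam_square: "summable (\<lambda>n. 1 / (lam n)\<^sup>2)"
proof (rule summableI_nonneg_bounded)
  fix N
  have int: "(\<lambda>z. (\<Sum>n<N. (1 / (lam n)\<^sup>2) * (psi n z * psi n z * r z))) integrable_on I"
    by (intro integrable_sum integrable_on_mult_right weighted_integrable psi_continuous) auto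
  have "(\<Sum>n<N. 1 / (lam n)\<^sup>2) = (\<Sum>n<N. (1 / (lam n)\<^sup>2) * inner (psi n) (psi n))"
    by (simp add: orthonormal)
  also have "\<dots> = integral I (\<lambda>z. (\<Sum>n<N. (1 / (lam n)\<^sup>2) * (psi n z * psi n z * r z)))"
    unfolding inner_def
    by (subst Henstock_Kurzweil_Integration.integral_sum)
       (auto simp del: times_divide_eq_left intro!: integrable_on_mult_right weighted_integrable psi_continuous)
  also have "\<dots> \<le> integral I (\<lambda>z. (\<beta> - \<alpha>)\<^sup>2 * mass * r z)"
  proof (rule integral_le[OF int])
    show "(\<lambda>z. (\<beta> - \<alpha>)\<^sup>2 * mass * r z) integrable_on I"
      by (intro integrable_continuous_real continuous_intros mass_continuous)
    fix z assume z: "z \<in> I"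
    have "(\<Sum>n<N. (1 / (lam n)\<^sup>2) * (psi n z * psi n z * r z)) = (\<Sum>n<N. (psi n z / lam n)\<^sup>2) * r z"
      by (simp add: sum_distrib_right power2_eq_square)
    also have "\<dots> \<le> (\<beta> - \<alpha>)\<^sup>2 * mass * r z"
      using mass_pos[OF z] by (intro mult_right_mono psi_over_lam_square_sum z) simp
    finally show "(\<Sum>n<N. (1 / (lam n)\<^sup>2) * (psi n z * psi n z * r z)) \<le> (\<beta> - \<alpha>)\<^sup>2 * mass * r z" .
  qed
  also have "\<dots> = (\<beta> - \<alpha>)\<^sup>2 * mass * mass" by (simp add: mass_def)
  finally show "(\<Sum>n<N. 1 / (lam n)\<^sup>2) \<le> (\<beta> - \<alpha>)\<^sup>2 * mass * mass" .
qed simp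

definition heat :: "real \<Rightarrow> real \<Rightarrow> real \<Rightarrow> real" where
  "heat t z w = (\<Sum>n. exp (- lam n * t) * psi n z * psi n w)"

lemma heat_term_bound:
  assumes t: "0 < t" and z: "z \<in> I" and w: "w \<in> I"
  shows "norm (exp (- lam n * t) * psi n z * psi n w)
     \<le> 64 / t ^ 4 * ((\<beta> - \<alpha>)\<^sup>2 * mass) * (1 / (lam n)\<^sup>2)"
proof -
  let ?G = "(\<beta> - \<alpha>) * sqrt mass"
  have G: "0 \<le> ?G" using interval mass_total_pos by simp
  have "norm (exp (- lam n * t) * psi n z * psi n w) = exp (- (lam n * t)) * \<bar>psi n z\<bar> * \<bar>psi n w\<bar>"
    by (simp add: abs_mult)
  also have "\<dots> \<le> 64 / (lam n * t) ^ 4 * (lam n * ?G) * (lam n * ?G)"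
    using lam_pos[of n] t G
    by (intro mult_mono psi_bound z w exp_minus_le_inverse_power4) (auto intro!: mult_nonneg_nonneg)
  also have "\<dots> = 64 / t ^ 4 * (?G * ?G) * (1 / (lam n)\<^sup>2)"
  proof -
    have "64 / (l * t) ^ 4 * (l * g) * (l * g) = 64 / t ^ 4 * (g * g) * (1 / l\<^sup>2)" if "0 < l" for l g
      using that t by (simp add: field_simps eval_nat_numeral)
    then show ?thesis using lam_pos[of n] by blast
  qed
  also have "?G * ?G = (\<beta> - \<alpha>)\<^sup>2 * mass"
    using mass_total_pos by (simp add: power2_eq_square)
  finally show ?thesis .
qed

lemma heat_summable:
  assumes "0 < t" "z \<in> I" "w \<in> I"
  shows "summable (\<lambda>n. exp (- lam n * t) * psi n z * psi n w)"
  by (rule summable_comparison_test'[where N = 0, OF summable_mult[OF summable_inverse_lam_square]])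
     (rule heat_term_bound[OF assms])

lemma heat_uniform_limit:
  assumes "0 < t" "z \<in> I"
  shows "uniform_limit I (\<lambda>N w. \<Sum>n<N. exp (- lam n * t) * psi n z * psi n w) (heat t z) sequentially"
  unfolding heat_def[abs_def]
  by (rule Weierstrass_m_test[OF _ summable_mult[OF summable_inverse_lam_square]])
     (rule heat_term_bound[OF assms])

lemma heat_continuous:
  assumes "0 < t" "z \<in> I"
  shows "continuous_on I (heat t z)"
  by (rule uniform_limit_theorem[OF _ heat_uniform_limit[OF assms]])
     (auto intro!: always_eventually continuous_intros psi_continuous)

lemma inner_heat_psi:
  assumes "0 < t" "z \<in> I"
  shows "inner (heat t z) (psi m) = exp (- lam m * t) * psi m z"
proof -
  let ?s = "\<lambda>N w. \<Sum>n<N. exp (- lam n * t) * psi n z * psi n w"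
  have cs: "continuous_on I (?s N)" for N
    by (intro continuous_intros psi_continuous)
  have "inner (?s N) (psi m) = (if m < N then exp (- lam m * t) * psi m z else 0)" for N
  proof (induction N)
    case (Suc N)
    have "inner (?s (Suc N)) (psi m) = inner (\<lambda>w. 1 * ?s N w + (exp (- lam N * t) * psi N z) * psi N w) (psi m)"
      by simp
    also have "\<dots> = 1 * inner (?s N) (psi m) + (exp (- lam N * t) * psi N z) * inner (psi N) (psi m)"
      by (rule inner_combine[OF cs psi_continuous psi_continuous])
    finally show ?case unfolding Suc by (auto simp: orthonormal less_Suc_eq)
  qed (simp add: inner_def)
  then have "(\<lambda>N. inner (?s N) (psi m)) \<longlonglongrightarrow> exp (- lam m * t) * psi m z"
    by (intro tendsto_eventually) (auto simp: eventually_sequentially intro!: exI[of _ "Suc m"])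
  from LIMSEQ_unique[OF uniform_limit_inner[OF cs heat_continuous[OF assms] psi_continuous heat_uniform_limit[OF assms]] this]
  show ?thesis .
qed

section \<open>Measures determined by their eigenfunction moments\<close>

lemma potential_eq_set_integral:
  assumes f: "continuous_on I f"
  shows "potential f w = (LINT z:I|lborel. green w z * f z * r z)"
proof -
  have "set_integrable lborel I (\<lambda>z. green w z * f z * r z)"
    unfolding set_integrable_def
    by (intro borel_integrable_compact) (auto intro!: continuous_intros continuous_on_green f mass_continuous)
  from set_borel_integral_eq_integral(2)[OF this] show ?thesis
    by (simp add: potential_def inner_def)
qed

lemma green_set_integrable:
  assumes "finite_measure \<mu>" and [measurable_cong]: "sets \<mu> = sets borel" and z: "z \<in> I"
  shows "set_integrable \<mu> I (green z)"
proof -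
  interpret finite_measure \<mu> by fact
  have [measurable]: "green z \<in> borel_measurable borel"
    by (intro borel_measurable_continuous_onI continuous_on_green)
  show ?thesis
    unfolding set_integrable_def
    using green_bounds[OF z] interval
    by (intro integrable_const_bound[where B = "\<beta> - \<alpha>"]) (auto simp: indicator_def)
qed

lemma potential_measure_lipschitz:
  assumes \<mu>: "finite_measure \<mu>" "sets \<mu> = sets borel" and z: "z \<in> I" "z' \<in> I"
  shows "\<bar>(LINT w:I|\<mu>. green z w) - (LINT w:I|\<mu>. green z' w)\<bar>
    \<le> 2 * \<bar>z - z'\<bar> * measure \<mu> (space \<mu>)"
proof -
  interpret finite_measure \<mu> by fact
  note [measurable_cong] = \<mu>(2)
  note int = green_set_integrable[OF \<mu> z(1)] green_set_integrable[OF \<mu> z(2)]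
  have "(LINT w:I|\<mu>. green z w) - (LINT w:I|\<mu>. green z' w)
      = (LINT w:I|\<mu>. green z w - green z' w)"
    by (rule set_integral_diff(2)[OF int, symmetric])
  moreover have "\<bar>LINT w:I|\<mu>. green z w - green z' w\<bar> \<le> (LINT w|\<mu>. 2 * \<bar>z - z'\<bar>)"
    unfolding set_lebesgue_integral_def
  proof (rule order_trans[OF integral_abs_bound integral_mono])
    show "integrable \<mu> (\<lambda>w. \<bar>indicat_real I w *\<^sub>R (green z w - green z' w)\<bar>)"
      using set_integral_diff(1)[OF int] unfolding set_integrable_def by (rule integrable_abs)
    show "\<bar>indicat_real I w *\<^sub>R (green z w - green z' w)\<bar> \<le> 2 * \<bar>z - z'\<bar>" for w
      using green_lipschitz[of w z z'] by (auto simp: indicator_def)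
  qed simp
  ultimately show ?thesis by (simp add: mult.commute mult.left_commute)
qed

lemma potential_measure_continuous:
  assumes \<mu>: "finite_measure \<mu>" "sets \<mu> = sets borel"
  shows "continuous_on I (\<lambda>z. LINT w:I|\<mu>. green z w)"
proof (rule continuous_onI)
  let ?v = "\<lambda>z. LINT w:I|\<mu>. green z w"
  fix z e :: real assume z: "z \<in> I" and e: "0 < e"
  define m where "m = 2 * measure \<mu> (space \<mu>) + 1"
  have m: "0 < m" unfolding m_def by (simp add: add_nonneg_pos)
  have "dist (?v z') (?v z) \<le> e" if z': "z' \<in> I" "dist z' z < e / m" for z'
  proof -
    have "dist (?v z') (?v z) \<le> 2 * \<bar>z' - z\<bar> * measure \<mu> (space \<mu>)"
      unfolding dist_real_def by (rule potential_measure_lipschitz[OF \<mu> z'(1) z])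
    also have "\<dots> \<le> \<bar>z' - z\<bar> * m" by (simp add: m_def algebra_simps)
    also have "\<dots> \<le> e / m * m"
      using z'(2) m by (intro mult_right_mono) (auto simp: dist_real_def)
    finally show ?thesis using m by simp
  qed
  then show "\<exists>d>0. \<forall>z'\<in>I. dist z' z < d \<longrightarrow> dist (?v z') (?v z) \<le> e"
    using e m by (intro exI[of _ "e / m"]) auto
qed

text \<open>Fubini: the potential of \<open>\<mu>\<close>, tested against \<open>f r dz\<close>, is the potential of \<open>f r dz\<close> tested against
\<open>\<mu>\<close>.\<close>

lemma integral_potential_measure:
  assumes \<mu>: "finite_measure \<mu>" "sets \<mu> = sets borel" and f: "continuous_on I f"
  shows "inner (\<lambda>z. LINT w:I|\<mu>. green z w) f = (LINT w:I|\<mu>. potential f w)"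
proof -
  interpret finite_measure \<mu> by fact
  have sf: "sigma_finite_measure \<mu>" by unfold_locales
  interpret pair_sigma_finite lborel \<mu> ..
  note [measurable_cong] = \<mu>(2)
  let ?v = "\<lambda>z. LINT w:I|\<mu>. green z w"
  have cv: "continuous_on I ?v" by (rule potential_measure_continuous[OF \<mu>])
  define k where "k z = indicator I z *\<^sub>R (f z * r z)" for z :: real
  have [measurable]: "k \<in> borel_measurable borel"
    unfolding k_def by (intro borel_measurable_continuous_on_indicator continuous_intros f mass_continuous) auto
  have [measurable]: "(\<lambda>p. green (fst p) (snd p)) \<in> borel_measurable (borel \<Otimes>\<^sub>M borel)"
    unfolding green_def by measurable
  obtain C where C: "0 < C" "\<And>z. z \<in> I \<Longrightarrow> \<bar>f z * r z\<bar> \<le> C"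
    using continuous_on_Icc_bounded[of \<alpha> \<beta> "\<lambda>z. f z * r z"] by (metis continuous_on_mult f mass_continuous)
  have int: "integrable (lborel \<Otimes>\<^sub>M \<mu>) (\<lambda>(z, w). indicator I w * green z w * k z)"
  proof (rule Bochner_Integration.integrable_bound)
    show "integrable (lborel \<Otimes>\<^sub>M \<mu>) (\<lambda>p. indicat_real (I \<times> UNIV) p * ((\<beta> - \<alpha>) * C))"
    proof (intro integrable_mult_left integrable_real_indicator)
      show "I \<times> UNIV \<in> sets (lborel \<Otimes>\<^sub>M \<mu>)" using \<mu>(2) sets_eq_imp_space_eq[OF \<mu>(2)] by auto
      have "emeasure (lborel \<Otimes>\<^sub>M \<mu>) (I \<times> space \<mu>) = emeasure lborel I * emeasure \<mu> (space \<mu>)"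
        by (rule sigma_finite_measure.emeasure_pair_measure_Times[OF sf]) auto
      then show "emeasure (lborel \<Otimes>\<^sub>M \<mu>) (I \<times> UNIV) < \<infinity>"
        using sets_eq_imp_space_eq[OF \<mu>(2)] interval
        by (simp add: ennreal_mult_less_top emeasure_eq_measure)
    qed
    show "AE p in lborel \<Otimes>\<^sub>M \<mu>. norm (case p of (z, w) \<Rightarrow> indicator I w * green z w * k z)
        \<le> norm (indicat_real (I \<times> UNIV) p * ((\<beta> - \<alpha>) * C))"
    proof (rule AE_I2, clarify)
      fix z w
      show "norm (indicator I w * green z w * k z) \<le> norm (indicat_real (I \<times> UNIV) (z, w) * ((\<beta> - \<alpha>) * C))"
      proof (cases "z \<in> I \<and> w \<in> I")
        case True
        then show ?thesis
          using mult_mono[OF green_bounds(2)[of z w] C(2)[of z]] green_bounds[of z w] interval C(1)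
          by (auto simp: k_def abs_mult)
      qed (auto simp: k_def indicator_def)
    qed
  qed measurable
  have "inner ?v f = (LINT z:I|lborel. ?v z * f z * r z)"
  proof -
    have "set_integrable lborel I (\<lambda>z. ?v z * f z * r z)"
      unfolding set_integrable_def
      by (intro borel_integrable_compact) (auto intro!: continuous_intros cv f mass_continuous)
    from set_borel_integral_eq_integral(2)[OF this] show ?thesis by (simp add: inner_def)
  qed
  also have "\<dots> = (LINT z|lborel. LINT w|\<mu>. indicator I w * green z w * k z)"
    unfolding set_lebesgue_integral_def
    by (intro Bochner_Integration.integral_cong refl) (simp add: k_def)
  also have "\<dots> = (LINT w|\<mu>. LINT z|lborel. indicator I w * green z w * k z)"
    using Fubini_integral[OF int] by simp
  also have "\<dots> = (LINT w:I|\<mu>. potential f w)"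
    unfolding set_lebesgue_integral_def
  proof (intro Bochner_Integration.integral_cong refl)
    fix w
    have "(LINT z|lborel. indicator I w * green z w * k z) = indicator I w * (LINT z|lborel. green z w * k z)"
      by (simp add: mult.assoc)
    also have "(LINT z|lborel. green z w * k z) = potential f w"
      unfolding potential_eq_set_integral[OF f] set_lebesgue_integral_def k_def
      by (intro Bochner_Integration.integral_cong refl) (simp add: green_commute[of w] mult.left_commute)
    finally show "(LINT z|lborel. indicator I w * green z w * k z) = indicat_real I w *\<^sub>R potential f w" by simp
  qed
  finally show ?thesis .
qed

text \<open>Both potentials are continuous and have the same mode coefficients, the moments divided by
\<open>\<lambda>\<^sub>n\<close>, so completeness identifies them.\<close>

lemma potential_determined_by_moments:
  assumes \<mu>: "finite_measure \<mu>" "sets \<mu> = sets borel" and q: "continuous_on I q"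
    and moments: "\<And>n. (LINT w:I|\<mu>. psi n w) = inner q (psi n)"
    and z: "z \<in> I"
  shows "(LINT w:I|\<mu>. green z w) = potential q z"
proof -
  let ?v = "\<lambda>z. LINT w:I|\<mu>. green z w"
  have cv: "continuous_on I ?v" by (rule potential_measure_continuous[OF \<mu>])
  have "inner (\<lambda>z. 1 * ?v z + (- 1) * potential q z) (psi n) = 0" for n
  proof -
    have "inner ?v (psi n) = (LINT w:I|\<mu>. potential (psi n) w)"
      by (rule integral_potential_measure[OF \<mu> psi_continuous])
    also have "\<dots> = (LINT w:I|\<mu>. psi n w / lam n)"
      using mode_eq_potential[OF modes, of _ n] lam_pos[of n]
      by (intro set_lebesgue_integral_cong) (auto simp: \<mu>(2) field_simps)
    also have "\<dots> = inner (potential q) (psi n)"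
      by (simp add: moments inner_potential_psi[OF q])
    finally show ?thesis
      by (simp only: inner_combine[OF cv potential_continuous[OF q] psi_continuous])
  qed
  from completeness[OF _ this z] show ?thesis
    using cv potential_continuous[OF q] by (force intro: continuous_intros)
qed

text \<open>Equal potentials mean equal integrals of all Green functions. Four of them combine into trapezoids
\<open>\<tau>\<^sub>n\<close> that increase from 0 to 1 just after \<open>c\<close> and decrease to 0 just before \<open>\<beta>\<close>; they converge
to the indicator of \<open>(c,\<beta>)\<close>, which carries the part of \<open>\<mu>\<close> beyond \<open>c\<close>.\<close>

lemma tail_determined_by_moments:
  assumes \<mu>: "finite_measure \<mu>" "sets \<mu> = sets borel" and q: "continuous_on I q"
    and moments: "\<And>n. (LINT w:I|\<mu>. psi n w) = inner q (psi n)"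
    and supp: "AE w in \<mu>. \<alpha> < w \<and> w < \<beta>"
    and c: "c \<in> {\<alpha>..<\<beta>}"
  shows "measure \<mu> {c<..} = integral {c..\<beta>} (\<lambda>w. q w * r w)"
proof -
  interpret finite_measure \<mu> by fact
  note [measurable_cong] = \<mu>(2)
  \<comment> \<open>The ramps have width \<open>h\<^sub>n\<close>, small enough to fit between \<open>c\<close> and \<open>\<beta>\<close>.\<close>
  define h where "h n = (\<beta> - c) / real (Suc n)" for n
  have h: "0 < h n" "c + h n \<le> \<beta>" "\<alpha> \<le> \<beta> - h n" for n
  proof -
    show "0 < h n" using c by (simp add: h_def)
    have "(\<beta> - c) * 1 \<le> (\<beta> - c) * real (Suc n)" using c by (intro mult_left_mono) auto
    then have "h n \<le> \<beta> - c" unfolding h_def by (simp only: divide_le_eq mult_1_right) simp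
    then show "c + h n \<le> \<beta>" "\<alpha> \<le> \<beta> - h n" using c by auto
  qed
  have h0: "h \<longlonglongrightarrow> 0"
    unfolding h_def by (rule LIMSEQ_Suc[OF lim_const_over_n])
  \<comment> \<open>The weights of the four corners make the affine parts of the Green functions cancel.\<close>
  define \<tau> where "\<tau> n w = (green (c + h n) w + green (\<beta> - h n) w - green c w - green \<beta> w) / h n" for n w
  have \<tau>_eq: "\<tau> n w = (max 0 (w - c) - max 0 (w - (c + h n))) / h n
     - (max 0 (w - (\<beta> - h n)) - max 0 (w - \<beta>)) / h n" for n w
  proof -
    have "(w - \<alpha>) * (\<beta> - (c + h n)) / (\<beta> - \<alpha>) + (w - \<alpha>) * (\<beta> - (\<beta> - h n)) / (\<beta> - \<alpha>)
        - (w - \<alpha>) * (\<beta> - c) / (\<beta> - \<alpha>) - (w - \<alpha>) * (\<beta> - \<beta>) / (\<beta> - \<alpha>) = 0"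
      by (simp add: add_divide_distrib[symmetric] diff_divide_distrib[symmetric] algebra_simps)
    then show ?thesis
      unfolding \<tau>_def green_eq_affine_minus_hinge diff_divide_distrib[symmetric] by (simp add: algebra_simps)
  qed
  have ramp: "\<bar>(max 0 (w - x) - max 0 (w - (x + e))) / e\<bar> \<le> 1" if "0 < e" for w x e :: real
    using that by (auto simp: max_def divide_simps)
  have bound: "\<bar>\<tau> n w\<bar> \<le> 2" for n w
  proof -
    have "\<bar>(max 0 (w - (\<beta> - h n)) - max 0 (w - \<beta>)) / h n\<bar> \<le> 1"
      using ramp[OF h(1), of w "\<beta> - h n" n] by (simp only: diff_add_cancel)
    from order_trans[OF abs_triangle_ineq4 add_mono[OF ramp[OF h(1)] this]]
    show ?thesis unfolding \<tau>_eq by simp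
  qed
  have ramp_lim: "(\<lambda>n. \<tau> n w) \<longlonglongrightarrow> indicator {c<..} w" if w: "\<alpha> < w" "w < \<beta>" for w
  proof -
    have "\<forall>\<^sub>F n in sequentially. h n < (if c < w then w - c else 1)"
      using order_tendstoD(2)[OF h0] by auto
    moreover have "\<forall>\<^sub>F n in sequentially. h n < \<beta> - w"
      using order_tendstoD(2)[OF h0] w by auto
    ultimately have "\<forall>\<^sub>F n in sequentially. \<tau> n w = indicator {c<..} w"
    proof eventually_elim
      case (elim n)
      then show ?case using h(1)[of n] w unfolding \<tau>_eq by (auto simp: max_def split: if_splits)
    qed
    then show ?thesis by (rule tendsto_eventually)
  qed
  have c\<tau>: "continuous_on S (\<tau> n)" for S n
    unfolding \<tau>_def using h(1)[of n] by (intro continuous_intros continuous_on_green) auto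
  have [measurable]: "\<tau> n \<in> borel_measurable borel" for n
    by (intro borel_measurable_continuous_onI c\<tau>)
  have eq: "(LINT w:I|\<mu>. \<tau> n w) = inner (\<tau> n) q" for n
  proof -
    have I: "c + h n \<in> I" "\<beta> - h n \<in> I" "c \<in> I" "\<beta> \<in> I" using h[of n] c interval by auto
    note int = I[THEN green_set_integrable[OF \<mu>]]
    have "(LINT w:I|\<mu>. \<tau> n w) = (potential q (c + h n) + potential q (\<beta> - h n) - potential q c - potential q \<beta>) / h n"
      unfolding \<tau>_def I[THEN potential_determined_by_moments[OF \<mu> q moments], symmetric]
      using int by simp
    also have "\<dots> = inner (\<tau> n) q"
    proof -
      have "inner (\<tau> n) q = inner (\<lambda>w. (1 / h n) * (1 * (1 * green (c + h n) w + 1 * green (\<beta> - h n) w)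
          + (- 1) * (1 * green c w + 1 * green \<beta> w)) + 0 * 0) q"
        by (intro inner_cong) (simp_all add: \<tau>_def diff_diff_eq)
      also have "\<dots> = (1 / h n) * (inner (green (c + h n)) q + inner (green (\<beta> - h n)) q
          - (inner (green c) q + inner (green \<beta>) q))"
        by (subst inner_combine inner_scale, (intro continuous_intros continuous_on_green q)+)+ simp
      finally show ?thesis unfolding potential_def by (simp add: diff_diff_eq)
    qed
    finally show ?thesis .
  qed
  have left: "(\<lambda>n. LINT w:I|\<mu>. \<tau> n w) \<longlonglongrightarrow> measure \<mu> {c<..}"
  proof -
    have "(\<lambda>n. LINT w|\<mu>. indicator I w *\<^sub>R \<tau> n w) \<longlonglongrightarrow> (LINT w|\<mu>. indicator {c<..} w)"
    proof (rule integral_dominated_convergence[where w = "\<lambda>_. 2"])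
      show "AE w in \<mu>. (\<lambda>n. indicat_real I w *\<^sub>R \<tau> n w) \<longlonglongrightarrow> indicat_real {c<..} w"
        using supp by eventually_elim (use ramp_lim in simp)
      show "AE w in \<mu>. norm (indicat_real I w *\<^sub>R \<tau> n w) \<le> 2" for n
        using bound by (auto simp: indicator_def)
    qed auto
    then show ?thesis
      using sets_eq_imp_space_eq[OF \<mu>(2)] by (simp add: set_lebesgue_integral_def)
  qed
  have right: "(\<lambda>n. inner (\<tau> n) q) \<longlonglongrightarrow> integral {c..\<beta>} (\<lambda>w. q w * r w)"
  proof -
    obtain C where C: "0 < C" "\<And>w. w \<in> I \<Longrightarrow> \<bar>q w * r w\<bar> \<le> C"
      using continuous_on_Icc_bounded[of \<alpha> \<beta> "\<lambda>z. q z * r z"] by (metis continuous_on_mult q mass_continuous)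
    have "(\<lambda>n. integral {\<alpha><..<\<beta>} (\<lambda>w. \<tau> n w * q w * r w))
        \<longlonglongrightarrow> integral {\<alpha><..<\<beta>} (\<lambda>w. if w \<in> {c<..} then q w * r w else 0)"
    proof (rule dominated_convergence(2)[where h = "\<lambda>_. 2 * C"])
      show "(\<lambda>w. \<tau> n w * q w * r w) integrable_on {\<alpha><..<\<beta>}" for n
        by (simp add: integrable_on_open_interval_real weighted_integrable c\<tau> q)
      show "(\<lambda>_. 2 * C) integrable_on {\<alpha><..<\<beta>}"
        unfolding integrable_on_open_interval_real by (rule Henstock_Kurzweil_Integration.integrable_const_ivl)
      fix w assume w: "w \<in> {\<alpha><..<\<beta>}"
      show "norm (\<tau> n w * q w * r w) \<le> 2 * C" for n
        using mult_mono[OF bound[of n w] C(2)[of w]] w by (simp add: abs_mult mult.assoc)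
      have "(\<lambda>n. \<tau> n w * (q w * r w)) \<longlonglongrightarrow> indicator {c<..} w * (q w * r w)"
        using w by (intro tendsto_intros ramp_lim) auto
      then show "(\<lambda>n. \<tau> n w * q w * r w) \<longlonglongrightarrow> (if w \<in> {c<..} then q w * r w else 0)"
        by (cases "c < w") (simp_all add: mult.assoc)
    qed
    also have "integral {\<alpha><..<\<beta>} (\<lambda>w. if w \<in> {c<..} then q w * r w else 0) = integral {c..\<beta>} (\<lambda>w. q w * r w)"
    proof -
      have "{\<alpha><..<\<beta>} \<inter> {c<..} = {c<..<\<beta>}" using c by auto
      then show ?thesis
        by (simp only: Henstock_Kurzweil_Integration.integral_restrict_Int Int_commute) (simp add: integral_open_interval_real)
    qed
    finally show ?thesis by (simp add: inner_def integral_open_interval_real)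
  qed
  from LIMSEQ_unique[OF left] right show ?thesis unfolding eq by simp
qed

text \<open>If \<open>q\<close> were negative at a point, the mass beyond \<open>c\<close> would increase with \<open>c\<close> there.\<close>

lemma density_nonneg_of_moments:
  assumes \<mu>: "finite_measure \<mu>" "sets \<mu> = sets borel" and q: "continuous_on I q"
    and moments: "\<And>n. (LINT w:I|\<mu>. psi n w) = inner q (psi n)"
    and supp: "AE w in \<mu>. \<alpha> < w \<and> w < \<beta>"
    and w: "w \<in> {\<alpha><..<\<beta>}"
  shows "0 \<le> q w"
proof (rule ccontr)
  assume neg: "\<not> 0 \<le> q w"
  interpret finite_measure \<mu> by fact
  define Q where "Q c = integral {c..\<beta>} (\<lambda>w. q w * r w)" for c
  have "(Q has_real_derivative - (q w * r w)) (at w within I)"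
    unfolding Q_def using w by (intro integral_has_real_derivative' continuous_intros q mass_continuous) auto
  moreover have "0 < - (q w * r w)"
    using neg mass_pos[of w] w by (simp add: mult_neg_pos)
  ultimately obtain d where d: "0 < d" "\<And>h. 0 < h \<Longrightarrow> w + h \<in> I \<Longrightarrow> h < d \<Longrightarrow> Q w < Q (w + h)"
    using has_real_derivative_pos_inc_right by blast
  define h where "h = min (d / 2) ((\<beta> - w) / 2)"
  have h: "0 < h" "h < d" "w + h < \<beta>" using d(1) w by (auto simp: h_def min_def field_simps)
  have "measure \<mu> {w + h<..} \<le> measure \<mu> {w<..}"
    using h by (intro finite_measure_mono) (auto simp: \<mu>(2))
  then have "Q (w + h) \<le> Q w"
    using h w by (simp add: Q_def tail_determined_by_moments[OF \<mu> q moments supp])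
  with d(2)[of h] h w show False by auto
qed

end

section \<open>The Markov property of Brownian motion at a fixed time\<close>

lemma finite_set_enumeration:
  fixes J :: "real set"
  assumes "finite J" "J \<subseteq> {0..u}" "0 \<le> u"
  obtains ts :: "nat \<Rightarrow> real" and n where "ts 0 = 0" "ts n = u" "\<And>i. i < n \<Longrightarrow> ts i < ts (Suc i)"
    "\<And>i. i \<le> n \<Longrightarrow> 0 \<le> ts i" "J \<subseteq> ts ` {..n}"
proof -
  define L where "L = sorted_list_of_set (insert 0 (insert u J))"
  have L: "set L = insert 0 (insert u J)" "sorted_wrt (<) L"
    unfolding L_def using assms(1)
    by (simp_all add: set_sorted_list_of_set strict_sorted_list_of_set del: sorted_list_of_set_insert_remove)
  have ne: "0 < length L" using L(1) by (cases L) auto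
  have mono: "L ! i < L ! j" if "i < j" "j < length L" for i j
    using sorted_wrt_nth_less[OF L(2) that] .
  have rng: "0 \<le> L ! i" "L ! i \<le> u" if "i < length L" for i
  proof -
    have "L ! i \<in> {0..u}" using nth_mem[OF that] L(1) assms(2,3) by auto
    then show "0 \<le> L ! i" "L ! i \<le> u" by auto
  qed
  obtain i where i: "i < length L" "L ! i = 0" using L(1) by (metis in_set_conv_nth insertI1)
  obtain j where j: "j < length L" "L ! j = u" using L(1) by (metis in_set_conv_nth insertI1 insertI2)
  have "i = 0" using mono[of 0 i] rng(1)[of 0] i ne by (cases i) auto
  have "j = length L - 1"
  proof (rule ccontr)
    assume "j \<noteq> length L - 1"
    then have "L ! j < L ! (length L - 1)" using j(1) ne by (intro mono) auto
    then show False using rng(2)[of "length L - 1"] ne j(2) by simp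
  qed
  show thesis
  proof (rule that[of "\<lambda>i. L ! i" "length L - 1"])
    show "L ! 0 = 0" using i \<open>i = 0\<close> by simp
    show "L ! (length L - 1) = u" using j \<open>j = _\<close> by simp
    show "J \<subseteq> (!) L ` {..length L - 1}"
    proof
      fix v assume "v \<in> J"
      then obtain k where "k < length L" "L ! k = v" using L(1) by (metis in_set_conv_nth insertCI)
      then show "v \<in> (!) L ` {..length L - 1}" by (intro image_eqI[of _ _ k]) auto
    qed
    show "0 \<le> L ! i" if "i \<le> length L - 1" for i
      using that ne by (intro rng(1)) linarith
  qed (use mono in auto)
qed

locale brownian =
  fixes M :: "'w measure" and B :: "real \<Rightarrow> 'w \<Rightarrow> real" and z0 :: real
  assumes brownian: "brownian_motion M {0..} z0 B"
begin

sublocale prob_space M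
  using brownian unfolding brownian_motion_def by blast

lemma B_measurable: "0 \<le> t \<Longrightarrow> B t \<in> borel_measurable M"
  and B_start: "\<omega> \<in> space M \<Longrightarrow> B 0 \<omega> = z0"
  and B_path: "\<omega> \<in> space M \<Longrightarrow> continuous_on {0..} (\<lambda>t. B t \<omega>)"
  and B_increment: "0 \<le> u \<Longrightarrow> u < t \<Longrightarrow>
    distributed M lborel (\<lambda>\<omega>. B t \<omega> - B u \<omega>) (\<lambda>z. ennreal (normal_density 0 (sqrt (t - u)) z))"
  and B_indep: "(\<And>i. i \<le> n \<Longrightarrow> 0 \<le> ts i) \<Longrightarrow> (\<And>i. i < n \<Longrightarrow> ts i < ts (Suc i)) \<Longrightarrow>
    indep_vars (\<lambda>_. borel) (\<lambda>i \<omega>. B (ts (Suc i)) \<omega> - B (ts i) \<omega>) {..<n}"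
  using brownian unfolding brownian_motion_def by auto

text \<open>The events that depend on the path at finitely many times up to \<open>u\<close>. They form a generator of
\<open>past u\<close> that is closed under intersection, so independence needs to be checked on them only.\<close>

definition cylinders :: "real \<Rightarrow> 'w set set" where
  "cylinders u = {{\<omega> \<in> space M. \<forall>v\<in>J. B v \<omega> \<in> A v} | J A.
     finite J \<and> J \<subseteq> {0..u} \<and> (\<forall>v\<in>J. A v \<in> sets borel)}"

definition past :: "real \<Rightarrow> 'w measure" where
  "past u = sigma (space M) (cylinders u)"

lemma cylinders_events: "cylinders u \<subseteq> events"
proof
  fix E assume "E \<in> cylinders u"
  then obtain J A where E: "E = {\<omega> \<in> space M. \<forall>v\<in>J. B v \<omega> \<in> A v}"
    and J: "finite J" "J \<subseteq> {0..u}" "\<forall>v\<in>J. A v \<in> sets borel" unfolding cylinders_def by auto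
  have "{\<omega> \<in> space M. B v \<omega> \<in> A v} \<in> events" if "v \<in> J" for v
    using that J measurable_sets[OF B_measurable, of v "A v"]
    by (auto simp: vimage_def Int_def conj_commute)
  then show "E \<in> events" unfolding E using J(1) by (intro sets.sets_Collect_finite_All) auto
qed

lemma space_past [simp]: "space (past u) = space M"
  unfolding past_def using cylinders_events[of u] sets.space_closed
  by (intro space_measure_of) blast

lemma sets_past: "sets (past u) = sigma_sets (space M) (cylinders u)"
  unfolding past_def using cylinders_events[of u] sets.space_closed by (intro sets_measure_of) blast

lemma sets_past_subset: "sets (past u) \<subseteq> events"
  unfolding sets_past by (rule sets.sigma_sets_subset[OF cylinders_events])

lemma measurable_past_subset: "f \<in> measurable (past u) N \<Longrightarrow> f \<in> measurable M N"
  using sets_past_subset by (auto simp: measurable_def)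

lemma B_measurable_past: "0 \<le> v \<Longrightarrow> v \<le> u \<Longrightarrow> B v \<in> borel_measurable (past u)"
proof (rule measurableI)
  fix A :: "real set" assume "0 \<le> v" "v \<le> u" "A \<in> sets borel"
  then have "{\<omega> \<in> space M. \<forall>v\<in>{v}. B v \<omega> \<in> A} \<in> cylinders u"
    unfolding cylinders_def by (intro CollectI exI[of _ "{v}"] exI[of _ "\<lambda>_. A"]) auto
  then show "B v -` A \<inter> space (past u) \<in> sets (past u)"
    unfolding sets_past by (intro sigma_sets.Basic) (simp add: vimage_def Int_def conj_commute)
qed simp

lemma Int_stable_cylinders: "Int_stable (cylinders u)"
proof (rule Int_stableI)
  fix E F assume "E \<in> cylinders u" "F \<in> cylinders u"
  then obtain J A K C where
    E: "E = {\<omega> \<in> space M. \<forall>v\<in>J. B v \<omega> \<in> A v}" "finite J" "J \<subseteq> {0..u}" "\<forall>v\<in>J. A v \<in> sets borel" and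
    F: "F = {\<omega> \<in> space M. \<forall>v\<in>K. B v \<omega> \<in> C v}" "finite K" "K \<subseteq> {0..u}" "\<forall>v\<in>K. C v \<in> sets borel"
    unfolding cylinders_def by auto
  let ?D = "\<lambda>v. (if v \<in> J then A v else UNIV) \<inter> (if v \<in> K then C v else UNIV)"
  have "E \<inter> F = {\<omega> \<in> space M. \<forall>v\<in>J \<union> K. B v \<omega> \<in> ?D v}"
    unfolding E(1) F(1) by (auto split: if_splits)
  with E F show "E \<inter> F \<in> cylinders u"
    unfolding cylinders_def by (intro CollectI exI[of _ "J \<union> K"] exI[of _ ?D]) auto
qed

text \<open>The independent increments are those of an increasing list of times. List the times of the cylinder
from 0 to \<open>u\<close> and append \<open>t\<close>: the cylinder is a function of the increments up to \<open>u\<close>, by summation,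
and the last increment is independent of these.\<close>

lemma indep_cylinder_increment:
  assumes u: "0 \<le> u" "u < t" and E: "E \<in> cylinders u" and S: "S \<in> sets borel"
  shows "prob (E \<inter> ((\<lambda>\<omega>. B t \<omega> - B u \<omega>) -` S \<inter> space M))
    = prob E * prob ((\<lambda>\<omega>. B t \<omega> - B u \<omega>) -` S \<inter> space M)"
proof -
  obtain J A where E: "E = {\<omega> \<in> space M. \<forall>v\<in>J. B v \<omega> \<in> A v}"
    and J: "finite J" "J \<subseteq> {0..u}" "\<forall>v\<in>J. A v \<in> sets borel"
    using E unfolding cylinders_def by auto
  obtain ts n where ts: "ts 0 = 0" "ts n = u" "\<And>i. i < n \<Longrightarrow> ts i < ts (Suc i)"
    "\<And>i. i \<le> n \<Longrightarrow> 0 \<le> ts i" "J \<subseteq> ts ` {..n}"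
    using finite_set_enumeration[OF J(1,2) u(1)] by metis
  define ts' where "ts' = ts(Suc n := t)"
  let ?X = "\<lambda>i \<omega>. B (ts' (Suc i)) \<omega> - B (ts' i) \<omega>"
  have "indep_vars (\<lambda>_. borel) ?X {..<Suc n}"
    using ts u by (intro B_indep) (auto simp: ts'_def less_Suc_eq le_Suc_eq)
  then have iv: "indep_var (PiM {..<n} (\<lambda>_. borel)) (\<lambda>\<omega>. restrict (\<lambda>i. ?X i \<omega>) {..<n})
     (PiM {n} (\<lambda>_. borel)) (\<lambda>\<omega>. restrict (\<lambda>i. ?X i \<omega>) {n})"
    by (rule indep_var_restrict) auto
  let ?N = "PiM {..<n} (\<lambda>_::nat. borel :: real measure)"
  let ?N' = "PiM {n} (\<lambda>_::nat. borel :: real measure)"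
  define D where "D = {f \<in> space ?N. \<forall>i\<in>{i. i \<le> n \<and> ts i \<in> J}. z0 + (\<Sum>j<i. f j) \<in> A (ts i)}"
  have D: "D \<in> sets ?N"
    unfolding D_def
  proof (rule sets.sets_Collect_finite_All)
    fix i assume "i \<in> {i. i \<le> n \<and> ts i \<in> J}"
    then have i: "i \<le> n" and A: "A (ts i) \<in> sets borel" using J(3) by auto
    have "(\<lambda>f. z0 + (\<Sum>j<i. f j)) \<in> borel_measurable ?N"
      using i by (intro borel_measurable_add borel_measurable_const borel_measurable_sum measurable_component_singleton) auto
    from measurable_sets[OF this A]
    show "{f \<in> space ?N. z0 + (\<Sum>j<i. f j) \<in> A (ts i)} \<in> sets ?N"
      by (simp add: vimage_def Int_def conj_commute)
  qed auto
  have D': "{f \<in> space ?N'. f n \<in> S} \<in> sets ?N'"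
    using S by measurable
  have telescope: "z0 + (\<Sum>j<i. ?X j \<omega>) = B (ts i) \<omega>" if "i \<le> n" "\<omega> \<in> space M" for i \<omega>
    using that(1)
  proof (induction i)
    case 0 show ?case using ts(1) B_start[OF that(2)] by simp
  next
    case (Suc i) then show ?case by (auto simp: ts'_def)
  qed
  have eqE: "(\<lambda>\<omega>. restrict (\<lambda>i. ?X i \<omega>) {..<n}) -` D \<inter> space M = E"
  proof -
    have "(\<lambda>\<omega>. restrict (\<lambda>i. ?X i \<omega>) {..<n}) -` D \<inter> space M
       = {\<omega> \<in> space M. \<forall>i\<in>{i. i \<le> n \<and> ts i \<in> J}. B (ts i) \<omega> \<in> A (ts i)}"
      using telescope by (auto simp: D_def space_PiM)
    also have "\<dots> = E" unfolding E using ts(5) by fastforce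
    finally show ?thesis .
  qed
  have eqS: "(\<lambda>\<omega>. restrict (\<lambda>i. ?X i \<omega>) {n}) -` {f \<in> space ?N'. f n \<in> S} \<inter> space M
      = (\<lambda>\<omega>. B t \<omega> - B u \<omega>) -` S \<inter> space M"
    using ts(2) by (auto simp: space_PiM ts'_def)
  have "prob ((\<lambda>\<omega>. (restrict (\<lambda>i. ?X i \<omega>) {..<n}, restrict (\<lambda>i. ?X i \<omega>) {n})) -` (D \<times> {f \<in> space ?N'. f n \<in> S}) \<inter> space M)
     = prob E * prob ((\<lambda>\<omega>. B t \<omega> - B u \<omega>) -` S \<inter> space M)"
    unfolding indep_varD[OF iv D D'] eqE eqS ..
  also have "(\<lambda>\<omega>. (restrict (\<lambda>i. ?X i \<omega>) {..<n}, restrict (\<lambda>i. ?X i \<omega>) {n})) -` (D \<times> {f \<in> space ?N'. f n \<in> S}) \<inter> space M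
     = E \<inter> ((\<lambda>\<omega>. B t \<omega> - B u \<omega>) -` S \<inter> space M)"
    unfolding eqE[symmetric] eqS[symmetric] by auto
  finally show ?thesis .
qed

lemma id_measurable_past: "(\<lambda>\<omega>. \<omega>) \<in> measurable M (past u)"
proof (rule measurableI)
  fix A assume A: "A \<in> sets (past u)"
  then have "A \<subseteq> space M" using sets.sets_into_space by fastforce
  then have "(\<lambda>\<omega>. \<omega>) -` A \<inter> space M = A" by auto
  with A show "(\<lambda>\<omega>. \<omega>) -` A \<inter> space M \<in> events" using sets_past_subset by auto
qed simp

text \<open>Independence of the past and the next increment in the form that Fubini's theorem uses. By the
previous lemma it holds on a generator that is closed under intersection.\<close>

lemma past_increment_product:
  assumes u: "0 \<le> u" "u < t"
  defines "\<xi> \<equiv> \<lambda>\<omega>. B t \<omega> - B u \<omega>"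
  shows "distr M (past u) (\<lambda>\<omega>. \<omega>) \<Otimes>\<^sub>M distr M borel \<xi>
    = distr M (past u \<Otimes>\<^sub>M borel) (\<lambda>\<omega>. (\<omega>, \<xi> \<omega>))"
proof -
  have rv: "\<xi> \<in> borel_measurable M"
    unfolding \<xi>_def using u by (intro borel_measurable_diff B_measurable) auto
  let ?G = "{\<xi> -` S \<inter> space M | S. S \<in> sets borel}"
  have "indep_set (cylinders u) ?G"
  proof (rule indep_setI)
    show "cylinders u \<subseteq> events" by (rule cylinders_events)
    show "?G \<subseteq> events" using measurable_sets[OF rv] by auto
  qed (use indep_cylinder_increment[OF u] in \<open>auto simp: \<xi>_def\<close>)
  moreover have "Int_stable ?G"
  proof (rule Int_stableI)
    fix a b assume "a \<in> ?G" "b \<in> ?G"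
    then obtain S T where "a = \<xi> -` S \<inter> space M" "b = \<xi> -` T \<inter> space M" "S \<in> sets borel" "T \<in> sets borel" by auto
    then show "a \<inter> b \<in> ?G" by (intro CollectI exI[of _ "S \<inter> T"]) auto
  qed
  ultimately have indep: "indep_set (sigma_sets (space M) (cylinders u)) (sigma_sets (space M) ?G)"
    by (rule indep_set_sigma_sets[OF _ Int_stable_cylinders])
  interpret P: prob_space "distr M (past u) (\<lambda>\<omega>. \<omega>)" by (rule prob_space_distr[OF id_measurable_past])
  interpret Q: prob_space "distr M borel \<xi>" by (rule prob_space_distr[OF rv])
  have pair: "(\<lambda>\<omega>. (\<omega>, \<xi> \<omega>)) \<in> measurable M (past u \<Otimes>\<^sub>M borel)"
    using id_measurable_past rv by (rule measurable_Pair)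
  show ?thesis
  proof (rule pair_measure_eqI)
    fix A S assume "A \<in> sets (distr M (past u) (\<lambda>\<omega>. \<omega>))" "S \<in> sets (distr M borel \<xi>)"
    then have A: "A \<in> sets (past u)" and S: "S \<in> sets borel" by auto
    have AM: "A \<in> events" "A \<subseteq> space M" using A sets_past_subset sets.sets_into_space[OF A] by auto
    have SM: "\<xi> -` S \<inter> space M \<in> events" using measurable_sets[OF rv S] .
    have "prob (A \<inter> (\<xi> -` S \<inter> space M)) = prob A * prob (\<xi> -` S \<inter> space M)"
      using A S by (intro indep_setD[OF indep]) (auto simp: sets_past)
    then have "emeasure M (A \<inter> (\<xi> -` S \<inter> space M)) = emeasure M A * emeasure M (\<xi> -` S \<inter> space M)"
      by (simp add: emeasure_eq_measure ennreal_mult)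
    moreover have "(\<lambda>\<omega>. (\<omega>, \<xi> \<omega>)) -` (A \<times> S) \<inter> space M = A \<inter> (\<xi> -` S \<inter> space M)" using AM by auto
    moreover have "(\<lambda>\<omega>. \<omega>) -` A \<inter> space M = A" using AM by auto
    ultimately show "emeasure (distr M (past u) (\<lambda>\<omega>. \<omega>)) A * emeasure (distr M borel \<xi>) S
        = emeasure (distr M (past u \<Otimes>\<^sub>M borel) (\<lambda>\<omega>. (\<omega>, \<xi> \<omega>))) (A \<times> S)"
      using A S by (simp add: emeasure_distr id_measurable_past rv pair)
  qed (unfold_locales, unfold_locales, simp cong: sets_pair_measure_cong)
qed

text \<open>Write \<open>B(t)\<close> as \<open>B(u)\<close> plus the increment and integrate the increment out first.\<close>

lemma markov_step:
  assumes u: "0 \<le> u" "u < t" and H: "H \<in> borel_measurable (past u)" "\<And>\<omega>. \<omega> \<in> space M \<Longrightarrow> \<bar>H \<omega>\<bar> \<le> C"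
    and f: "f \<in> borel_measurable borel" "\<And>x. \<bar>f x\<bar> \<le> D"
  shows "expectation (\<lambda>\<omega>. H \<omega> * f (B t \<omega>))
     = expectation (\<lambda>\<omega>. H \<omega> * (LINT y|lborel. normal_density 0 (sqrt (t - u)) y * f (B u \<omega> + y)))"
proof -
  let ?\<xi> = "\<lambda>\<omega>. B t \<omega> - B u \<omega>"
  let ?P = "distr M (past u) (\<lambda>\<omega>. \<omega>)" and ?Q = "distr M borel ?\<xi>"
  note id = id_measurable_past
  have rv: "?\<xi> \<in> borel_measurable M" using u by (intro borel_measurable_diff B_measurable) auto
  note eq = past_increment_product[OF u]
  interpret P: prob_space ?P by (rule prob_space_distr[OF id])
  interpret Q: prob_space ?Q by (rule prob_space_distr[OF rv])
  interpret PQ: pair_prob_space ?P ?Q ..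
  note [measurable] = H(1) f(1) B_measurable_past[OF u(1) order_refl]
  let ?g = "\<lambda>(\<omega>, y). H \<omega> * f (B u \<omega> + y)"
  have g: "?g \<in> borel_measurable (past u \<Otimes>\<^sub>M borel)" by measurable
  have int: "integrable (?P \<Otimes>\<^sub>M ?Q) ?g"
  proof (rule PQ.integrable_const_bound[where B = "C * D"])
    have "norm (?g (\<omega>, y)) \<le> C * D" if "\<omega> \<in> space M" for \<omega> y
      using mult_mono[OF H(2)[OF that] f(2)[of "B u \<omega> + y"]] H(2)[OF that] by (simp add: abs_mult)
    then show "AE p in ?P \<Otimes>\<^sub>M ?Q. norm (?g p) \<le> C * D"
      by (intro AE_I2) (auto simp: space_pair_measure)
  qed (use g in \<open>simp cong: measurable_cong_sets\<close>)
  have "expectation (\<lambda>\<omega>. H \<omega> * f (B t \<omega>)) = expectation (\<lambda>\<omega>. ?g (\<omega>, ?\<xi> \<omega>))" by simp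
  also have "\<dots> = integral\<^sup>L (distr M (past u \<Otimes>\<^sub>M borel) (\<lambda>\<omega>. (\<omega>, ?\<xi> \<omega>))) ?g"
    by (rule integral_distr[symmetric, OF _ g]) (use id rv in measurable)
  also have "\<dots> = (LINT \<omega>|?P. LINT y|?Q. ?g (\<omega>, y))"
    unfolding eq[symmetric] by (rule PQ.integral_fst'[OF int, symmetric])
  also have "\<dots> = (LINT \<omega>|?P. H \<omega> * (LINT y|lborel. normal_density 0 (sqrt (t - u)) y * f (B u \<omega> + y)))"
  proof (intro Bochner_Integration.integral_cong refl)
    fix \<omega>
    have "(LINT y|?Q. f (B u \<omega> + y)) = expectation (\<lambda>\<omega>'. f (B u \<omega> + ?\<xi> \<omega>'))"
      by (rule integral_distr[OF rv]) measurable
    also have "\<dots> = (LINT y|lborel. normal_density 0 (sqrt (t - u)) y * f (B u \<omega> + y))"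
      by (rule distributed_integral[OF B_increment[OF u], symmetric]) auto
    finally show "(LINT y|?Q. ?g (\<omega>, y)) = H \<omega> * (LINT y|lborel. normal_density 0 (sqrt (t - u)) y * f (B u \<omega> + y))"
      by simp
  qed
  also have "\<dots> = expectation (\<lambda>\<omega>. H \<omega> * (LINT y|lborel. normal_density 0 (sqrt (t - u)) y * f (B u \<omega> + y)))"
    by (rule integral_distr[OF id]) measurable
  finally show ?thesis .
qed

end

section \<open>Taylor expansions, Riemann sums and the extension of a mode\<close>

lemma glue_derivatives:
  fixes f g :: "real \<Rightarrow> real"
  assumes g: "\<And>x. x \<in> S \<Longrightarrow> x \<le> a \<Longrightarrow> (g has_real_derivative g' x) (at x within S \<inter> {..a})"
    and f: "\<And>x. x \<in> S \<Longrightarrow> a \<le> x \<Longrightarrow> (f has_real_derivative f' x) (at x within S \<inter> {a..})"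
    and eq: "g a = f a" "g' a = f' a" and x: "x \<in> S"
  shows "((\<lambda>x. if x < a then g x else f x) has_real_derivative (if x < a then g' x else f' x)) (at x within S)"
proof -
  let ?h = "\<lambda>x. if x < a then g x else f x"
  have S: "S = (S \<inter> {..a}) \<union> (S \<inter> {a..})" by auto
  have left: "(?h has_real_derivative (if x < a then g' x else f' x)) (at x within S \<inter> {..a})"
  proof (cases "x \<le> a")
    case True
    have "(?h has_real_derivative g' x) (at x within S \<inter> {..a})"
      by (rule has_field_derivative_transform_within[OF g[OF x True] zero_less_one]) (use x True eq in auto)
    then show ?thesis using True eq by (cases "x = a") auto
  next
    case False
    have "x \<notin> closure (S \<inter> {..a})" using closure_minimal[of "S \<inter> {..a}" "{..a}"] False by auto
    then have "at x within S \<inter> {..a} = bot" by (rule not_in_closure_trivial_limitI)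
    then show ?thesis by (simp add: has_field_derivative_iff)
  qed
  have right: "(?h has_real_derivative (if x < a then g' x else f' x)) (at x within S \<inter> {a..})"
  proof (cases "a \<le> x")
    case True
    have "(?h has_real_derivative f' x) (at x within S \<inter> {a..})"
      by (rule has_field_derivative_transform_within[OF f[OF x True] zero_less_one]) (use x True in auto)
    then show ?thesis using True by auto
  next
    case False
    have "x \<notin> closure (S \<inter> {a..})" using closure_minimal[of "S \<inter> {a..}" "{a..}"] False by auto
    then have "at x within S \<inter> {a..} = bot" by (rule not_in_closure_trivial_limitI)
    then show ?thesis by (simp add: has_field_derivative_iff)
  qed
  have "(?h has_real_derivative (if x < a then g' x else f' x)) (at x within (S \<inter> {..a}) \<union> (S \<inter> {a..}))"
    using left right unfolding has_field_derivative_iff by (subst at_within_union) (rule filterlim_sup)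
  then show ?thesis using S by simp
qed

text \<open>For small \<open>h\<close> the remainder is at most \<open>\<epsilon> h\<^sup>2\<close>, uniformly in \<open>z\<close>, because \<open>f''\<close> is uniformly
continuous near \<open>[a,b]\<close>; for \<open>|h| \<ge> d\<close> it is at most \<open>K h\<^sup>2 \<le> (K/d\<^sup>2) h\<^sup>4\<close>. The quartic form is chosen
because Gaussian increments of variance \<open>\<delta>\<close> make it \<open>O(\<delta>\<^sup>2)\<close>.\<close>

lemma Taylor2_uniform_remainder:
  fixes f f' f'' :: "real \<Rightarrow> real"
  assumes f: "\<And>x. (f has_real_derivative f' x) (at x)" and f': "\<And>x. (f' has_real_derivative f'' x) (at x)"
    and cont: "continuous_on UNIV f''" and bound: "\<And>x. \<bar>f'' x\<bar> \<le> K" and \<epsilon>: "0 < \<epsilon>"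
  obtains C where "0 \<le> C"
    "\<And>z h. z \<in> {a..b} \<Longrightarrow> \<bar>f (z + h) - (f z + f' z * h + f'' z * h\<^sup>2 / 2)\<bar> \<le> \<epsilon> * h\<^sup>2 + C * h ^ 4"
proof -
  have "uniformly_continuous_on {a - 1..b + 1} f''"
    by (intro compact_uniformly_continuous continuous_on_subset[OF cont]) auto
  then obtain d0 where d0: "0 < d0"
    "\<And>x y. x \<in> {a - 1..b + 1} \<Longrightarrow> y \<in> {a - 1..b + 1} \<Longrightarrow> dist y x < d0 \<Longrightarrow> dist (f'' y) (f'' x) < \<epsilon>"
    using \<epsilon> unfolding uniformly_continuous_on_def by meson
  define d where "d = min d0 1"
  have d: "0 < d" using d0(1) by (simp add: d_def)
  have near: "\<bar>f'' t - f'' z\<bar> < \<epsilon>" if "z \<in> {a..b}" "\<bar>t - z\<bar> < d" for z t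
  proof -
    have "z \<in> {a - 1..b + 1}" "t \<in> {a - 1..b + 1}"
      using that by (auto simp: d_def abs_less_iff)
    from d0(2)[OF this] show ?thesis using that(2) by (simp add: d_def dist_real_def)
  qed
  have K: "0 \<le> K" using bound[of 0] by simp
  show thesis
  proof (rule that[of "K / d\<^sup>2"])
    show "0 \<le> K / d\<^sup>2" using K by simp
    fix z h :: real assume z: "z \<in> {a..b}"
    show "\<bar>f (z + h) - (f z + f' z * h + f'' z * h\<^sup>2 / 2)\<bar> \<le> \<epsilon> * h\<^sup>2 + K / d\<^sup>2 * h ^ 4"
    proof (cases "h = 0")
      case False
      define diff where "diff m = (if m = 0 then f else if m = 1 then f' else f'')" for m :: nat
      have "\<exists>t. (if z + h < z then z + h < t \<and> t < z else z < t \<and> t < z + h) \<and>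
        f (z + h) = (\<Sum>m<2. diff m z / fact m * (z + h - z) ^ m) + diff 2 t / fact 2 * (z + h - z) ^ 2"
        by (rule Taylor[where a = "z - \<bar>h\<bar>" and b = "z + \<bar>h\<bar>"])
           (use f f' False in \<open>auto simp: diff_def less_2_cases_iff\<close>)
      then obtain t where between: "if z + h < z then z + h < t \<and> t < z else z < t \<and> t < z + h"
        and "f (z + h) = (\<Sum>m<2. diff m z / fact m * (z + h - z) ^ m) + diff 2 t / fact 2 * (z + h - z) ^ 2"
        by blast
      moreover from between have t: "\<bar>t - z\<bar> < \<bar>h\<bar>" by (auto split: if_splits)
      ultimately have "f (z + h) = f z + f' z * h + f'' t * h\<^sup>2 / 2"
        by (simp add: diff_def eval_nat_numeral)
      then have eq: "\<bar>f (z + h) - (f z + f' z * h + f'' z * h\<^sup>2 / 2)\<bar> = \<bar>f'' t - f'' z\<bar> / 2 * h\<^sup>2"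
        by (simp add: abs_mult flip: diff_divide_distrib left_diff_distrib)
      show ?thesis
      proof (cases "\<bar>h\<bar> < d")
        case True
        then have "\<bar>f'' t - f'' z\<bar> / 2 * h\<^sup>2 \<le> \<epsilon> * h\<^sup>2"
          using near[OF z, of t] t \<epsilon> by (intro mult_right_mono) auto
        moreover have "0 \<le> K / d\<^sup>2 * h ^ 4" using K by simp
        ultimately show ?thesis unfolding eq by linarith
      next
        case False
        have "\<bar>f'' t - f'' z\<bar> / 2 * h\<^sup>2 \<le> K * h\<^sup>2"
          using bound[of t] bound[of z] by (intro mult_right_mono) auto
        also have "\<dots> \<le> K / d\<^sup>2 * h ^ 4"
        proof -
          have "d\<^sup>2 \<le> h\<^sup>2" using False d by (metis abs_le_square_iff abs_of_pos not_less)
          then have "1 \<le> h\<^sup>2 / d\<^sup>2" using d by simp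
          then have "K * h\<^sup>2 * 1 \<le> K * h\<^sup>2 * (h\<^sup>2 / d\<^sup>2)" using K by (intro mult_left_mono) auto
          then show ?thesis by (simp add: power4_eq_xxxx power2_eq_square)
        qed
        also have "\<dots> \<le> \<epsilon> * h\<^sup>2 + K / d\<^sup>2 * h ^ 4" using \<epsilon> by simp
        finally show ?thesis unfolding eq .
      qed
    qed simp
  qed
qed

text \<open>Integrating the expansion of \<open>f\<close> against the Gaussian density of variance \<open>\<delta>\<close>, whose moments of order 1, 2 and 4 are
0, \<open>\<delta>\<close> and \<open>3\<delta>\<^sup>2\<close>.\<close>

lemma gaussian_expansion:
  fixes f :: "real \<Rightarrow> real"
  assumes f: "f \<in> borel_measurable borel" "\<And>x. \<bar>f x\<bar> \<le> D" and \<delta>: "0 < \<delta>"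
    and taylor: "\<And>h. \<bar>f (z + h) - (f z + a * h + b * h\<^sup>2 / 2)\<bar> \<le> \<epsilon> * h\<^sup>2 + C * h ^ 4"
  shows "\<bar>(LINT y|lborel. normal_density 0 (sqrt \<delta>) y * f (z + y)) - (f z + b * \<delta> / 2)\<bar> \<le> \<epsilon> * \<delta> + 3 * C * \<delta>\<^sup>2"
proof -
  let ?n = "normal_density 0 (sqrt \<delta>)"
  have s: "0 < sqrt \<delta>" using \<delta> by simp
  have sd: "sqrt \<delta> ^ 2 = \<delta>" using \<delta> by simp
  have m0: "has_bochner_integral lborel (\<lambda>y. ?n y) 1"
    using normal_moment_even[OF s, of 0 0] by simp
  have m1: "has_bochner_integral lborel (\<lambda>y. ?n y * y) 0"
    using normal_moment_odd[OF s, of 0 0] by simp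
  have m2: "has_bochner_integral lborel (\<lambda>y. ?n y * y\<^sup>2) \<delta>"
    using normal_moment_even[OF s, of 0 1] \<delta> by (simp add: eval_nat_numeral)
  have m4: "has_bochner_integral lborel (\<lambda>y. ?n y * y ^ 4) (3 * \<delta>\<^sup>2)"
    using normal_moment_even[OF s, of 0 2] \<delta> by (simp add: sd fact_numeral power_divide)
  have P: "has_bochner_integral lborel (\<lambda>y. f z * ?n y + a * (?n y * y) + b / 2 * (?n y * y\<^sup>2)) (f z * 1 + a * 0 + b / 2 * \<delta>)"
    by (intro has_bochner_integral_add has_bochner_integral_mult_right m0 m1 m2)
  have Q: "has_bochner_integral lborel (\<lambda>y. \<epsilon> * (?n y * y\<^sup>2) + C * (?n y * y ^ 4)) (\<epsilon> * \<delta> + C * (3 * \<delta>\<^sup>2))"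
    by (intro has_bochner_integral_add has_bochner_integral_mult_right m2 m4)
  have I: "integrable lborel (\<lambda>y. ?n y * f (z + y))"
  proof (rule Bochner_Integration.integrable_bound)
    show "integrable lborel (\<lambda>y. D * ?n y)" using m0 by (auto dest: integrable.intros)
    have "\<bar>?n y\<bar> * \<bar>f (z + y)\<bar> \<le> \<bar>?n y\<bar> * \<bar>D\<bar>" for y
      using f(2)[of "z + y"] by (intro mult_left_mono) auto
    then show "AE y in lborel. norm (?n y * f (z + y)) \<le> norm (D * ?n y)"
      by (intro AE_I2) (simp add: abs_mult mult.commute)
    show "(\<lambda>y. ?n y * f (z + y)) \<in> borel_measurable lborel" using f(1) by measurable
  qed
  have eq: "(LINT y|lborel. ?n y * f (z + y)) - (f z + b * \<delta> / 2)
     = (LINT y|lborel. ?n y * f (z + y) - (f z * ?n y + a * (?n y * y) + b / 2 * (?n y * y\<^sup>2)))"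
    using P I by (simp add: has_bochner_integral_iff)
  have "\<bar>(LINT y|lborel. ?n y * f (z + y)) - (f z + b * \<delta> / 2)\<bar> \<le> (LINT y|lborel. \<epsilon> * (?n y * y\<^sup>2) + C * (?n y * y ^ 4))"
    unfolding eq
  proof (rule order_trans[OF integral_abs_bound integral_mono])
    show "integrable lborel (\<lambda>y. \<bar>?n y * f (z + y) - (f z * ?n y + a * (?n y * y) + b / 2 * (?n y * y\<^sup>2))\<bar>)"
      using P I by (auto simp: has_bochner_integral_iff)
    show "integrable lborel (\<lambda>y. \<epsilon> * (?n y * y\<^sup>2) + C * (?n y * y ^ 4))"
      using Q by (simp add: has_bochner_integral_iff)
    fix y
    have "\<bar>?n y * f (z + y) - (f z * ?n y + a * (?n y * y) + b / 2 * (?n y * y\<^sup>2))\<bar>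
        = ?n y * \<bar>f (z + y) - (f z + a * y + b * y\<^sup>2 / 2)\<bar>"
      by (subst abs_of_nonneg[OF normal_density_nonneg, symmetric], subst abs_mult[symmetric]) (simp add: algebra_simps)
    also have "\<dots> \<le> ?n y * (\<epsilon> * y\<^sup>2 + C * y ^ 4)" by (intro mult_left_mono taylor) simp
    also have "\<dots> = \<epsilon> * (?n y * y\<^sup>2) + C * (?n y * y ^ 4)" by (simp add: algebra_simps)
    finally show "\<bar>?n y * f (z + y) - (f z * ?n y + a * (?n y * y) + b / 2 * (?n y * y\<^sup>2))\<bar>
      \<le> \<epsilon> * (?n y * y\<^sup>2) + C * (?n y * y ^ 4)" .
  qed
  also have "\<dots> = \<epsilon> * \<delta> + 3 * C * \<delta>\<^sup>2"
    using Q by (simp add: has_bochner_integral_integral_eq)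
  finally show ?thesis .
qed

lemma riemann_sum_error:
  fixes g :: "real \<Rightarrow> real"
  assumes g: "continuous_on {0..} g" and \<delta>: "0 < \<delta>" and kL: "real k * \<delta> \<le> L"
    and osc: "\<And>x y. x \<in> {0..L} \<Longrightarrow> y \<in> {0..L} \<Longrightarrow> \<bar>x - y\<bar> \<le> \<delta> \<Longrightarrow> \<bar>g x - g y\<bar> \<le> e"
  shows "\<bar>(\<Sum>j<k. \<delta> * g (real j * \<delta>)) - integral {0..real k * \<delta>} g\<bar> \<le> real k * \<delta> * e"
  using kL
proof (induction k)
  case (Suc k)
  let ?a = "real k * \<delta>" and ?b = "real (Suc k) * \<delta>"
  have ab: "0 \<le> ?a" "?a \<le> ?b" "?b - ?a = \<delta>" using \<delta> by (auto simp: algebra_simps)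
  have int: "g integrable_on {x..y}" if "0 \<le> x" for x y
    using that by (intro integrable_continuous_real continuous_on_subset[OF g]) auto
  have "integral {0..?a} g + integral {?a..?b} g = integral {0..?b} g"
    using ab int by (intro Henstock_Kurzweil_Integration.integral_combine) auto
  moreover have "\<bar>\<delta> * g ?a - integral {?a..?b} g\<bar> \<le> \<delta> * e"
  proof -
    have "\<delta> * g ?a - integral {?a..?b} g = integral {?a..?b} (\<lambda>x. g ?a - g x)"
      using ab by (subst Henstock_Kurzweil_Integration.integral_diff) (auto intro: int)
    moreover have "norm (integral {?a..?b} (\<lambda>x. g ?a - g x)) \<le> e * (?b - ?a)"
    proof (rule integral_bound[OF ab(2)])
      show "continuous_on {?a..?b} (\<lambda>x. g ?a - g x)"
        using ab by (intro continuous_intros continuous_on_subset[OF g]) auto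
      show "norm (g ?a - g x) \<le> e" if "x \<in> {?a..?b}" for x
      proof -
        have "?a \<in> {0..L}" "x \<in> {0..L}"
          using that ab(1,2) Suc.prems unfolding atLeastAtMost_iff by linarith+
        moreover have "\<bar>?a - x\<bar> \<le> \<delta>" using that ab(3) by auto
        ultimately show ?thesis using osc by simp
      qed
    qed
    ultimately show ?thesis using ab(3) by (simp add: mult.commute)
  qed
  moreover have "?a \<le> L" using Suc.prems ab by linarith
  note Suc.IH[OF this]
  moreover have "?b * e = ?a * e + \<delta> * e" by (simp add: algebra_simps)
  ultimately show ?case by simp
qed simp

lemma riemann_sum_tendsto:
  fixes g :: "real \<Rightarrow> real"
  assumes g: "continuous_on {0..} g" and \<delta>: "\<And>n. 0 < \<delta> n" "\<delta> \<longlonglongrightarrow> 0"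
    and \<tau>: "0 \<le> \<tau>" "(\<lambda>n. real (k n) * \<delta> n) \<longlonglongrightarrow> \<tau>"
  shows "(\<lambda>n. \<Sum>j<k n. \<delta> n * g (real j * \<delta> n)) \<longlonglongrightarrow> integral {0..\<tau>} g"
proof -
  obtain L0 where L0: "\<And>n. \<bar>real (k n) * \<delta> n\<bar> \<le> L0"
    using convergent_imp_Bseq[OF convergentI[OF \<tau>(2)]] unfolding Bseq_def by auto
  define L where "L = max L0 \<tau> + 1"
  have kL: "real (k n) * \<delta> n \<le> L" for n using L0[of n] by (simp add: L_def)
  have L: "0 < L" "\<tau> \<le> L" using \<tau>(1) by (auto simp: L_def)
  have int: "(\<lambda>n. integral {0..real (k n) * \<delta> n} g) \<longlonglongrightarrow> integral {0..\<tau>} g"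
  proof (rule continuous_on_tendsto_compose[where f = "\<lambda>x. integral {0..x} g"])
    show "continuous_on {0..L} (\<lambda>x. integral {0..x} g)"
      by (intro indefinite_integral_continuous_1 integrable_continuous_real continuous_on_subset[OF g]) auto
    show "(\<lambda>n. real (k n) * \<delta> n) \<longlonglongrightarrow> \<tau>" by (rule \<tau>)
    show "\<tau> \<in> {0..L}" using \<tau> L by auto
    show "\<forall>\<^sub>F n in sequentially. real (k n) * \<delta> n \<in> {0..L}"
      using kL mult_nonneg_nonneg[OF of_nat_0_le_iff less_imp_le[OF \<delta>(1)]] by (auto intro!: always_eventually)
  qed
  have "(\<lambda>n. (\<Sum>j<k n. \<delta> n * g (real j * \<delta> n)) - integral {0..real (k n) * \<delta> n} g) \<longlonglongrightarrow> 0"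
  proof (rule LIMSEQ_I)
    fix e :: real assume e: "0 < e"
    have "uniformly_continuous_on {0..L} g"
      by (intro compact_uniformly_continuous continuous_on_subset[OF g]) auto
    moreover have "0 < e / (2 * L)" using e L by simp
    ultimately obtain d where d: "0 < d"
      "\<And>x y. x \<in> {0..L} \<Longrightarrow> y \<in> {0..L} \<Longrightarrow> dist y x < d \<Longrightarrow> dist (g y) (g x) < e / (2 * L)"
      unfolding uniformly_continuous_on_def by meson
    obtain N where N: "\<And>n. N \<le> n \<Longrightarrow> \<delta> n < d"
      using order_tendstoD(2)[OF \<delta>(2) d(1)] unfolding eventually_sequentially by auto
    have "norm ((\<Sum>j<k n. \<delta> n * g (real j * \<delta> n)) - integral {0..real (k n) * \<delta> n} g - 0) < e" if n: "N \<le> n" for n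
    proof -
      have "\<bar>(\<Sum>j<k n. \<delta> n * g (real j * \<delta> n)) - integral {0..real (k n) * \<delta> n} g\<bar> \<le> real (k n) * \<delta> n * (e / (2 * L))"
      proof (rule riemann_sum_error[OF g \<delta>(1) kL])
        show "\<bar>g x - g y\<bar> \<le> e / (2 * L)" if "x \<in> {0..L}" "y \<in> {0..L}" "\<bar>x - y\<bar> \<le> \<delta> n" for x y
          using d(2)[OF that(2,1)] that(3) N[OF n] by (auto simp: dist_real_def)
      qed
      also have "\<dots> \<le> L * (e / (2 * L))" using kL e L by (intro mult_right_mono) auto
      also have "\<dots> < e" using L e by simp
      finally show ?thesis by simp
    qed
    then show "\<exists>N. \<forall>n\<ge>N. norm ((\<Sum>j<k n. \<delta> n * g (real j * \<delta> n)) - integral {0..real (k n) * \<delta> n} g - 0) < e" by blast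
  qed
  from tendsto_add[OF this int] show ?thesis by simp
qed

text \<open>The last step before the exit may leave \<open>[\<alpha>,\<beta>]\<close>, so a mode has to be extended to a bounded function
with continuous second derivative on the line. Since \<open>\<psi>\<close> and \<open>\<psi>'' = - \<mu> r \<psi>\<close> both vanish at the
ends, a multiple of the sine fits: it has value 0, second derivative 0 and the slope of \<open>\<psi>\<close> there.\<close>

lemma (in dirichlet_string) mode_extension:
  assumes \<psi>: "mode \<mu> \<psi>"
  obtains F F' D where "continuous_on UNIV F" "\<And>z. \<bar>F z\<bar> \<le> D" "\<And>z. z \<in> I \<Longrightarrow> F z = \<psi> z"
    "\<And>\<epsilon>. 0 < \<epsilon> \<Longrightarrow> \<exists>C\<ge>0. \<forall>z\<in>I. \<forall>h.
        \<bar>F (z + h) - (F z + F' z * h + (- (\<mu> * F z * r z)) * h\<^sup>2 / 2)\<bar> \<le> \<epsilon> * h\<^sup>2 + C * h ^ 4"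
proof -
  obtain \<psi>' where d: "\<And>z. z \<in> I \<Longrightarrow> (\<psi> has_real_derivative \<psi>' z) (at z within I)"
    "\<And>z. z \<in> I \<Longrightarrow> (\<psi>' has_real_derivative - (\<mu> * \<psi> z * r z)) (at z within I)"
    and bd: "\<psi> \<alpha> = 0" "\<psi> \<beta> = 0"
    using \<psi> unfolding mode_def poisson_def by blast
  have c\<psi>: "continuous_on I \<psi>" using \<psi> by (rule mode_continuous)
  define k where "k z = \<mu> * \<psi> z * r z" for z
  have ck: "continuous_on I k" unfolding k_def by (intro continuous_intros c\<psi> mass_continuous)
  have kbd: "k \<alpha> = 0" "k \<beta> = 0" by (simp_all add: k_def bd)
  define p q where "p = \<psi>' \<alpha>" and "q = \<psi>' \<beta>"
  have I: "{\<alpha>..} \<inter> {..\<beta>} = I" "{\<alpha>..} \<inter> {\<beta>..} = {\<beta>..}" "UNIV \<inter> {..\<alpha>} = {..\<alpha>}" "UNIV \<inter> {\<alpha>..} = {\<alpha>..}"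
    using interval by auto
  define F1 where "F1 x = (if x < \<beta> then \<psi> x else q * sin (x - \<beta>))" for x
  define F1' where "F1' x = (if x < \<beta> then \<psi>' x else q * cos (x - \<beta>))" for x
  define F1'' where "F1'' x = (if x < \<beta> then - k x else - q * sin (x - \<beta>))" for x
  define F where "F x = (if x < \<alpha> then p * sin (x - \<alpha>) else F1 x)" for x
  define F' where "F' x = (if x < \<alpha> then p * cos (x - \<alpha>) else F1' x)" for x
  define F'' where "F'' x = (if x < \<alpha> then - p * sin (x - \<alpha>) else F1'' x)" for x
  have sin: "((\<lambda>x. s * sin (x - a)) has_real_derivative s * cos (x - a)) (at x within S)"
    and cos: "((\<lambda>x. s * cos (x - a)) has_real_derivative - s * sin (x - a)) (at x within S)" for s a x S
    by (auto intro!: derivative_eq_intros)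
  have "(F1 has_real_derivative F1' x) (at x within {\<alpha>..})" if "x \<in> {\<alpha>..}" for x
    unfolding F1_def[abs_def] F1'_def
    by (rule glue_derivatives[OF _ _ _ _ that]) (auto simp: I bd q_def intro!: d sin)
  note F1 = this
  have F: "(F has_real_derivative F' x) (at x)" for x
    unfolding F_def[abs_def] F'_def
    by (rule glue_derivatives[where S = UNIV])
       (use interval in \<open>simp_all add: I F1 sin\<close>, simp_all add: F1_def F1'_def bd p_def)
  have "(F1' has_real_derivative F1'' x) (at x within {\<alpha>..})" if "x \<in> {\<alpha>..}" for x
    unfolding F1'_def[abs_def] F1''_def
    by (rule glue_derivatives[OF _ _ _ _ that]) (use d(2) cos[of q] in \<open>auto simp: I bd q_def k_def\<close>)
  note F1' = this
  have F': "(F' has_real_derivative F'' x) (at x)" for x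
    unfolding F'_def[abs_def] F''_def
    by (rule glue_derivatives[where S = UNIV])
       (use interval in \<open>simp_all add: I F1' cos[simplified]\<close>, simp_all add: F1'_def F1''_def kbd p_def)
  let ?c = "\<lambda>x. max \<alpha> (min \<beta> x)"
  \<comment> \<open>One formula without case distinction shows continuity and boundedness at once.\<close>
  have F''_eq: "F'' x = - (p * sin (min 0 (x - \<alpha>))) - k (?c x) - q * sin (max 0 (x - \<beta>))" for x
    using interval kbd by (auto simp: F''_def F1''_def max_def min_def)
  have F_eq: "F x = p * sin (min 0 (x - \<alpha>)) + \<psi> (?c x) + q * sin (max 0 (x - \<beta>))" for x
    using interval bd by (auto simp: F_def F1_def max_def min_def)
  have clamp: "continuous_on UNIV (\<lambda>x. f (?c x))" if "continuous_on I f" for f :: "real \<Rightarrow> real"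
    using interval by (intro continuous_on_compose2[OF that] continuous_intros) auto
  obtain C1 where C1: "\<And>z. z \<in> I \<Longrightarrow> \<bar>\<psi> z\<bar> \<le> C1" using continuous_on_Icc_bounded[OF c\<psi>] by blast
  obtain C2 where C2: "\<And>z. z \<in> I \<Longrightarrow> \<bar>k z\<bar> \<le> C2" using continuous_on_Icc_bounded[OF ck] by blast
  have ps: "\<bar>s * sin y\<bar> \<le> \<bar>s\<bar>" for s y :: real
    by (simp add: abs_mult mult_left_le)
  have cI: "?c x \<in> I" for x using interval by auto
  have tri: "\<bar>x + y + w\<bar> \<le> a + b + c" "\<bar>- x - y - w\<bar> \<le> a + b + c"
    if "\<bar>x\<bar> \<le> a" "\<bar>y\<bar> \<le> b" "\<bar>w\<bar> \<le> c" for x y w a b c :: real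
    using that by linarith+
  have FD: "\<bar>F x\<bar> \<le> \<bar>p\<bar> + C1 + \<bar>q\<bar>" for x
    unfolding F_eq by (rule tri(1)[OF ps C1[OF cI] ps])
  have F''D: "\<bar>F'' x\<bar> \<le> \<bar>p\<bar> + C2 + \<bar>q\<bar>" for x
    unfolding F''_eq by (rule tri(2)[OF ps C2[OF cI] ps])
  have cF'': "continuous_on UNIV F''" unfolding F''_eq[abs_def] by (intro continuous_intros clamp ck)
  have cF: "continuous_on UNIV F" unfolding F_eq[abs_def] by (intro continuous_intros clamp c\<psi>)
  have F\<psi>: "F z = \<psi> z" if "z \<in> I" for z using that bd by (auto simp: F_def F1_def)
  have F''\<psi>: "F'' z = - (\<mu> * F z * r z)" if "z \<in> I" for z
    using that kbd F\<psi>[OF that] by (auto simp: F''_def F1''_def k_def)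
  show thesis
  proof (rule that[OF cF FD F\<psi>])
    fix \<epsilon> :: real assume "0 < \<epsilon>"
    from Taylor2_uniform_remainder[OF F F' cF'' F''D this, of \<alpha> \<beta>] obtain C where "0 \<le> C"
      "\<And>z h. z \<in> I \<Longrightarrow> \<bar>F (z + h) - (F z + F' z * h + F'' z * h\<^sup>2 / 2)\<bar> \<le> \<epsilon> * h\<^sup>2 + C * h ^ 4" by blast
    then show "\<exists>C\<ge>0. \<forall>z\<in>I. \<forall>h.
        \<bar>F (z + h) - (F z + F' z * h + (- (\<mu> * F z * r z)) * h\<^sup>2 / 2)\<bar> \<le> \<epsilon> * h\<^sup>2 + C * h ^ 4"
      by (intro exI[of _ C]) (simp add: F''\<psi>)
  qed
qed

section \<open>The clock, its inverse and the exit time\<close>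

lemma floor_grid_tendsto:
  assumes "0 \<le> x"
  shows "(\<lambda>n. real (nat \<lfloor>x * real (Suc n)\<rfloor>) / real (Suc n)) \<longlonglongrightarrow> x"
proof (rule tendsto_sandwich)
  have i: "real (nat \<lfloor>x * real (Suc n)\<rfloor>) = of_int \<lfloor>x * real (Suc n)\<rfloor>" for n
    using assms by (intro of_nat_nat) simp
  have "x - 1 / real (Suc n) \<le> of_int \<lfloor>x * real (Suc n)\<rfloor> / real (Suc n)" for n
  proof -
    have "(x - 1 / real (Suc n)) * real (Suc n) = x * real (Suc n) - 1" by (simp add: field_simps)
    also have "\<dots> \<le> of_int \<lfloor>x * real (Suc n)\<rfloor>" by linarith
    finally show ?thesis by (subst pos_le_divide_eq) simp_all
  qed
  then show "\<forall>\<^sub>F n in sequentially. x - 1 / real (Suc n) \<le> real (nat \<lfloor>x * real (Suc n)\<rfloor>) / real (Suc n)"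
    unfolding i by (intro always_eventually allI)
  have "of_int \<lfloor>x * real (Suc n)\<rfloor> / real (Suc n) \<le> x" for n
    by (subst pos_divide_le_eq) simp_all
  then show "\<forall>\<^sub>F n in sequentially. real (nat \<lfloor>x * real (Suc n)\<rfloor>) / real (Suc n) \<le> x"
    unfolding i by (intro always_eventually allI)
  have "(\<lambda>n. x - 1 / real (Suc n)) \<longlonglongrightarrow> x - 0"
    by (intro tendsto_intros LIMSEQ_Suc[OF lim_const_over_n])
  then show "(\<lambda>n. x - 1 / real (Suc n)) \<longlonglongrightarrow> x" by simp
qed simp

locale killed_clock = brownian M B z0 + dirichlet_string \<alpha> \<beta> r
  for M :: "'w measure" and B z0 \<alpha> \<beta> r +
  assumes start: "\<alpha> < z0" "z0 < \<beta>"
begin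

text \<open>The argument is clamped to \<open>[\<alpha>,\<beta>]\<close> so that the clock runs at a rate between positive bounds for all
times. Then the clock has an inverse on \<open>[0,\<infinity>)\<close>, and survival can be expressed by this inverse
without reference to the exit time; before the exit nothing changes.\<close>

definition rate :: "real \<Rightarrow> real" where
  "rate z = r (max \<alpha> (min \<beta> z)) / 2"

definition clock :: "'w \<Rightarrow> real \<Rightarrow> real" where
  "clock \<omega> u = integral {0..u} (\<lambda>v. rate (B v \<omega>))"

definition inside :: "real \<Rightarrow> 'w set" where
  "inside u = {\<omega> \<in> space M. \<forall>v\<in>{0..u}. \<alpha> < B v \<omega> \<and> B v \<omega> < \<beta>}"

definition stop :: "real \<Rightarrow> 'w \<Rightarrow> real" where
  "stop t \<omega> = (THE u. 0 \<le> u \<and> clock \<omega> u = t)"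

definition alive :: "real \<Rightarrow> 'w set" where
  "alive t = {\<omega> \<in> space M. \<omega> \<in> inside (stop t \<omega>)}"

lemma rate_inside: "z \<in> I \<Longrightarrow> rate z = r z / 2"
  by (auto simp: rate_def max_def min_def)

lemma rate_continuous: "continuous_on UNIV rate"
  unfolding rate_def using interval
  by (intro continuous_intros continuous_on_compose2[OF mass_continuous]) auto

lemma rate_measurable [measurable]: "rate \<in> borel_measurable borel"
  by (rule borel_measurable_continuous_onI[OF rate_continuous])

lemma rate_bounds:
  obtains m R where "0 < m" "m \<le> R" "\<And>z. m \<le> rate z" "\<And>z. rate z \<le> R"
proof -
  have ne: "I \<noteq> {}" using interval by simp
  obtain x where x: "x \<in> I" "\<And>z. z \<in> I \<Longrightarrow> r x \<le> r z"
    using continuous_attains_inf[OF compact_Icc ne mass_continuous] by blast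
  obtain y where y: "y \<in> I" "\<And>z. z \<in> I \<Longrightarrow> r z \<le> r y"
    using continuous_attains_sup[OF compact_Icc ne mass_continuous] by blast
  have c: "max \<alpha> (min \<beta> z) \<in> I" for z using interval by auto
  show thesis
    by (rule that[of "r x / 2" "r y / 2"])
       (use mass_pos[OF x(1)] x(2)[OF y(1)] x(2)[OF c] y(2)[OF c] in \<open>auto simp: rate_def\<close>)
qed

context
  fixes \<omega> assumes \<omega>: "\<omega> \<in> space M"
begin

lemma path_on: "0 \<le> a \<Longrightarrow> continuous_on {a..b} (\<lambda>v. B v \<omega>)"
  by (rule continuous_on_subset[OF B_path[OF \<omega>]]) auto

lemma rate_path: "continuous_on {0..} (\<lambda>v. rate (B v \<omega>))"
  by (rule continuous_on_compose2[OF rate_continuous B_path[OF \<omega>]]) auto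

lemma clock_0: "clock \<omega> 0 = 0"
  by (simp add: clock_def)

lemma clock_increment:
  assumes "0 \<le> u" "u \<le> v" "\<And>z. m \<le> rate z" "\<And>z. rate z \<le> R"
  shows "m * (v - u) \<le> clock \<omega> v - clock \<omega> u" "clock \<omega> v - clock \<omega> u \<le> R * (v - u)"
proof -
  have int: "(\<lambda>v. rate (B v \<omega>)) integrable_on {x..y}" if "0 \<le> x" for x y
    using that by (intro integrable_continuous_real continuous_on_subset[OF rate_path]) auto
  have "clock \<omega> v - clock \<omega> u = integral {u..v} (\<lambda>v. rate (B v \<omega>))"
    unfolding clock_def using Henstock_Kurzweil_Integration.integral_combine[OF assms(1,2) int[OF order_refl]] by simp
  moreover have "integral {u..v} (\<lambda>_. m) \<le> integral {u..v} (\<lambda>v. rate (B v \<omega>))"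
    by (intro integral_le int assms) auto
  moreover have "integral {u..v} (\<lambda>v. rate (B v \<omega>)) \<le> integral {u..v} (\<lambda>_. R)"
    by (intro integral_le int assms) auto
  ultimately show "m * (v - u) \<le> clock \<omega> v - clock \<omega> u" "clock \<omega> v - clock \<omega> u \<le> R * (v - u)"
    using assms(2) by (simp_all add: mult.commute)
qed

lemma clock_strict_mono: "0 \<le> u \<Longrightarrow> u < v \<Longrightarrow> clock \<omega> u < clock \<omega> v"
proof -
  assume u: "0 \<le> u" "u < v"
  obtain m R where m: "0 < m" "\<And>z. m \<le> rate z" "\<And>z. rate z \<le> R" using rate_bounds by metis
  have "0 < m * (v - u)" using m(1) u by simp
  also have "\<dots> \<le> clock \<omega> v - clock \<omega> u" using u by (intro clock_increment(1)[where R = R] m) auto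
  finally show ?thesis by simp
qed

lemma clock_continuous: "continuous_on {0..b} (clock \<omega>)"
  unfolding clock_def[abs_def]
  by (intro indefinite_integral_continuous_1 integrable_continuous_real continuous_on_subset[OF rate_path]) auto

lemma stop_exists:
  assumes "0 \<le> t" and m: "0 < m" "\<And>z. m \<le> rate z"
  shows "\<exists>u. 0 \<le> u \<and> u \<le> t / m \<and> clock \<omega> u = t"
proof -
  obtain R where R: "\<And>z. rate z \<le> R" using rate_bounds by metis
  have "m * (t / m - 0) \<le> clock \<omega> (t / m) - clock \<omega> 0"
    using assms by (intro clock_increment(1)[OF _ _ m(2) R]) auto
  then have "t \<le> clock \<omega> (t / m)" using m(1) clock_0 by simp
  then show ?thesis
    using IVT'[of "clock \<omega>" 0 t "t / m"] clock_0 clock_continuous assms by auto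
qed

lemma stop_props:
  assumes "0 \<le> t"
  shows stop_nonneg: "0 \<le> stop t \<omega>" and clock_stop: "clock \<omega> (stop t \<omega>) = t"
proof -
  obtain m where m: "0 < m" "\<And>z. m \<le> rate z" using rate_bounds by metis
  obtain u where u: "0 \<le> u" "clock \<omega> u = t" using stop_exists[OF assms m] by blast
  have "\<exists>!u. 0 \<le> u \<and> clock \<omega> u = t"
  proof (rule ex1I[of _ u])
    fix v assume "0 \<le> v \<and> clock \<omega> v = t"
    then show "v = u" using u clock_strict_mono[of u v] clock_strict_mono[of v u] by (cases u v rule: linorder_cases) auto
  qed (use u in auto)
  from theI'[OF this] show "0 \<le> stop t \<omega>" "clock \<omega> (stop t \<omega>) = t" unfolding stop_def by auto
qed

lemma less_stop_iff: "0 \<le> t \<Longrightarrow> 0 \<le> u \<Longrightarrow> u < stop t \<omega> \<longleftrightarrow> clock \<omega> u < t"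
  using stop_props[of t] clock_strict_mono[of u "stop t \<omega>"] clock_strict_mono[of "stop t \<omega>" u]
  by (cases u "stop t \<omega>" rule: linorder_cases) auto

lemma stop_eqI: "0 \<le> u \<Longrightarrow> clock \<omega> u = t \<Longrightarrow> 0 \<le> t \<Longrightarrow> stop t \<omega> = u"
  using stop_props[of t] clock_strict_mono[of u "stop t \<omega>"] clock_strict_mono[of "stop t \<omega>" u]
  by (cases u "stop t \<omega>" rule: linorder_cases) auto

lemma stop_le: 
  assumes "0 \<le> t" "0 < m" "\<And>z. m \<le> rate z"
  shows "stop t \<omega> \<le> t / m"
  using stop_exists[OF assms] stop_eqI assms(1) by metis

text \<open>Either the clock reaches \<open>t\<close> first or the path exits first; \<open>\<tau>\<close> is the time at which this happens.
To be inside with the clock below \<open>t\<close> is to be before \<open>\<tau>\<close>.\<close>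

lemma exit_dichotomy:
  assumes t: "0 \<le> t"
  obtains \<tau> where "0 \<le> \<tau>" "\<tau> \<le> stop t \<omega>"
    "\<And>u. 0 \<le> u \<Longrightarrow> \<omega> \<in> inside u \<and> clock \<omega> u < t \<longleftrightarrow> u < \<tau>"
    "\<omega> \<in> alive t \<Longrightarrow> \<tau> = stop t \<omega>" "\<omega> \<notin> alive t \<Longrightarrow> B \<tau> \<omega> = \<alpha> \<or> B \<tau> \<omega> = \<beta>"
proof (cases "\<omega> \<in> alive t")
  case True
  have "\<omega> \<in> inside u \<and> clock \<omega> u < t \<longleftrightarrow> u < stop t \<omega>" if "0 \<le> u" for u
    using True that less_stop_iff[OF t that] by (auto simp: alive_def inside_def)
  with True show thesis by (intro that[of "stop t \<omega>"]) (auto simp: stop_nonneg[OF t])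
next
  case False
  let ?s = "stop t \<omega>"
  \<comment> \<open>The exit times up to \<open>stop t \<omega>\<close>; the least one is the exit.\<close>
  define E where "E = {v \<in> {0..?s}. B v \<omega> \<in> {..\<alpha>} \<union> {\<beta>..}}"
  have "closed E"
    unfolding E_def using continuous_closed_preimage[OF path_on[OF order_refl, of ?s], of "{..\<alpha>} \<union> {\<beta>..}"]
      closed_Un[OF closed_atMost[of \<alpha>] closed_atLeast[of \<beta>]]
    by (simp add: vimage_def Int_def conj_commute)
  moreover have "bounded E" by (rule bounded_subset[of "{0..?s}"]) (auto simp: E_def)
  moreover have "E \<noteq> {}"
    using False \<omega> by (auto simp: alive_def inside_def E_def not_less)
  ultimately obtain \<tau> where \<tau>: "\<tau> \<in> E" "\<And>v. v \<in> E \<Longrightarrow> \<tau> \<le> v"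
    using compact_attains_inf[of E] compact_eq_bounded_closed by blast
  have \<tau>s: "0 \<le> \<tau>" "\<tau> \<le> ?s" "B \<tau> \<omega> \<le> \<alpha> \<or> \<beta> \<le> B \<tau> \<omega>" using \<tau>(1) by (auto simp: E_def)
  have before: "\<alpha> < B v \<omega> \<and> B v \<omega> < \<beta>" if "0 \<le> v" "v < \<tau>" for v
    using \<tau>(2)[of v] that \<tau>s by (force simp: E_def)
  have "0 < \<tau>" using \<tau>s start B_start[OF \<omega>] by (cases "\<tau> = 0") auto
  have exit: "B \<tau> \<omega> = \<alpha> \<or> B \<tau> \<omega> = \<beta>"
  proof -
    define v where "v n = \<tau> * (1 - 1 / real (Suc (Suc n)))" for n
    have v: "0 \<le> v n" "v n < \<tau>" for n using \<open>0 < \<tau>\<close> by (auto simp: v_def)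
    have "v \<longlonglongrightarrow> \<tau> * (1 - 0)"
      unfolding v_def by (intro tendsto_intros LIMSEQ_Suc[OF LIMSEQ_Suc[OF lim_const_over_n]])
    then have "(\<lambda>n. B (v n) \<omega>) \<longlonglongrightarrow> B \<tau> \<omega>"
      using v \<tau>s(1) by (intro continuous_on_tendsto_compose[OF B_path[OF \<omega>]]) auto
    then have "B \<tau> \<omega> \<in> I"
      by (rule closed_sequentially[OF closed_atLeastAtMost, rotated]) (use before[OF v] in \<open>auto intro: less_imp_le\<close>)
    with \<tau>s(3) show ?thesis by auto
  qed
  show thesis
  proof (rule that[OF \<tau>s(1,2)])
    fix u :: real assume u: "0 \<le> u"
    show "\<omega> \<in> inside u \<and> clock \<omega> u < t \<longleftrightarrow> u < \<tau>"
    proof (cases "u < \<tau>")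
      case True
      then have "\<omega> \<in> inside u" using before \<omega> by (auto simp: inside_def)
      moreover have "clock \<omega> u < t" using less_stop_iff[OF t u] True \<tau>s(2) by simp
      ultimately show ?thesis using True by simp
    next
      case False
      then have "\<tau> \<in> {0..u}" using \<tau>s(1) by simp
      then have "\<omega> \<notin> inside u" using \<tau>s(3) unfolding inside_def by fastforce
      with False show ?thesis by simp
    qed
  qed (use False exit in auto)
qed

end

text \<open>By compactness a path that stays inside the open interval stays in a smaller closed one, and by
continuity that can be tested at countably many times.\<close>

lemma inside_past:
  assumes u: "0 \<le> u"
  shows "inside u \<in> sets (past u)"
proof -
  \<comment> \<open>the rational multiples of \<open>u\<close> in \<open>[0,u]\<close>\<close>
  let ?g = "\<lambda>n i. u * (real i / real (Suc n))"
  have g: "0 \<le> ?g n i" "?g n i \<le> u" if "i \<le> Suc n" for n i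
  proof -
    have "real i / real (Suc n) \<le> 1" using that by (simp add: divide_le_eq)
    then show "0 \<le> ?g n i" "?g n i \<le> u" using u mult_left_le[of "real i / real (Suc n)" u] by auto
  qed
  have eq: "inside u = (\<Union>m. {\<omega> \<in> space M. \<forall>n. \<forall>i\<in>{..Suc n}.
      B (?g n i) \<omega> \<in> {\<alpha> + 1 / real (Suc m)..\<beta> - 1 / real (Suc m)}})" (is "_ = (\<Union>m. ?G m)")
  proof (intro set_eqI iffI)
    fix \<omega> assume "\<omega> \<in> inside u"
    then have \<omega>: "\<omega> \<in> space M" and ins: "\<And>v. v \<in> {0..u} \<Longrightarrow> \<alpha> < B v \<omega> \<and> B v \<omega> < \<beta>" by (auto simp: inside_def)
    have ne: "{0..u} \<noteq> {}" using u by simp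
    obtain x where x: "x \<in> {0..u}" "\<And>v. v \<in> {0..u} \<Longrightarrow> B x \<omega> \<le> B v \<omega>"
      using continuous_attains_inf[OF compact_Icc ne path_on[OF \<omega> order_refl]] by blast
    obtain y where y: "y \<in> {0..u}" "\<And>v. v \<in> {0..u} \<Longrightarrow> B v \<omega> \<le> B y \<omega>"
      using continuous_attains_sup[OF compact_Icc ne path_on[OF \<omega> order_refl]] by blast
    have "0 < min (B x \<omega> - \<alpha>) (\<beta> - B y \<omega>)" using ins[OF x(1)] ins[OF y(1)] by auto
    then obtain m where m: "1 / real (Suc m) < min (B x \<omega> - \<alpha>) (\<beta> - B y \<omega>)"
      using nat_approx_posE by blast
    have "B (?g n i) \<omega> \<in> {\<alpha> + 1 / real (Suc m)..\<beta> - 1 / real (Suc m)}" if "i \<le> Suc n" for n i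
      using g[OF that] x(2)[of "?g n i"] y(2)[of "?g n i"] m by auto
    then show "\<omega> \<in> (\<Union>m. ?G m)" using \<omega> by auto
  next
    fix \<omega> assume "\<omega> \<in> (\<Union>m. ?G m)"
    then obtain m where \<omega>: "\<omega> \<in> space M" and m: "\<And>n i. i \<le> Suc n \<Longrightarrow>
        B (?g n i) \<omega> \<in> {\<alpha> + 1 / real (Suc m)..\<beta> - 1 / real (Suc m)}" by auto
    have "\<alpha> < B v \<omega> \<and> B v \<omega> < \<beta>" if v: "v \<in> {0..u}" for v
    proof -
      define i where "i n = nat \<lfloor>v / u * real (Suc n)\<rfloor>" for n
      have vu: "0 \<le> v / u" "v / u \<le> 1" using v by (auto simp: divide_le_eq_1)
      have i: "real (i n) = of_int \<lfloor>v / u * real (Suc n)\<rfloor>" for n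
        unfolding i_def by (intro of_nat_nat) (simp only: zero_le_floor mult_nonneg_nonneg[OF vu(1) of_nat_0_le_iff])
      have iSuc: "i n \<le> Suc n" for n
      proof -
        have "v / u * real (Suc n) \<le> 1 * real (Suc n)" using vu by (intro mult_right_mono) auto
        from order_trans[OF of_int_floor_le this] have "real (i n) \<le> real (Suc n)"
          unfolding i by (simp only: mult_1)
        then show ?thesis by simp
      qed
      have "(\<lambda>n. real (i n) / real (Suc n)) \<longlonglongrightarrow> v / u"
        unfolding i_def by (rule floor_grid_tendsto[OF vu(1)])
      then have "(\<lambda>n. ?g n (i n)) \<longlonglongrightarrow> u * (v / u)" by (rule tendsto_mult_left)
      moreover have "u * (v / u) = v" using v by auto
      ultimately have "(\<lambda>n. ?g n (i n)) \<longlonglongrightarrow> v" by simp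
      then have "(\<lambda>n. B (?g n (i n)) \<omega>) \<longlonglongrightarrow> B v \<omega>"
        using v g(1)[OF iSuc] by (intro continuous_on_tendsto_compose[OF B_path[OF \<omega>]]) auto
      then have "B v \<omega> \<in> {\<alpha> + 1 / real (Suc m)..\<beta> - 1 / real (Suc m)}"
        by (rule closed_sequentially[OF closed_atLeastAtMost, rotated]) (rule m[OF iSuc])
      moreover have "0 < 1 / real (Suc m)" by simp
      ultimately show ?thesis unfolding atLeastAtMost_iff by linarith
    qed
    then show "\<omega> \<in> inside u" using \<omega> by (auto simp: inside_def)
  qed
  have "{\<omega> \<in> space (past u). B (?g n i) \<omega> \<in> {x..y}} \<in> sets (past u)" if "i \<le> Suc n" for n i x y
    using measurable_sets[OF B_measurable_past[OF g[OF that]], of "{x..y}"]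
    by (simp add: vimage_def Int_def conj_commute)
  note grid_event = this
  have "{\<omega> \<in> space (past u). \<forall>n. \<forall>i\<in>{..Suc n}.
      B (?g n i) \<omega> \<in> {\<alpha> + 1 / real (Suc m)..\<beta> - 1 / real (Suc m)}} \<in> sets (past u)" for m
    by (rule sets.sets_Collect_countable_All, rule sets.sets_Collect_finite_All, rule grid_event) auto
  then show ?thesis
    unfolding eq space_past by (intro sets.countable_UN) auto
qed

text \<open>The clock is a limit of Riemann sums of the past.\<close>

lemma clock_past:
  assumes u: "0 \<le> u"
  shows "(\<lambda>\<omega>. clock \<omega> u) \<in> borel_measurable (past u)"
proof (cases "u = 0")
  case True
  then show ?thesis by (simp add: clock_def)
next
  case False
  then have u: "0 < u" using u by simp
  let ?\<delta> = "\<lambda>n. u / real (Suc n)"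
  show ?thesis
  proof (rule borel_measurable_LIMSEQ_real)
    fix \<omega> assume "\<omega> \<in> space (past u)"
    then show "(\<lambda>n. \<Sum>j<Suc n. ?\<delta> n * rate (B (real j * ?\<delta> n) \<omega>)) \<longlonglongrightarrow> clock \<omega> u"
      unfolding clock_def using u
      by (intro riemann_sum_tendsto[where k = Suc] rate_path LIMSEQ_Suc[OF lim_const_over_n]) (auto simp del: of_nat_Suc)
  next
    fix n
    have "real j * ?\<delta> n \<le> u" if "j < Suc n" for j
    proof -
      have "u * real j \<le> u * real (Suc n)" using u that by (intro mult_left_mono) auto
      then show ?thesis by (simp only: times_divide_eq_right divide_le_eq) (simp add: mult.commute)
    qed
    then have "B (real j * ?\<delta> n) \<in> borel_measurable (past u)" if "j < Suc n" for j
      using u that by (intro B_measurable_past) auto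
    then show "(\<lambda>\<omega>. \<Sum>j<Suc n. ?\<delta> n * rate (B (real j * ?\<delta> n) \<omega>)) \<in> borel_measurable (past u)"
      by (intro borel_measurable_sum borel_measurable_times borel_measurable_const
          measurable_compose[OF _ rate_measurable]) auto
  qed
qed

lemma inside_event: "0 \<le> u \<Longrightarrow> inside u \<in> events"
  using inside_past sets_past_subset by blast

lemma clock_measurable: "0 \<le> u \<Longrightarrow> (\<lambda>\<omega>. clock \<omega> u) \<in> borel_measurable M"
  using measurable_past_subset[OF clock_past] .

lemma stop_measurable:
  assumes t: "0 \<le> t"
  shows "stop t \<in> borel_measurable M"
proof (rule borel_measurableI_le)
  fix u
  show "{\<omega> \<in> space M. stop t \<omega> \<le> u} \<in> events"
  proof (cases "0 \<le> u")
    case True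
    have "{\<omega> \<in> space M. stop t \<omega> \<le> u} = {\<omega> \<in> space M. t \<le> clock \<omega> u}"
      using less_stop_iff[OF _ t True] by (auto simp: not_less[symmetric])
    also have "\<dots> \<in> events" using clock_measurable[OF True] by measurable
    finally show ?thesis .
  next
    case False
    then have "{\<omega> \<in> space M. stop t \<omega> \<le> u} = {}" using stop_nonneg[OF _ t] by force
    then show ?thesis by (simp only: sets.empty_sets)
  qed
qed

text \<open>A path that is inside up to \<open>stop t\<close> stays inside a little longer, up to a rational time \<open>q\<close> at which
the clock is beyond \<open>t\<close>.\<close>

lemma alive_event:
  assumes t: "0 \<le> t"
  shows "alive t \<in> events"
proof -
  have eq: "alive t = (\<Union>q\<in>\<rat> \<inter> {0..}. inside q \<inter> {\<omega> \<in> space M. t < clock \<omega> q})"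
  proof (intro set_eqI iffI)
    fix \<omega> assume al: "\<omega> \<in> alive t"
    then have \<omega>: "\<omega> \<in> space M" and ins: "\<omega> \<in> inside (stop t \<omega>)" by (auto simp: alive_def)
    have s: "0 \<le> stop t \<omega>" by (rule stop_nonneg[OF \<omega> t])
    have "B (stop t \<omega>) \<omega> \<in> {\<alpha><..<\<beta>}" using ins s by (auto simp: inside_def)
    then have "\<forall>\<^sub>F v in at (stop t \<omega>) within {0..}. B v \<omega> \<in> {\<alpha><..<\<beta>}"
      using B_path[OF \<omega>] s by (intro topological_tendstoD[where l = "B (stop t \<omega>) \<omega>"]) (auto simp: continuous_on_def)
    then obtain d where d: "0 < d" "\<And>v. 0 \<le> v \<Longrightarrow> v \<noteq> stop t \<omega> \<Longrightarrow> \<bar>v - stop t \<omega>\<bar> < d \<Longrightarrow> B v \<omega> \<in> {\<alpha><..<\<beta>}"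
      unfolding eventually_at dist_real_def by auto
    obtain q where q: "q \<in> \<rat>" "stop t \<omega> < q" "q < stop t \<omega> + d"
      using Rats_dense_in_real[of "stop t \<omega>" "stop t \<omega> + d"] d(1) by auto
    have "\<omega> \<in> inside q"
      unfolding inside_def
    proof (intro CollectI conjI ballI)
      fix v assume v: "v \<in> {0..q}"
      have "B v \<omega> \<in> {\<alpha><..<\<beta>}"
      proof (cases "v \<le> stop t \<omega>")
        case True then show ?thesis using ins v by (auto simp: inside_def)
      next
        case False then show ?thesis using v q by (intro d(2)) auto
      qed
      then show "\<alpha> < B v \<omega>" "B v \<omega> < \<beta>" by auto
    qed (rule \<omega>)
    moreover have "t < clock \<omega> q" using clock_strict_mono[OF \<omega> s q(2)] clock_stop[OF \<omega> t] by simp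
    ultimately show "\<omega> \<in> (\<Union>q\<in>\<rat> \<inter> {0..}. inside q \<inter> {\<omega> \<in> space M. t < clock \<omega> q})"
      using q s \<omega> by auto
  next
    fix \<omega> assume "\<omega> \<in> (\<Union>q\<in>\<rat> \<inter> {0..}. inside q \<inter> {\<omega> \<in> space M. t < clock \<omega> q})"
    then obtain q where q: "0 \<le> q" "\<omega> \<in> inside q" "\<omega> \<in> space M" "t < clock \<omega> q" by auto
    then have "stop t \<omega> \<le> q" using less_stop_iff[OF q(3) t q(1)] by (simp add: not_less[symmetric])
    then show "\<omega> \<in> alive t" using q by (auto simp: alive_def inside_def)
  qed
  show ?thesis
    unfolding eq
  proof (rule sets.countable_UN'')
    show "countable (\<rat> \<inter> {0::real..})" using countable_rat by blast
    fix q :: real assume "q \<in> \<rat> \<inter> {0..}"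
    then have q: "0 \<le> q" by simp
    note [measurable] = clock_measurable[OF q]
    show "inside q \<inter> {\<omega> \<in> space M. t < clock \<omega> q} \<in> events"
      by (intro sets.Int inside_event q) measurable
  qed
qed

text \<open>Approximate the random time by its roundings to multiples of \<open>1/n\<close>, which take countably many values.\<close>

lemma B_stop_measurable:
  assumes t: "0 \<le> t"
  shows "(\<lambda>\<omega>. B (stop t \<omega>) \<omega>) \<in> borel_measurable M"
proof (rule borel_measurable_LIMSEQ_real)
  let ?g = "\<lambda>n \<omega>. nat \<lfloor>stop t \<omega> * real (Suc n)\<rfloor>"
  fix \<omega> assume \<omega>: "\<omega> \<in> space M"
  have s: "0 \<le> stop t \<omega>" by (rule stop_nonneg[OF \<omega> t])
  from floor_grid_tendsto[OF s]
  show "(\<lambda>n. B (real (?g n \<omega>) / real (Suc n)) \<omega>) \<longlonglongrightarrow> B (stop t \<omega>) \<omega>"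
    using s by (intro continuous_on_tendsto_compose[OF B_path[OF \<omega>]]) auto
next
  fix n
  note [measurable] = stop_measurable[OF t]
  show "(\<lambda>\<omega>. B (real (nat \<lfloor>stop t \<omega> * real (Suc n)\<rfloor>) / real (Suc n)) \<omega>) \<in> borel_measurable M"
    by (rule measurable_compose_countable[where f = "\<lambda>i. B (real i / real (Suc n))"])
       (intro B_measurable, simp, measurable)
qed

end

section \<open>The exponential martingale of an eigenfunction\<close>

lemma exp_second_order_defect:
  fixes x :: real
  assumes "0 \<le> x"
  shows "\<bar>exp x * (1 - x) - 1\<bar> \<le> x\<^sup>2 * exp x"
proof -
  have "exp x * (1 - x) \<le> exp x * exp (- x)"
    using exp_ge_add_one_self[of "- x"] by (intro mult_left_mono) auto
  then have upper: "exp x * (1 - x) \<le> 1" by (simp flip: exp_add)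
  have "1 \<le> (1 + x) * (1 - x + x\<^sup>2)"
    using assms by (simp add: algebra_simps power2_eq_square)
  also have "\<dots> \<le> exp x * (1 - x + x\<^sup>2)"
  proof (rule mult_right_mono)
    have "0 \<le> (1 - x)\<^sup>2 + x" using assms by simp
    then show "0 \<le> 1 - x + x\<^sup>2" by (simp add: power2_eq_square algebra_simps)
  qed (rule exp_ge_add_one_self)
  finally have "1 \<le> exp x * (1 - x + x\<^sup>2)" .
  with upper show ?thesis by (simp add: algebra_simps abs_le_iff)
qed

lemma sum_stopped_telescope:
  fixes Z :: "nat \<Rightarrow> real"
  assumes "K \<le> L" "\<And>k. k < L \<Longrightarrow> w k = (if k < K then 1 else 0)"
  shows "(\<Sum>k<L. w k * (Z (Suc k) - Z k)) = Z K - Z 0"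
proof -
  have "(\<Sum>k<L. w k * (Z (Suc k) - Z k)) = (\<Sum>k<K. w k * (Z (Suc k) - Z k))"
    using assms by (intro sum.mono_neutral_right) auto
  also have "\<dots> = (\<Sum>k<K. Z (Suc k) - Z k)"
    using assms by (intro sum.cong) auto
  also have "\<dots> = Z K - Z 0" by (rule sum_lessThan_telescope)
  finally show ?thesis .
qed

context killed_clock begin

definition grid_clock :: "real \<Rightarrow> nat \<Rightarrow> 'w \<Rightarrow> real" where
  "grid_clock \<delta> k \<omega> = (\<Sum>j<k. \<delta> * rate (B (real j * \<delta>) \<omega>))"

text \<open>The grid version of \<open>e\<^sup>l\<^sup>A F(B)\<close>. The Riemann sum replaces the clock because its value after the
next step is already determined by the past.\<close>

definition weighted :: "real \<Rightarrow> (real \<Rightarrow> real) \<Rightarrow> real \<Rightarrow> nat \<Rightarrow> 'w \<Rightarrow> real" where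
  "weighted l F \<delta> k \<omega> = exp (l * grid_clock \<delta> k \<omega>) * F (B (real k * \<delta>) \<omega>)"

definition running :: "real \<Rightarrow> real \<Rightarrow> 'w set" where
  "running t u = inside u \<inter> {\<omega> \<in> space M. clock \<omega> u < t}"

lemma running_past: "0 \<le> u \<Longrightarrow> running t u \<in> sets (past u)"
proof -
  assume u: "0 \<le> u"
  note [measurable] = clock_past[OF u]
  have "{\<omega> \<in> space (past u). clock \<omega> u < t} \<in> sets (past u)" by measurable
  then show ?thesis unfolding running_def using inside_past[OF u] by auto
qed

lemma grid_clock_past:
  assumes "0 \<le> \<delta>" "real k * \<delta> \<le> u + \<delta>"
  shows "grid_clock \<delta> k \<in> borel_measurable (past u)"
proof -
  have "real j * \<delta> \<le> u" if "j < k" for j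
  proof -
    have "real (Suc j) * \<delta> \<le> real k * \<delta>" using that assms(1) by (intro mult_right_mono) auto
    then show ?thesis using assms(2) by (simp add: algebra_simps)
  qed
  then have "B (real j * \<delta>) \<in> borel_measurable (past u)" if "j < k" for j
    using that assms(1) by (intro B_measurable_past) auto
  then show ?thesis
    unfolding grid_clock_def
    by (intro borel_measurable_sum borel_measurable_times borel_measurable_const
        measurable_compose[OF _ rate_measurable]) auto
qed

lemma grid_clock_bounds:
  assumes "0 \<le> \<delta>" "\<And>z. 0 \<le> rate z" "\<And>z. rate z \<le> R"
  shows "0 \<le> grid_clock \<delta> k \<omega>" "grid_clock \<delta> k \<omega> \<le> R * (real k * \<delta>)"
proof -
  show "0 \<le> grid_clock \<delta> k \<omega>" unfolding grid_clock_def using assms by (intro sum_nonneg) auto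
  have "grid_clock \<delta> k \<omega> \<le> (\<Sum>j<k. \<delta> * R)"
    unfolding grid_clock_def using assms by (intro sum_mono mult_left_mono) auto
  then show "grid_clock \<delta> k \<omega> \<le> R * (real k * \<delta>)" by (simp add: mult_ac)
qed

text \<open>For \<open>z\<close> in \<open>[\<alpha>,\<beta>]\<close> put \<open>x = l \<delta> r(z)/2\<close>. One step multiplies the weight by \<open>e\<^sup>x\<close> and replaces
\<open>F(z)\<close> by its Gaussian average, which is \<open>F(z) (1 - x)\<close> up to \<open>\<epsilon> \<delta> + 3 C \<delta>\<^sup>2\<close> because
\<open>F'' = - l r F\<close>. The two effects cancel to first order, as \<open>e\<^sup>x (1 - x) = 1 + O(x\<^sup>2)\<close>. Before the
clock shows \<open>t\<close> the accumulated weight is bounded, since then the time is at most \<open>t/m\<close>.\<close>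

lemma one_step_defect:
  assumes F: "continuous_on UNIV F" "\<And>z. \<bar>F z\<bar> \<le> D" and l: "0 < l" and t: "0 \<le> t"
    and rate: "0 < m" "\<And>z. m \<le> rate z" "\<And>z. rate z \<le> R"
    and C: "0 \<le> C" "\<And>z h. z \<in> I \<Longrightarrow>
        \<bar>F (z + h) - (F z + F' z * h + (- (l * F z * r z)) * h\<^sup>2 / 2)\<bar> \<le> \<epsilon> * h\<^sup>2 + C * h ^ 4"
    and \<delta>: "0 < \<delta>" "\<delta> \<le> 1" and \<epsilon>: "0 < \<epsilon>"
  shows "\<bar>expectation (\<lambda>\<omega>. indicator (running t (real k * \<delta>)) \<omega> * (weighted l F \<delta> (Suc k) \<omega> - weighted l F \<delta> k \<omega>))\<bar>
     \<le> exp (l * (R * (t / m))) * (exp (l * R) * (D * (l * R)\<^sup>2 * \<delta>\<^sup>2 + \<epsilon> * \<delta> + 3 * C * \<delta>\<^sup>2))"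
    and "integrable M (\<lambda>\<omega>. indicator (running t (real k * \<delta>)) \<omega> * (weighted l F \<delta> (Suc k) \<omega> - weighted l F \<delta> k \<omega>))"
proof -
  let ?Z = "weighted l F \<delta>"
  define u where "u = real k * \<delta>"
  have u: "0 \<le> u" "u < real (Suc k) * \<delta>" "real (Suc k) * \<delta> - u = \<delta>"
    using \<delta> by (auto simp: u_def algebra_simps)
  let ?E = "running t u"
  have R: "0 < R" using rate(1) rate(2)[of 0] rate(3)[of 0] by linarith
  have D: "0 \<le> D" using F(2)[of 0] by linarith
  have rate0: "0 \<le> rate z" for z using rate(1) rate(2)[of z] by linarith
  have Fm [measurable]: "F \<in> borel_measurable borel" by (rule borel_measurable_continuous_onI[OF F(1)])
  let ?H = "\<lambda>\<omega>. indicator ?E \<omega> * exp (l * grid_clock \<delta> (Suc k) \<omega>) :: real"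
  let ?P = "\<lambda>z. LINT y|lborel. normal_density 0 (sqrt \<delta>) y * F (z + y)"
  let ?G = "exp (l * (R * (t / m)))"
  define err where "err = exp (l * R) * (D * (l * R)\<^sup>2 * \<delta>\<^sup>2 + \<epsilon> * \<delta> + 3 * C * \<delta>\<^sup>2)"
  have E: "\<omega> \<in> space M \<and> B u \<omega> \<in> I \<and> u \<le> t / m" if "\<omega> \<in> ?E" for \<omega>
  proof -
    have \<omega>: "\<omega> \<in> space M" "clock \<omega> u < t" and ins: "\<omega> \<in> inside u" using that by (auto simp: running_def)
    have "B u \<omega> \<in> I" using ins u(1) by (auto simp: inside_def intro: less_imp_le)
    moreover have "u < stop t \<omega>" using less_stop_iff[OF \<omega>(1) t u(1)] \<omega>(2) by simp
    ultimately show ?thesis using stop_le[OF \<omega>(1) t rate(1,2)] \<omega> by auto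
  qed
  have G: "exp (l * grid_clock \<delta> k \<omega>) \<le> ?G" if "\<omega> \<in> ?E" for \<omega>
  proof -
    have "grid_clock \<delta> k \<omega> \<le> R * u"
      unfolding u_def using \<delta> by (intro grid_clock_bounds rate0 rate) auto
    also have "\<dots> \<le> R * (t / m)" using E[OF that] R by (intro mult_left_mono) auto
    finally have "l * grid_clock \<delta> k \<omega> \<le> l * (R * (t / m))" using l by (intro mult_left_mono) auto
    then show ?thesis by (simp only: exp_le_cancel_iff)
  qed
  have step: "exp (l * grid_clock \<delta> (Suc k) \<omega>) = exp (l * grid_clock \<delta> k \<omega>) * exp (l * (\<delta> * rate (B u \<omega>)))" for \<omega>
    by (simp add: grid_clock_def u_def distrib_left exp_add)
  have local_err: "\<bar>exp (l * (\<delta> * rate z)) * ?P z - F z\<bar> \<le> err" if z: "z \<in> I" for z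
  proof -
    define x where "x = l * (\<delta> * rate z)"
    have x0: "0 \<le> x" unfolding x_def using l \<delta> rate0[of z] by simp
    have "\<delta> * rate z \<le> \<delta> * R" using \<delta> rate(3)[of z] by (intro mult_left_mono) auto
    from mult_left_mono[OF this less_imp_le[OF l]] have "l * (\<delta> * rate z) \<le> l * (\<delta> * R)" .
    then have x1: "x \<le> l * R * \<delta>" by (simp add: x_def mult_ac)
    also have "\<dots> \<le> l * R" using \<delta> l R by (simp add: mult_left_le)
    finally have x2: "exp x \<le> exp (l * R)" by simp
    have "\<bar>?P z - (F z + (- (l * F z * r z)) * \<delta> / 2)\<bar> \<le> \<epsilon> * \<delta> + 3 * C * \<delta>\<^sup>2"
      by (rule gaussian_expansion[OF Fm F(2) \<delta>(1) C(2)[OF z]])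
    then have P: "\<bar>?P z - F z * (1 - x)\<bar> \<le> \<epsilon> * \<delta> + 3 * C * \<delta>\<^sup>2"
      by (simp add: x_def rate_inside[OF z] algebra_simps)
    have split: "exp x * ?P z - F z = F z * (exp x * (1 - x) - 1) + exp x * (?P z - F z * (1 - x))"
      by (simp add: algebra_simps)
    have b1: "\<bar>F z * (exp x * (1 - x) - 1)\<bar> \<le> D * ((l * R * \<delta>)\<^sup>2 * exp (l * R))"
      unfolding abs_mult
    proof (intro mult_mono F(2))
      have "x\<^sup>2 * exp x \<le> (l * R * \<delta>)\<^sup>2 * exp (l * R)"
        using x0 x1 x2 by (intro mult_mono power_mono) auto
      with exp_second_order_defect[OF x0]
      show "\<bar>exp x * (1 - x) - 1\<bar> \<le> (l * R * \<delta>)\<^sup>2 * exp (l * R)" by linarith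
    qed (use D in auto)
    have b2: "\<bar>exp x * (?P z - F z * (1 - x))\<bar> \<le> exp (l * R) * (\<epsilon> * \<delta> + 3 * C * \<delta>\<^sup>2)"
      unfolding abs_mult using P x2 by (intro mult_mono) auto
    have "\<bar>exp x * ?P z - F z\<bar> \<le> D * ((l * R * \<delta>)\<^sup>2 * exp (l * R)) + exp (l * R) * (\<epsilon> * \<delta> + 3 * C * \<delta>\<^sup>2)"
      unfolding split by (rule order_trans[OF abs_triangle_ineq add_mono[OF b1 b2]])
    also have "\<dots> = err" by (simp add: err_def algebra_simps power_mult_distrib)
    finally show ?thesis unfolding x_def .
  qed
  note [measurable] = running_past[OF u(1)] B_measurable_past[OF u(1) order_refl]
  have gm [measurable]: "grid_clock \<delta> k \<in> borel_measurable (past u)" "grid_clock \<delta> (Suc k) \<in> borel_measurable (past u)"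
    using \<delta> by (auto intro!: grid_clock_past simp: u_def algebra_simps)
  have Hm: "?H \<in> borel_measurable (past u)" by measurable
  have Hb: "\<bar>?H \<omega>\<bar> \<le> ?G * exp (l * R)" for \<omega>
  proof (cases "\<omega> \<in> ?E")
    case True
    have "\<delta> * rate (B u \<omega>) \<le> 1 * R" using \<delta> rate(3) rate0 by (intro mult_mono) auto
    then have "exp (l * (\<delta> * rate (B u \<omega>))) \<le> exp (l * R)" using l by simp
    then have "exp (l * grid_clock \<delta> k \<omega>) * exp (l * (\<delta> * rate (B u \<omega>))) \<le> ?G * exp (l * R)"
      using G[OF True] by (intro mult_mono) auto
    then show ?thesis using True unfolding step by simp
  qed simp
  have Zm: "(\<lambda>\<omega>. indicator ?E \<omega> * ?Z k \<omega>) \<in> borel_measurable M"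
    unfolding weighted_def u_def[symmetric] by (rule measurable_past_subset[of _ u]) measurable
  have Zi: "integrable M (\<lambda>\<omega>. indicator ?E \<omega> * ?Z k \<omega>)"
  proof (rule integrable_const_bound[OF _ Zm])
    have "norm (indicator ?E \<omega> * ?Z k \<omega>) \<le> ?G * D" for \<omega>
    proof (cases "\<omega> \<in> ?E")
      case True
      then show ?thesis using mult_mono[OF G[OF True] F(2)[of "B u \<omega>"]] by (simp add: weighted_def u_def abs_mult)
    qed (use D in simp)
    then show "AE \<omega> in M. norm (indicator ?E \<omega> * ?Z k \<omega>) \<le> ?G * D" by (intro AE_I2)
  qed
  have B1: "B (real (Suc k) * \<delta>) \<in> borel_measurable M" using u by (intro B_measurable) linarith
  have HFi: "integrable M (\<lambda>\<omega>. ?H \<omega> * F (B (real (Suc k) * \<delta>) \<omega>))"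
  proof (rule integrable_const_bound)
    show "AE \<omega> in M. norm (?H \<omega> * F (B (real (Suc k) * \<delta>) \<omega>)) \<le> (?G * exp (l * R)) * D"
      using Hb F(2) D unfolding real_norm_def abs_mult[of "?H _" "F _"] by (intro AE_I2 mult_mono) auto
    show "(\<lambda>\<omega>. ?H \<omega> * F (B (real (Suc k) * \<delta>) \<omega>)) \<in> borel_measurable M"
      by (intro borel_measurable_times measurable_past_subset[OF Hm] measurable_compose[OF B1 Fm])
  qed
  have eq: "indicator ?E \<omega> * (?Z (Suc k) \<omega> - ?Z k \<omega>) = ?H \<omega> * F (B (real (Suc k) * \<delta>) \<omega>) - indicator ?E \<omega> * ?Z k \<omega>" for \<omega>
    by (simp add: weighted_def algebra_simps)
  show "integrable M (\<lambda>\<omega>. indicator (running t (real k * \<delta>)) \<omega> * (?Z (Suc k) \<omega> - ?Z k \<omega>))"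
    unfolding u_def[symmetric] eq by (rule Bochner_Integration.integrable_diff[OF HFi Zi])
  have markov: "expectation (\<lambda>\<omega>. ?H \<omega> * F (B (real (Suc k) * \<delta>) \<omega>)) = expectation (\<lambda>\<omega>. ?H \<omega> * ?P (B u \<omega>))"
    using markov_step[OF u(1,2) Hm Hb Fm F(2)] unfolding u(3) .
  have diff: "\<bar>?H \<omega> * ?P (B u \<omega>) - indicator ?E \<omega> * ?Z k \<omega>\<bar> \<le> ?G * err" for \<omega>
  proof (cases "\<omega> \<in> ?E")
    case True
    have "?H \<omega> * ?P (B u \<omega>) - indicator ?E \<omega> * ?Z k \<omega>
        = exp (l * grid_clock \<delta> k \<omega>) * (exp (l * (\<delta> * rate (B u \<omega>))) * ?P (B u \<omega>) - F (B u \<omega>))"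
      using True unfolding step by (simp add: weighted_def u_def algebra_simps)
    then show ?thesis
      using mult_mono[OF G[OF True] local_err[of "B u \<omega>"]] E[OF True] by (simp only: abs_mult) simp
  next
    case False
    have "0 \<le> err" unfolding err_def using D C(1) \<epsilon> \<delta> by (intro mult_nonneg_nonneg add_nonneg_nonneg) auto
    with False show ?thesis by simp
  qed
  have di: "integrable M (\<lambda>\<omega>. ?H \<omega> * ?P (B u \<omega>) - indicator ?E \<omega> * ?Z k \<omega>)"
  proof (rule integrable_const_bound)
    show "AE \<omega> in M. norm (?H \<omega> * ?P (B u \<omega>) - indicator ?E \<omega> * ?Z k \<omega>) \<le> ?G * err"
      using diff by (intro AE_I2) simp
    have "(\<lambda>\<omega>. ?H \<omega> * ?P (B u \<omega>)) \<in> borel_measurable (past u)" by measurable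
    then show "(\<lambda>\<omega>. ?H \<omega> * ?P (B u \<omega>) - indicator ?E \<omega> * ?Z k \<omega>) \<in> borel_measurable M"
      by (intro borel_measurable_diff Zm) (rule measurable_past_subset)
  qed
  have "integrable M (\<lambda>\<omega>. ?H \<omega> * ?P (B u \<omega>))"
    using Bochner_Integration.integrable_add[OF di Zi] by simp
  then have "expectation (\<lambda>\<omega>. indicator ?E \<omega> * (?Z (Suc k) \<omega> - ?Z k \<omega>))
      = expectation (\<lambda>\<omega>. ?H \<omega> * ?P (B u \<omega>) - indicator ?E \<omega> * ?Z k \<omega>)"
    unfolding eq using HFi Zi markov by simp
  moreover have "\<bar>expectation (\<lambda>\<omega>. ?H \<omega> * ?P (B u \<omega>) - indicator ?E \<omega> * ?Z k \<omega>)\<bar> \<le> expectation (\<lambda>_. ?G * err)"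
    by (rule order_trans[OF integral_abs_bound integral_mono]) (use di diff in auto)
  ultimately show "\<bar>expectation (\<lambda>\<omega>. indicator (running t (real k * \<delta>)) \<omega> * (?Z (Suc k) \<omega> - ?Z k \<omega>))\<bar>
     \<le> exp (l * (R * (t / m))) * (exp (l * R) * (D * (l * R)\<^sup>2 * \<delta>\<^sup>2 + \<epsilon> * \<delta> + 3 * C * \<delta>\<^sup>2))"
    by (simp add: u_def err_def prob_space)
qed

text \<open>Along a fixed path the weighted increments telescope to the value at the first grid point not before
\<open>\<tau>\<close>, the earlier of the exit and \<open>stop t\<close>. As the mesh shrinks this point tends to \<open>\<tau>\<close>. There \<open>F\<close>
vanishes if the path has exited, and otherwise the clock shows \<open>t\<close>.\<close>

lemma stopped_path_limit:
  fixes F \<psi> :: "real \<Rightarrow> real" and l t m :: real and N :: nat and \<omega> :: 'w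
  assumes F: "continuous_on UNIV F" "\<And>z. z \<in> I \<Longrightarrow> F z = \<psi> z" and bd: "\<psi> \<alpha> = 0" "\<psi> \<beta> = 0"
    and t: "0 \<le> t" and m: "0 < m" "\<And>z. m \<le> rate z" and N: "t / m \<le> real N" and \<omega>: "\<omega> \<in> space M"
    and \<delta>_def: "\<And>n. \<delta> n = 1 / real (Suc n)"
  shows "\<exists>K. (\<forall>n. K n \<le> N * Suc n) \<and>
    (\<forall>n. weighted l F (\<delta> n) 0 \<omega> + (\<Sum>k<N * Suc n. indicator (running t (real k * \<delta> n)) \<omega> *
       (weighted l F (\<delta> n) (Suc k) \<omega> - weighted l F (\<delta> n) k \<omega>)) = weighted l F (\<delta> n) (K n) \<omega>) \<and>
    (\<lambda>n. weighted l F (\<delta> n) (K n) \<omega>) \<longlonglongrightarrow> exp (l * t) * (indicator (alive t) \<omega> * \<psi> (B (stop t \<omega>) \<omega>))"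
proof -
  let ?Z = "\<lambda>n k. weighted l F (\<delta> n) k \<omega>"
  obtain \<tau> where \<tau>: "0 \<le> \<tau>" "\<tau> \<le> stop t \<omega>"
    "\<And>u. 0 \<le> u \<Longrightarrow> \<omega> \<in> inside u \<and> clock \<omega> u < t \<longleftrightarrow> u < \<tau>"
    and al: "\<omega> \<in> alive t \<Longrightarrow> \<tau> = stop t \<omega>" and dead: "\<omega> \<notin> alive t \<Longrightarrow> B \<tau> \<omega> = \<alpha> \<or> B \<tau> \<omega> = \<beta>"
    using exit_dichotomy[OF \<omega> t] by metis
  \<comment> \<open>the number of grid points before \<open>\<tau>\<close>\<close>
  define K where "K n = nat \<lceil>\<tau> * real (Suc n)\<rceil>" for n
  have \<delta>: "0 < \<delta> n" for n by (simp add: \<delta>_def)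
  have \<delta>0: "\<delta> \<longlonglongrightarrow> 0" unfolding \<delta>_def by (rule LIMSEQ_Suc[OF lim_const_over_n])
  have less: "k < K n \<longleftrightarrow> real k * \<delta> n < \<tau>" for k n
  proof -
    have "k < K n \<longleftrightarrow> real k < \<tau> * real (Suc n)"
      unfolding K_def zless_nat_eq_int_zless less_ceiling_iff by simp
    also have "\<dots> \<longleftrightarrow> real k * \<delta> n < \<tau>"
      unfolding \<delta>_def by (simp only: times_divide_eq_right mult_1_right) (subst pos_divide_less_eq, simp_all)
    finally show ?thesis .
  qed
  have KL: "K n \<le> N * Suc n" for n
  proof -
    have "\<tau> \<le> real N" using \<tau>(2) stop_le[OF \<omega> t m] N by linarith
    then have "\<tau> * real (Suc n) \<le> real N * real (Suc n)" by (intro mult_right_mono) auto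
    then show ?thesis unfolding K_def by (subst nat_ceiling_le_eq) (simp only: of_nat_mult)
  qed
  have Kpos: "\<tau> \<le> real (K n) * \<delta> n" for n using less[of "K n" n] by simp
  have Kupper: "real (K n) * \<delta> n \<le> \<tau> + \<delta> n" for n
  proof (cases "K n")
    case (Suc j)
    then have "real j * \<delta> n < \<tau>" using less[of j n] by simp
    then show ?thesis unfolding Suc by (simp add: algebra_simps)
  qed (use \<tau>(1) \<delta>[of n] in simp)
  have K\<tau>: "(\<lambda>n. real (K n) * \<delta> n) \<longlonglongrightarrow> \<tau>"
  proof (rule tendsto_sandwich)
    show "\<forall>\<^sub>F n in sequentially. \<tau> \<le> real (K n) * \<delta> n" using Kpos by simp
    show "\<forall>\<^sub>F n in sequentially. real (K n) * \<delta> n \<le> \<tau> + \<delta> n" using Kupper by simp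
    show "(\<lambda>n. \<tau> + \<delta> n) \<longlonglongrightarrow> \<tau>" using tendsto_add[OF tendsto_const \<delta>0, of \<tau>] by simp
  qed simp
  show ?thesis
  proof (intro exI[of _ K] conjI allI KL)
    fix n
    have "indicator (running t (real k * \<delta> n)) \<omega> = (if k < K n then 1 else 0 :: real)" for k
      using \<tau>(3)[of "real k * \<delta> n"] less[of k n] \<omega> less_imp_le[OF \<delta>[of n]]
      by (auto simp: running_def indicator_def)
    from sum_stopped_telescope[OF KL this, of "?Z n"]
    show "?Z n 0 + (\<Sum>k<N * Suc n. indicator (running t (real k * \<delta> n)) \<omega> * (?Z n (Suc k) - ?Z n k)) = ?Z n (K n)"
      by simp
  next
    have clock: "(\<lambda>n. grid_clock (\<delta> n) (K n) \<omega>) \<longlonglongrightarrow> clock \<omega> \<tau>"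
      unfolding grid_clock_def clock_def
      by (rule riemann_sum_tendsto[OF rate_path[OF \<omega>] \<delta> \<delta>0 \<tau>(1) K\<tau>])
    have path: "(\<lambda>n. B (real (K n) * \<delta> n) \<omega>) \<longlonglongrightarrow> B \<tau> \<omega>"
      using \<tau>(1) by (intro continuous_on_tendsto_compose[OF B_path[OF \<omega>] K\<tau>])
        (auto intro!: always_eventually mult_nonneg_nonneg less_imp_le[OF \<delta>])
    have "(\<lambda>n. F (B (real (K n) * \<delta> n) \<omega>)) \<longlonglongrightarrow> F (B \<tau> \<omega>)"
      by (intro continuous_on_tendsto_compose[OF F(1) path]) auto
    then have lim: "(\<lambda>n. ?Z n (K n)) \<longlonglongrightarrow> exp (l * clock \<omega> \<tau>) * F (B \<tau> \<omega>)"
      unfolding weighted_def by (intro tendsto_intros clock)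
    have "exp (l * clock \<omega> \<tau>) * F (B \<tau> \<omega>) = exp (l * t) * (indicator (alive t) \<omega> * \<psi> (B (stop t \<omega>) \<omega>))"
    proof (cases "\<omega> \<in> alive t")
      case True
      then have "B (stop t \<omega>) \<omega> \<in> I"
        using stop_nonneg[OF \<omega> t] by (auto simp: alive_def inside_def intro: less_imp_le)
      then show ?thesis using True al[OF True] clock_stop[OF \<omega> t] F(2) by simp
    next
      case False
      then have "F (B \<tau> \<omega>) = 0" using dead F(2)[of \<alpha>] F(2)[of \<beta>] bd interval by auto
      with False show ?thesis by simp
    qed
    with lim show "(\<lambda>n. ?Z n (K n)) \<longlonglongrightarrow> exp (l * t) * (indicator (alive t) \<omega> * \<psi> (B (stop t \<omega>) \<omega>))" by simp
  qed
qed

text \<open>Optional stopping for \<open>e\<^sup>l\<^sup>A\<psi>(B)\<close>: on the grid the expectation of the stopped value differs from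
the initial value \<open>\<psi>(z\<^sub>0)\<close> by at most the sum of the one-step defects, which is arbitrarily small, and the
stopped values converge boundedly.\<close>

lemma expectation_mode:
  assumes \<psi>: "mode l \<psi>" and l: "0 < l" and t: "0 \<le> t"
  shows "expectation (\<lambda>\<omega>. indicator (alive t) \<omega> * \<psi> (B (stop t \<omega>) \<omega>)) = exp (- l * t) * \<psi> z0"
proof -
  obtain F F' D where F: "continuous_on UNIV F" "\<And>z. \<bar>F z\<bar> \<le> D" "\<And>z. z \<in> I \<Longrightarrow> F z = \<psi> z"
    and taylor: "\<And>\<epsilon>. 0 < \<epsilon> \<Longrightarrow> \<exists>C\<ge>0. \<forall>z\<in>I. \<forall>h.
        \<bar>F (z + h) - (F z + F' z * h + (- (l * F z * r z)) * h\<^sup>2 / 2)\<bar> \<le> \<epsilon> * h\<^sup>2 + C * h ^ 4"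
    using mode_extension[OF \<psi>] by metis
  have bd: "\<psi> \<alpha> = 0" "\<psi> \<beta> = 0" using \<psi> by (auto simp: mode_def poisson_def)
  obtain m R where rate: "0 < m" "m \<le> R" "\<And>z. m \<le> rate z" "\<And>z. rate z \<le> R" using rate_bounds by metis
  have rate0: "0 \<le> rate z" for z using rate(1) rate(3)[of z] by linarith
  have R: "0 < R" using rate(1,2) by linarith
  have D: "0 \<le> D" using F(2)[of 0] by linarith
  obtain N :: nat where N0: "t / m \<le> real N" "0 < N"
  proof -
    obtain n :: nat where "t / m \<le> real n" using real_arch_simple by blast
    then show thesis by (intro that[of "Suc n"]) auto
  qed
  define \<delta> where "\<delta> n = 1 / real (Suc n)" for n
  have \<delta>: "0 < \<delta> n" "\<delta> n \<le> 1" "real (N * Suc n) * \<delta> n = real N" for n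
    by (auto simp: \<delta>_def field_simps)
  have \<delta>0: "\<delta> \<longlonglongrightarrow> 0" unfolding \<delta>_def by (rule LIMSEQ_Suc[OF lim_const_over_n])
  let ?Z = "\<lambda>n. weighted l F (\<delta> n)"
  let ?I = "\<lambda>n k \<omega>. indicator (running t (real k * \<delta> n)) \<omega> * (?Z n (Suc k) \<omega> - ?Z n k \<omega>)"
  define Y where "Y n \<omega> = ?Z n 0 \<omega> + (\<Sum>k<N * Suc n. ?I n k \<omega>)" for n \<omega>
  let ?T = "\<lambda>\<omega>. indicator (alive t) \<omega> * \<psi> (B (stop t \<omega>) \<omega>)"
  note step = one_step_defect[OF F(1,2) l t rate(1,3,4)]
  obtain C1 where C1: "0 \<le> C1" "\<And>z h. z \<in> I \<Longrightarrow>
      \<bar>F (z + h) - (F z + F' z * h + (- (l * F z * r z)) * h\<^sup>2 / 2)\<bar> \<le> 1 * h\<^sup>2 + C1 * h ^ 4"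
    using taylor[of 1] by auto
  have Ii: "integrable M (?I n k)" for n k
    by (rule step(2)[OF C1 \<delta>(1,2) zero_less_one])
  have Z0: "?Z n 0 \<omega> = \<psi> z0" if "\<omega> \<in> space M" for n \<omega>
    using B_start[OF that] F(3)[of z0] start by (simp add: weighted_def grid_clock_def)
  have Z0i: "integrable M (?Z n 0)" for n
    using Bochner_Integration.integrable_cong[of M M "?Z n 0" "\<lambda>_. \<psi> z0"] Z0 by simp
  have Ym: "Y n \<in> borel_measurable M" for n
    unfolding Y_def using Ii Z0i by (intro borel_measurable_add borel_measurable_sum) auto
  have EZ0: "expectation (?Z n 0) = \<psi> z0" for n
    using Bochner_Integration.integral_cong[of M M "?Z n 0" "\<lambda>_. \<psi> z0"] Z0 by (simp add: prob_space)
  have EY: "expectation (Y n) - \<psi> z0 = (\<Sum>k<N * Suc n. expectation (?I n k))" for n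
  proof -
    have "expectation (Y n) = expectation (?Z n 0) + expectation (\<lambda>\<omega>. \<Sum>k<N * Suc n. ?I n k \<omega>)"
      unfolding Y_def by (rule Bochner_Integration.integral_add[OF Z0i Bochner_Integration.integrable_sum[OF Ii]])
    also have "expectation (\<lambda>\<omega>. \<Sum>k<N * Suc n. ?I n k \<omega>) = (\<Sum>k<N * Suc n. expectation (?I n k))"
      by (rule Bochner_Integration.integral_sum[OF Ii])
    finally show ?thesis unfolding EZ0 by (simp only: add_diff_cancel_left')
  qed
  define G where "G = real N * (exp (l * (R * (t / m))) * exp (l * R))"
  have G: "0 < G" using N0(2) by (simp add: G_def)
  have EYlim: "(\<lambda>n. expectation (Y n)) \<longlonglongrightarrow> \<psi> z0"
  proof (rule LIMSEQ_I)
    fix e :: real assume e: "0 < e"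
    \<comment> \<open>There are \<open>N/\<delta>\<close> steps, so the defects sum to at most \<open>G \<epsilon> + O(\<delta>)\<close>.\<close>
    define \<epsilon> where "\<epsilon> = e / (2 * G)"
    have \<epsilon>: "0 < \<epsilon>" using e G by (simp add: \<epsilon>_def)
    obtain C where C: "0 \<le> C" "\<And>z h. z \<in> I \<Longrightarrow>
        \<bar>F (z + h) - (F z + F' z * h + (- (l * F z * r z)) * h\<^sup>2 / 2)\<bar> \<le> \<epsilon> * h\<^sup>2 + C * h ^ 4"
      using taylor[OF \<epsilon>] by auto
    let ?b = "\<lambda>n. G * (D * (l * R)\<^sup>2 * \<delta> n + \<epsilon> + 3 * C * \<delta> n)"
    have "?b \<longlonglongrightarrow> G * (D * (l * R)\<^sup>2 * 0 + \<epsilon> + 3 * C * 0)" by (intro tendsto_intros \<delta>0)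
    then have "?b \<longlonglongrightarrow> e / 2" using G by (simp add: \<epsilon>_def)
    then have "\<forall>\<^sub>F n in sequentially. ?b n < e" using e by (intro order_tendstoD(2)[of ?b "e / 2"]) auto
    then obtain n0 where n0: "\<And>n. n0 \<le> n \<Longrightarrow> ?b n < e" unfolding eventually_sequentially by auto
    have "norm (expectation (Y n) - \<psi> z0) < e" if "n0 \<le> n" for n
    proof -
      have "\<bar>\<Sum>k<N * Suc n. expectation (?I n k)\<bar> \<le> (\<Sum>k<N * Suc n. \<bar>expectation (?I n k)\<bar>)" by (rule sum_abs)
      also have "\<dots> \<le> (\<Sum>k<N * Suc n. exp (l * (R * (t / m))) *
          (exp (l * R) * (D * (l * R)\<^sup>2 * (\<delta> n)\<^sup>2 + \<epsilon> * \<delta> n + 3 * C * (\<delta> n)\<^sup>2)))"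
        by (intro sum_mono step(1)[OF C \<delta>(1,2) \<epsilon>])
      also have "\<dots> = real (N * Suc n) * \<delta> n * (exp (l * (R * (t / m))) *
          (exp (l * R) * (D * (l * R)\<^sup>2 * \<delta> n + \<epsilon> + 3 * C * \<delta> n)))"
        by (simp add: algebra_simps power2_eq_square)
      also have "\<dots> = ?b n" unfolding \<delta>(3) G_def by (simp only: mult.assoc)
      also have "\<dots> < e" by (rule n0[OF that])
      finally show ?thesis unfolding EY by simp
    qed
    then show "\<exists>n0. \<forall>n\<ge>n0. norm (expectation (Y n) - \<psi> z0) < e" by blast
  qed
  have path: "\<exists>K. (\<forall>n. K n \<le> N * Suc n) \<and> (\<forall>n. Y n \<omega> = ?Z n (K n) \<omega>) \<and>
     (\<lambda>n. ?Z n (K n) \<omega>) \<longlonglongrightarrow> exp (l * t) * ?T \<omega>" if \<omega>: "\<omega> \<in> space M" for \<omega>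
    unfolding Y_def by (rule stopped_path_limit[OF F(1,3) bd t rate(1,3) N0(1) \<omega> \<delta>_def])
  have Ylim: "(\<lambda>n. Y n \<omega>) \<longlonglongrightarrow> exp (l * t) * ?T \<omega>" if "\<omega> \<in> space M" for \<omega>
    using path[OF that] by auto
  have Ybound: "\<bar>Y n \<omega>\<bar> \<le> exp (l * (R * real N)) * D" if \<omega>: "\<omega> \<in> space M" for n \<omega>
  proof -
    obtain K where K: "K n \<le> N * Suc n" "Y n \<omega> = ?Z n (K n) \<omega>" using path[OF \<omega>] by blast
    have "grid_clock (\<delta> n) (K n) \<omega> \<le> R * (real (K n) * \<delta> n)"
      using \<delta>(1)[of n] by (intro grid_clock_bounds rate0 rate) auto
    also have "\<dots> \<le> R * real N"
    proof -
      have "real (K n) * \<delta> n \<le> real (N * Suc n) * \<delta> n"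
        by (intro mult_right_mono of_nat_mono K(1) less_imp_le[OF \<delta>(1)])
      then show ?thesis using R unfolding \<delta>(3) by simp
    qed
    finally have "exp (l * grid_clock (\<delta> n) (K n) \<omega>) \<le> exp (l * (R * real N))" using l by simp
    then show ?thesis unfolding K(2) weighted_def abs_mult using F(2) by (intro mult_mono) auto
  qed
  have "(\<lambda>n. expectation (Y n)) \<longlonglongrightarrow> expectation (\<lambda>\<omega>. exp (l * t) * ?T \<omega>)"
  proof (rule integral_dominated_convergence[where w = "\<lambda>_. exp (l * (R * real N)) * D"])
    show "(\<lambda>\<omega>. exp (l * t) * ?T \<omega>) \<in> borel_measurable M"
      by (rule borel_measurable_LIMSEQ_real[OF Ylim Ym])
    show "AE \<omega> in M. (\<lambda>n. Y n \<omega>) \<longlonglongrightarrow> exp (l * t) * ?T \<omega>" using Ylim by (intro AE_I2)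
    show "AE \<omega> in M. norm (Y n \<omega>) \<le> exp (l * (R * real N)) * D" for n using Ybound by (intro AE_I2) simp
  qed (use Ym in auto)
  from LIMSEQ_unique[OF EYlim this] have "\<psi> z0 = exp (l * t) * expectation ?T" by simp
  then have "exp (- l * t) * \<psi> z0 = (exp (- l * t) * exp (l * t)) * expectation ?T" by simp
  then show ?thesis by (simp flip: exp_add)
qed

end

lemma (in killed_clock) alive_position:
  assumes "\<omega> \<in> alive t" "0 \<le> t"
  shows "\<alpha> < B (stop t \<omega>) \<omega>" "B (stop t \<omega>) \<omega> < \<beta>"
proof -
  have "\<omega> \<in> space M" using assms(1) by (simp add: alive_def)
  from stop_nonneg[OF this assms(2)] assms(1)
  show "\<alpha> < B (stop t \<omega>) \<omega>" "B (stop t \<omega>) \<omega> < \<beta>" by (auto simp: alive_def inside_def)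
qed

locale killed_clock_eigensystem = killed_clock M B z0 \<alpha> \<beta> r + string_eigensystem \<alpha> \<beta> r lam psi
  for M :: "'w measure" and B z0 \<alpha> \<beta> r lam psi
begin

definition stopped_law :: "real \<Rightarrow> real measure" where
  "stopped_law t = distr (restrict_space M (alive t)) borel (\<lambda>\<omega>. B (stop t \<omega>) \<omega>)"

lemma alive_subset: "alive t \<subseteq> space M"
  by (auto simp: alive_def)

lemma stopped_law_moment:
  assumes t: "0 \<le> t"
  shows "(LINT w:I|stopped_law t. psi n w) = exp (- lam n * t) * psi n z0"
proof -
  let ?k = "\<lambda>w. indicator I w *\<^sub>R psi n w"
  have A: "alive t \<inter> space M \<in> events" using alive_event[OF t] alive_subset by (simp add: Int_absorb2)
  have k: "?k \<in> borel_measurable borel"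
    by (intro borel_measurable_continuous_on_indicator psi_continuous) auto
  have "(LINT w:I|stopped_law t. psi n w)
      = (LINT \<omega>|restrict_space M (alive t). ?k (B (stop t \<omega>) \<omega>))"
    unfolding set_lebesgue_integral_def stopped_law_def
    by (rule integral_distr[OF measurable_restrict_space1[OF B_stop_measurable[OF t]] k])
  also have "\<dots> = expectation (\<lambda>\<omega>. indicator (alive t) \<omega> *\<^sub>R ?k (B (stop t \<omega>) \<omega>))"
    by (rule integral_restrict_space[OF A])
  also have "\<dots> = expectation (\<lambda>\<omega>. indicator (alive t) \<omega> * psi n (B (stop t \<omega>) \<omega>))"
  proof (intro Bochner_Integration.integral_cong refl)
    show "indicator (alive t) \<omega> *\<^sub>R ?k (B (stop t \<omega>) \<omega>) = indicator (alive t) \<omega> * psi n (B (stop t \<omega>) \<omega>)" for \<omega>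
      using alive_position[OF _ t, of \<omega>] by (cases "\<omega> \<in> alive t") auto
  qed
  also have "\<dots> = exp (- lam n * t) * psi n z0" by (rule expectation_mode[OF modes lam_pos t])
  finally show ?thesis .
qed

text \<open>The law of the stopped Brownian motion and the heat series have the same moments.\<close>

lemma stopped_law_density:
  assumes t: "0 < t"
  shows "w \<in> {\<alpha><..<\<beta>} \<Longrightarrow> 0 \<le> heat t z0 w"
    and "c \<in> {\<alpha>..<\<beta>} \<Longrightarrow> prob {\<omega> \<in> alive t. c < B (stop t \<omega>) \<omega>} = integral {c..\<beta>} (\<lambda>w. heat t z0 w * r w)"
proof -
  have t0: "0 \<le> t" using t by simp
  have A: "alive t \<inter> space M \<in> events" using alive_event[OF t0] alive_subset by (simp add: Int_absorb2)
  have Xm: "(\<lambda>\<omega>. B (stop t \<omega>) \<omega>) \<in> borel_measurable (restrict_space M (alive t))"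
    by (rule measurable_restrict_space1[OF B_stop_measurable[OF t0]])
  interpret R: finite_measure "restrict_space M (alive t)"
    by (rule finite_measure_restrict_space[OF finite_measure_axioms alive_event[OF t0]])
  have fin: "finite_measure (stopped_law t)"
    unfolding stopped_law_def by (rule R.finite_measure_distr[OF Xm])
  have sets: "sets (stopped_law t) = sets borel" by (simp add: stopped_law_def)
  have z0: "z0 \<in> I" using start by auto
  note q = heat_continuous[OF t z0]
  have mom: "(LINT w:I|stopped_law t. psi n w) = inner (heat t z0) (psi n)" for n
    by (simp add: stopped_law_moment[OF t0] inner_heat_psi[OF t z0])
  have supp: "AE w in stopped_law t. \<alpha> < w \<and> w < \<beta>"
    unfolding stopped_law_def
  proof (subst AE_distr_iff[OF Xm])
    show "{w \<in> space borel. \<alpha> < w \<and> w < \<beta>} \<in> sets borel" by measurable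
    show "AE \<omega> in restrict_space M (alive t). \<alpha> < B (stop t \<omega>) \<omega> \<and> B (stop t \<omega>) \<omega> < \<beta>"
      using alive_position[OF _ t0] by (intro AE_I2) (auto simp: space_restrict_space)
  qed
  show "0 \<le> heat t z0 w" if "w \<in> {\<alpha><..<\<beta>}"
    by (rule density_nonneg_of_moments[OF fin sets q mom supp that])
  show "prob {\<omega> \<in> alive t. c < B (stop t \<omega>) \<omega>} = integral {c..\<beta>} (\<lambda>w. heat t z0 w * r w)" if c: "c \<in> {\<alpha>..<\<beta>}"
  proof -
    have "measure (stopped_law t) {c<..} = measure (restrict_space M (alive t)) {\<omega> \<in> alive t. c < B (stop t \<omega>) \<omega>}"
      unfolding stopped_law_def using alive_subset
      by (subst measure_distr[OF Xm]) (auto simp: space_restrict_space intro!: arg_cong2[where f = measure])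
    also have "\<dots> = prob {\<omega> \<in> alive t. c < B (stop t \<omega>) \<omega>}"
      by (rule measure_restrict_space[OF A]) auto
    finally show ?thesis using tail_determined_by_moments[OF fin sets q mom supp c] by simp
  qed
qed

end

section \<open>The scale transformation\<close>

locale environment =
  fixes W :: "real \<Rightarrow> real"
  assumes W_continuous: "continuous_on UNIV W"
begin

abbreviation s :: "real \<Rightarrow> real" where "s \<equiv> scale_fun W"
abbreviation s_inv :: "real \<Rightarrow> real" where "s_inv \<equiv> inv (scale_fun W)"

lemma scale_derivative: "(s has_real_derivative exp (W x)) (at x)"
proof -
  define a b where "a = - \<bar>x\<bar> - 1" and "b = \<bar>x\<bar> + 1"
  have "((\<lambda>u. LBINT y=ereal 0..ereal u. exp (W y)) has_vector_derivative exp (W x)) (at x within {a..b})"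
    by (rule interval_integral_FTC2)
       (auto simp: a_def b_def intro!: continuous_intros continuous_on_subset[OF W_continuous])
  moreover have "at x within {a..b} = at x"
    by (rule at_within_Icc_at) (auto simp: a_def b_def)
  ultimately show ?thesis
    by (simp add: scale_fun_def[abs_def] has_real_derivative_iff_has_vector_derivative)
qed

lemma scale_derivative_within: "(s has_real_derivative exp (W x)) (at x within S)"
  by (rule has_field_derivative_at_within[OF scale_derivative])

lemma scale_continuous: "continuous_on S s"
  by (rule DERIV_continuous_on[OF scale_derivative_within])

lemma scale_strict_mono: "x < y \<Longrightarrow> s x < s y"
  by (rule DERIV_pos_imp_increasing) (use scale_derivative exp_gt_zero in blast)+

lemma scale_less_iff [simp]: "s x < s y \<longleftrightarrow> x < y"
  using scale_strict_mono[of x y] scale_strict_mono[of y x] by (cases x y rule: linorder_cases) auto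

lemma scale_le_iff [simp]: "s x \<le> s y \<longleftrightarrow> x \<le> y"
  using scale_less_iff[of y x] by linarith

lemma inv_scale [simp]: "s_inv (s x) = x"
  by (rule inv_f_f) (auto intro!: linorder_injI simp: order_less_imp_not_eq dest: scale_strict_mono)

lemma scale_image: "a \<le> b \<Longrightarrow> s ` {a..b} = {s a..s b}"
proof (intro set_eqI iffI)
  fix z assume "a \<le> b" "z \<in> {s a..s b}"
  then show "z \<in> s ` {a..b}" using IVT'[of s a z b] scale_continuous by force
qed auto

lemma scale_inv:
  assumes "a \<le> b" "z \<in> {s a..s b}"
  shows "s (s_inv z) = z" "s_inv z \<in> {a..b}"
proof -
  obtain x where "x \<in> {a..b}" "z = s x" using assms scale_image[OF assms(1)] by blast
  then show "s (s_inv z) = z" "s_inv z \<in> {a..b}" by auto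
qed

lemma inv_scale_continuous: "a \<le> b \<Longrightarrow> continuous_on {s a..s b} s_inv"
  using continuous_on_inv[OF scale_continuous compact_Icc, of a b s_inv] scale_image by simp

lemma inv_scale_derivative: "(s_inv has_real_derivative exp (- W x)) (at (s x))"
proof -
  have "(s_inv has_real_derivative inverse (exp (W x))) (at (s x))"
  proof (rule DERIV_inverse_function[where a = "s (x - 1)" and b = "s (x + 1)"])
    show "(s has_real_derivative exp (W x)) (at (s_inv (s x)))" by (simp add: scale_derivative)
    show "s (s_inv y) = y" if "s (x - 1) < y" "y < s (x + 1)" for y
      using that scale_inv(1)[of "x - 1" "x + 1" y] by simp
    have "s x \<in> interior {s (x - 1)..s (x + 1)}" by simp
    with inv_scale_continuous[of "x - 1" "x + 1"] show "isCont s_inv (s x)"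
      by (intro continuous_on_interior) auto
  qed auto
  then show ?thesis by (simp add: exp_minus)
qed

text \<open>The density of the speed measure in the coordinate \<open>z = s(x)\<close>: \<open>2 e\<^sup>-\<^sup>W dx = 2 e\<^sup>-\<^sup>2\<^sup>W dz\<close>.\<close>

definition speed_density :: "real \<Rightarrow> real" where
  "speed_density z = 2 * exp (- 2 * W (s_inv z))"

end

locale environment_interval = environment +
  fixes a b :: real assumes ab: "a < b"
begin

lemma speed_density_continuous: "continuous_on {s a..s b} speed_density"
  unfolding speed_density_def
  using ab by (intro continuous_intros continuous_on_compose2[OF W_continuous] inv_scale_continuous) auto

sublocale dirichlet_string "s a" "s b" speed_density
  by unfold_locales (use ab speed_density_continuous in \<open>auto simp: speed_density_def\<close>)

lemma integral_scale_substitution: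
  assumes f: "continuous_on {s a..s b} f" and c: "a \<le> c" "c \<le> b"
  shows "((\<lambda>x. exp (W x) * f (s x)) has_integral integral {s c..s b} f) {c..b}"
proof -
  have "s ` {c..b} \<subseteq> {s a..s b}" using c by auto
  from has_integral_substitution[OF c(2) _ this f scale_derivative_within] show ?thesis using c by simp
qed

lemma vector_derivative_eqI:
  assumes "(f has_real_derivative D) (at x within {a..b})" "x \<in> {a..b}"
    "\<And>y. y \<in> {a..b} \<Longrightarrow> h y = f y"
  shows "vector_derivative h (at x within {a..b}) = D"
proof -
  have "(h has_real_derivative D) (at x within {a..b})"
    by (rule has_field_derivative_transform_within[OF assms(1) zero_less_one assms(2)]) (simp add: assms(3))
  then show ?thesis
    using assms(2) ab vector_derivative_within_cbox[of a b x h D]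
    by (simp add: has_real_derivative_iff_has_vector_derivative)
qed

lemma generator_eq:
  assumes f: "\<And>x. x \<in> {a..b} \<Longrightarrow> (f has_real_derivative exp (W x) * g x) (at x within {a..b})"
    and g: "\<And>x. x \<in> {a..b} \<Longrightarrow> (g has_real_derivative g' x) (at x within {a..b})" and x: "x \<in> {a..b}"
  shows "generator W a b f x = exp (W x) / 2 * g' x"
proof -
  have "exp (- W y) * vector_derivative f (at y within {a..b}) = g y" if y: "y \<in> {a..b}" for y
    using vector_derivative_eqI[OF f[OF y] y] by (simp add: exp_minus)
  then show ?thesis
    unfolding generator_def using vector_derivative_eqI[OF g[OF x] x] by simp
qed

text \<open>With \<open>\<phi>' = e\<^sup>W g\<close> the derivative of \<open>\<phi>\<close> with respect to \<open>s\<close> is \<open>g\<close>, and the eigenvalue equation says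
\<open>g' = - 2 \<mu> e\<^sup>-\<^sup>W \<phi>\<close>; one more factor \<open>e\<^sup>-\<^sup>W\<close> from the change of variables gives the string equation.\<close>

lemma eigenfunction_imp_mode:
  assumes "eigenfunction W a b \<mu> \<phi>"
  shows "mode \<mu> (\<lambda>z. \<phi> (s_inv z))"
proof -
  obtain g g' where g: "\<And>x. x \<in> {a..b} \<Longrightarrow> (\<phi> has_real_derivative exp (W x) * g x) (at x within {a..b})"
    "\<And>x. x \<in> {a..b} \<Longrightarrow> (g has_real_derivative g' x) (at x within {a..b})"
    and bd: "\<phi> a = 0" "\<phi> b = 0" and ev: "\<And>x. x \<in> {a..b} \<Longrightarrow> generator W a b \<phi> x + \<mu> * \<phi> x = 0"
    using assms unfolding eigenfunction_def generator_domain_def by blast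
  have g': "g' x = - 2 * \<mu> * exp (- W x) * \<phi> x" if "x \<in> {a..b}" for x
    using ev[OF that] generator_eq[OF g that] by (simp add: exp_minus field_simps)
  have img: "s_inv ` {s a..s b} = {a..b}"
    using ab by (simp add: image_image flip: scale_image)
  have chain: "((\<lambda>z. f (s_inv z)) has_real_derivative D * exp (- W (s_inv z))) (at z within {s a..s b})"
    if z: "z \<in> {s a..s b}" and f: "(f has_real_derivative D) (at (s_inv z) within {a..b})" for f D z
  proof -
    have "(s_inv has_real_derivative exp (- W (s_inv z))) (at z within {s a..s b})"
      using inv_scale_derivative[of "s_inv z", unfolded scale_inv(1)[OF less_imp_le[OF ab] z]]
      by (rule has_field_derivative_at_within)
    from DERIV_image_chain[OF _ this, of f D] f show ?thesis by (simp add: img o_def)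
  qed
  show ?thesis
    unfolding mode_def poisson_def
  proof (intro conjI exI ballI)
    fix z assume z: "z \<in> {s a..s b}"
    have x: "s_inv z \<in> {a..b}" by (rule scale_inv(2)[OF less_imp_le[OF ab] z])
    from chain[OF z g(1)[OF x]]
    show "((\<lambda>z. \<phi> (s_inv z)) has_real_derivative g (s_inv z)) (at z within {s a..s b})"
      by (rule DERIV_cong) (simp add: exp_minus)
    from chain[OF z g(2)[OF x]]
    show "((\<lambda>z. g (s_inv z)) has_real_derivative - (\<mu> * \<phi> (s_inv z) * speed_density z)) (at z within {s a..s b})"
      by (rule DERIV_cong) (simp add: g'[OF x] speed_density_def mult_exp_exp algebra_simps)
  qed (simp_all add: bd)
qed

text \<open>Needed because the list of eigenvalues of \<open>L\<close> must exhaust those of the string.\<close>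

lemma mode_imp_eigenfunction:
  assumes \<psi>: "mode \<mu> \<psi>" and w: "w \<in> {s a..s b}" "\<psi> w \<noteq> 0"
  shows "eigenfunction W a b \<mu> (\<lambda>x. \<psi> (s x))"
proof -
  obtain \<psi>' where d: "\<And>z. z \<in> {s a..s b} \<Longrightarrow> (\<psi> has_real_derivative \<psi>' z) (at z within {s a..s b})"
    "\<And>z. z \<in> {s a..s b} \<Longrightarrow> (\<psi>' has_real_derivative - (\<mu> * \<psi> z * speed_density z)) (at z within {s a..s b})"
    and bd: "\<psi> (s a) = 0" "\<psi> (s b) = 0"
    using \<psi> unfolding mode_def poisson_def by blast
  have chain: "((\<lambda>x. f (s x)) has_real_derivative D * exp (W x)) (at x within {a..b})"
    if x: "x \<in> {a..b}" and f: "(f has_real_derivative D) (at (s x) within {s a..s b})" for f D x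
    using DERIV_image_chain[OF _ scale_derivative_within, of f D x "{a..b}"] f ab by (simp add: scale_image o_def)
  let ?g = "\<lambda>x. \<psi>' (s x)" and ?g' = "\<lambda>x. - 2 * \<mu> * exp (- W x) * \<psi> (s x)"
  have f: "((\<lambda>x. \<psi> (s x)) has_real_derivative exp (W x) * ?g x) (at x within {a..b})" if x: "x \<in> {a..b}" for x
    using chain[OF x d(1)] x by (simp add: mult.commute)
  have g: "(?g has_real_derivative ?g' x) (at x within {a..b})" if x: "x \<in> {a..b}" for x
    by (rule DERIV_cong[OF chain[OF x d(2)]]) (use x in \<open>simp_all add: speed_density_def mult_exp_exp algebra_simps\<close>)
  have c: "continuous_on {a..b} (\<lambda>x. \<psi> (s x))"
    by (rule continuous_on_compose2[OF mode_continuous[OF \<psi>] scale_continuous]) auto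
  have cg': "continuous_on {a..b} ?g'"
    by (intro continuous_intros c continuous_on_subset[OF W_continuous]) auto
  have "(\<lambda>x. \<psi> (s x)) \<in> generator_domain W a b"
    unfolding generator_domain_def
    by (intro CollectI conjI exI[of _ ?g] exI[of _ ?g'] ballI f g bd cg')
  moreover have "\<exists>x\<in>{a..b}. \<psi> (s x) \<noteq> 0"
    using w scale_inv[OF less_imp_le[OF ab] w(1)] by (intro bexI[of _ "s_inv w"]) auto
  moreover have "generator W a b (\<lambda>x. \<psi> (s x)) x + \<mu> * \<psi> (s x) = 0" if "x \<in> {a..b}" for x
    using generator_eq[where g' = ?g', OF f g that] by (simp add: exp_minus field_simps)
  ultimately show ?thesis unfolding eigenfunction_def by blast
qed

lemma speed_inner_eq_inner:
  assumes f: "continuous_on {s a..s b} (\<lambda>z. f (s_inv z))" and g: "continuous_on {s a..s b} (\<lambda>z. g (s_inv z))"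
  shows "speed_inner W a b f g = inner (\<lambda>z. f (s_inv z)) (\<lambda>z. g (s_inv z))"
proof -
  let ?h = "\<lambda>x. f x * g x * (2 * exp (- W x))"
  have pull: "continuous_on {a..b} h" if "continuous_on {s a..s b} (\<lambda>z. h (s_inv z))" for h :: "real \<Rightarrow> real"
  proof -
    have "continuous_on {a..b} (\<lambda>x. h (s_inv (s x)))"
      by (rule continuous_on_compose2[OF that scale_continuous]) auto
    then show ?thesis by simp
  qed
  have ch: "continuous_on {a..b} ?h"
    by (intro continuous_intros pull f g continuous_on_subset[OF W_continuous]) auto
  have W: "W \<in> borel_measurable borel" by (rule borel_measurable_continuous_onI[OF W_continuous])
  have m: "(\<lambda>x. indicator {a..b} x *\<^sub>R (f x * g x)) \<in> borel_measurable lborel"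
    using borel_measurable_continuous_on_indicator[of "{a..b}" "\<lambda>x. f x * g x"] pull[OF f] pull[OF g]
    by (auto intro!: continuous_intros)
  have "speed_inner W a b f g = (LINT x|lborel. (2 * exp (- W x)) *\<^sub>R (indicator {a..b} x *\<^sub>R (f x * g x)))"
    unfolding speed_inner_def set_lebesgue_integral_def speed_measure_def
    by (rule integral_density[OF m]) (use W in measurable)
  also have "\<dots> = (LINT x:{a..b}|lborel. ?h x)"
    unfolding set_lebesgue_integral_def by (simp add: mult_ac)
  also have "\<dots> = integral {a..b} ?h"
  proof (rule set_borel_integral_eq_integral(2))
    show "set_integrable lborel {a..b} ?h"
      unfolding set_integrable_def by (intro borel_integrable_compact ch) auto
  qed
  also have "\<dots> = inner (\<lambda>z. f (s_inv z)) (\<lambda>z. g (s_inv z))"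
  proof -
    have "((\<lambda>x. exp (W x) * (f (s_inv (s x)) * g (s_inv (s x)) * speed_density (s x))) has_integral
        inner (\<lambda>z. f (s_inv z)) (\<lambda>z. g (s_inv z))) {a..b}"
      unfolding inner_def using ab
      by (intro integral_scale_substitution continuous_intros f g speed_density_continuous) auto
    moreover have "(\<lambda>x. exp (W x) * (f (s_inv (s x)) * g (s_inv (s x)) * speed_density (s x))) = ?h"
    proof
      fix x
      have "exp (W x) * exp (- 2 * W x) = exp (- W x)" by (simp flip: exp_add)
      then show "exp (W x) * (f (s_inv (s x)) * g (s_inv (s x)) * speed_density (s x)) = ?h x"
        by (simp add: speed_density_def)
    qed
    ultimately show ?thesis by (simp add: integral_unique)
  qed
  finally show ?thesis .
qed

lemma eigensystem_imp_string_eigensystem: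
  assumes "eigensystem W a b lam phi"
  shows "string_eigensystem (s a) (s b) speed_density lam (\<lambda>n z. phi n (s_inv z))"
proof unfold_locales
  have ef: "eigenfunction W a b (lam n) (phi n)" for n using assms by (simp add: eigensystem_def)
  show modes: "mode (lam n) (\<lambda>z. phi n (s_inv z))" for n by (rule eigenfunction_imp_mode[OF ef])
  show "inner (\<lambda>z. phi m (s_inv z)) (\<lambda>z. phi n (s_inv z)) = (if m = n then 1 else 0)" for m n
    using assms speed_inner_eq_inner[OF mode_continuous[OF modes] mode_continuous[OF modes], of m n]
    by (simp add: eigensystem_def)
  fix \<mu> \<phi> w assume "mode \<mu> \<phi>" "w \<in> {s a..s b}" "\<phi> w \<noteq> 0"
  then have "eigenfunction W a b \<mu> (\<lambda>x. \<phi> (s x))" by (rule mode_imp_eigenfunction)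
  then show "\<mu> \<in> range lam" using assms by (auto simp: eigensystem_def)
qed

end

section \<open>The killed Brox diffusion\<close>

text \<open>Densities of one measure agree almost everywhere; the set where two continuous ones differ is open,
and an open null set is empty.\<close>

lemma continuous_AE_density_unique:
  fixes p q :: "real \<Rightarrow> real"
  assumes p: "continuous_on {a<..<b} p" "\<And>y. y \<in> {a<..<b} \<Longrightarrow> 0 \<le> p y"
    and q: "continuous_on {a<..<b} q" "\<And>y. y \<in> {a<..<b} \<Longrightarrow> 0 \<le> q y"
    and eq: "density lborel (\<lambda>y. indicator {a<..<b} y * ennreal (p y))
      = density lborel (\<lambda>y. indicator {a<..<b} y * ennreal (q y))"
    and y: "y \<in> {a<..<b}"
  shows "p y = q y"
proof -
  have ind: "(\<lambda>y. indicator {a<..<b} y * ennreal (f y)) = (\<lambda>y. ennreal (indicator {a<..<b} y *\<^sub>R f y))" for f :: "real \<Rightarrow> real"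
    by (auto simp: indicator_def)
  have m: "(\<lambda>y. indicator {a<..<b} y * ennreal (f y)) \<in> borel_measurable lborel"
    if "continuous_on {a<..<b} f" for f :: "real \<Rightarrow> real"
    unfolding ind using borel_measurable_continuous_on_indicator[OF _ that] by simp
  have "AE y in lborel. indicator {a<..<b} y * ennreal (p y) = indicator {a<..<b} y * ennreal (q y)"
    using sigma_finite_measure.density_unique[OF sigma_finite_lborel m[OF p(1)] m[OF q(1)] eq] .
  then obtain N where N: "{y. \<not> indicator {a<..<b} y * ennreal (p y) = indicator {a<..<b} y * ennreal (q y)} \<subseteq> N"
    "N \<in> null_sets lborel"
    unfolding eventually_ae_filter by auto
  let ?U = "{y \<in> {a<..<b}. p y - q y \<in> - {0}}"
  have "?U \<subseteq> N" using N(1) p(2) q(2) by auto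
  moreover have "negligible N" using N(2) by (auto simp: negligible_iff_null_sets intro: null_sets_completionI)
  ultimately have "negligible ?U" using negligible_subset by blast
  moreover have "open ?U"
    using continuous_open_preimage[OF continuous_on_diff[OF p(1) q(1)], of "- {0}"]
    by (simp add: vimage_def Int_def open_Compl)
  ultimately have "?U = {}" using open_not_negligible by blast
  with y show ?thesis by auto
qed

locale brox_setting = environment_interval W a b for W a b +
  fixes M :: "'w measure" and B :: "real \<Rightarrow> 'w \<Rightarrow> real" and x :: real
  assumes bm: "brownian_motion M {0..} (scale_fun W x) B" and x: "a < x" "x < b"
begin

sublocale killed_clock M B "s x" "s a" "s b" speed_density
  by unfold_locales (use bm x in auto)

lemma brox_clock_eq:
  assumes "\<omega> \<in> inside u" "0 \<le> u"
  shows "brox_clock W (\<lambda>u. B u \<omega>) u = clock \<omega> u"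
proof -
  have \<omega>: "\<omega> \<in> space M" using assms(1) by (simp add: inside_def)
  have "brox_clock W (\<lambda>u. B u \<omega>) u = (LINT v:{0..u}|lborel. exp (- 2 * W (s_inv (B v \<omega>))))"
    unfolding brox_clock_def using assms(2) by (simp add: interval_integral_Icc)
  also have "\<dots> = (LINT v:{0..u}|lborel. rate (B v \<omega>))"
  proof (rule set_lebesgue_integral_cong)
    show "\<forall>v. v \<in> {0..u} \<longrightarrow> exp (- 2 * W (s_inv (B v \<omega>))) = rate (B v \<omega>)"
      using assms(1) rate_inside by (auto simp: inside_def speed_density_def less_imp_le)
  qed simp
  also have "\<dots> = clock \<omega> u"
    unfolding clock_def
  proof (rule set_borel_integral_eq_integral(2))
    show "set_integrable lborel {0..u} (\<lambda>v. rate (B v \<omega>))"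
      unfolding set_integrable_def
      by (intro borel_integrable_compact continuous_on_subset[OF rate_path[OF \<omega>]]) auto
  qed
  finally show ?thesis .
qed

text \<open>A path that starts inside cannot leave the interval without hitting an end point.\<close>

lemma lifetime_iff:
  assumes \<omega>: "\<omega> \<in> space M"
  shows "u \<in> bm_lifetime W a b (\<lambda>u. B u \<omega>) \<longleftrightarrow> 0 \<le> u \<and> \<omega> \<in> inside u"
proof
  assume life: "u \<in> bm_lifetime W a b (\<lambda>u. B u \<omega>)"
  then have u: "0 \<le> u" and hit: "\<And>v. v \<in> {0..u} \<Longrightarrow> B v \<omega> \<noteq> s a \<and> B v \<omega> \<noteq> s b"
    by (auto simp: bm_lifetime_def)
  have "s a < B v \<omega> \<and> B v \<omega> < s b" if v: "v \<in> {0..u}" for v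
  proof (rule ccontr)
    assume "\<not> ?thesis"
    then consider "B v \<omega> \<le> s a" | "s b \<le> B v \<omega>" by linarith
    then show False
    proof cases
      case 1
      then obtain v' where "0 \<le> v'" "v' \<le> v" "B v' \<omega> = s a"
        using IVT2'[of "\<lambda>v. B v \<omega>" v "s a" 0] path_on[OF \<omega>] v start B_start[OF \<omega>] by auto
      then show False using hit[of v'] v by auto
    next
      case 2
      then obtain v' where "0 \<le> v'" "v' \<le> v" "B v' \<omega> = s b"
        using IVT'[of "\<lambda>v. B v \<omega>" 0 "s b" v] path_on[OF \<omega>] v start B_start[OF \<omega>] by auto
      then show False using hit[of v'] v by auto
    qed
  qed
  then show "0 \<le> u \<and> \<omega> \<in> inside u" using u \<omega> by (simp add: inside_def)
qed (force simp: bm_lifetime_def inside_def)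

text \<open>The clock of the diffusion integrates \<open>e\<^sup>-\<^sup>2\<^sup>W\<close>, which is half the speed density, along the path. During
the lifetime it is the clock of the string, so it reaches \<open>t\<close> there exactly if the path is still
inside at \<open>stop t\<close>.\<close>

lemma killed_brox_eq:
  assumes \<omega>: "\<omega> \<in> space M" and t: "0 \<le> t"
  shows "killed_brox W a b B t \<omega> = (if \<omega> \<in> alive t then Some (s_inv (B (stop t \<omega>) \<omega>)) else None)"
proof -
  let ?U = "bm_lifetime W a b (\<lambda>u. B u \<omega>)" and ?T = "brox_clock W (\<lambda>u. B u \<omega>)"
  have reached: "u = stop t \<omega> \<and> \<omega> \<in> alive t" if "u \<in> ?U" "?T u = t" for u
  proof -
    have u: "0 \<le> u" "\<omega> \<in> inside u" using that(1) lifetime_iff[OF \<omega>] by auto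
    then have "clock \<omega> u = t" using that(2) brox_clock_eq by simp
    then have "stop t \<omega> = u" using stop_eqI[OF \<omega> u(1)] t by blast
    with u \<omega> show ?thesis by (simp add: alive_def)
  qed
  have alive: "stop t \<omega> \<in> ?U \<and> ?T (stop t \<omega>) = t" if "\<omega> \<in> alive t"
    using that lifetime_iff[OF \<omega>] brox_clock_eq[of \<omega> "stop t \<omega>"] stop_nonneg[OF \<omega> t] clock_stop[OF \<omega> t]
    by (simp add: alive_def)
  show ?thesis
  proof (cases "\<omega> \<in> alive t")
    case True
    then have mem: "t \<in> ?T ` ?U" using alive by force
    have "inv_into ?U ?T t = stop t \<omega>"
      using reached[OF inv_into_into[OF mem] f_inv_into_f[OF mem]] by simp
    with True mem show ?thesis by (simp add: killed_brox_def Let_def)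
  next
    case False
    then have "t \<notin> ?T ` ?U" using reached by blast
    with False show ?thesis by (simp add: killed_brox_def Let_def)
  qed
qed

text \<open>The law on survival is compared with the density on half-lines, where both sides are the mass of
the stopped Brownian motion beyond \<open>s(c)\<close>.\<close>

lemma brox_density:
  assumes es: "eigensystem W a b lam phi" and t: "0 < t"
  shows "alive_density M a b (killed_brox W a b B t)
      (\<lambda>y. 2 * exp (- W y) * (\<Sum>n. exp (- lam n * t) * phi n x * phi n y))"
    and "y \<in> {a<..<b} \<Longrightarrow> summable (\<lambda>n. exp (- lam n * t) * phi n x * phi n y)"
proof -
  interpret killed_clock_eigensystem M B "s x" "s a" "s b" speed_density lam "\<lambda>n z. phi n (s_inv z)"
    by (intro killed_clock_eigensystem.intro killed_clock_axioms eigensystem_imp_string_eigensystem[OF es])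
  let ?Y = "killed_brox W a b B t"
  have t0: "0 \<le> t" using t by simp
  have zx: "s x \<in> {s a..s b}" using x by auto
  define q where "q = heat t (s x)"
  have q: "continuous_on {s a..s b} q" unfolding q_def by (rule heat_continuous[OF t zx])
  have series: "(\<Sum>n. exp (- lam n * t) * phi n x * phi n y) = q (s y)" for y
    by (simp add: q_def heat_def)
  define p where "p y = 2 * exp (- W y) * q (s y)" for y
  have p_eq: "p y = exp (W y) * (q (s y) * speed_density (s y))" for y
  proof -
    have "exp (W y) * exp (- 2 * W y) = exp (- W y)" by (simp flip: exp_add)
    then show ?thesis by (simp add: p_def speed_density_def)
  qed
  have pc: "continuous_on {a..b} p"
    unfolding p_def
    by (intro continuous_intros continuous_on_subset[OF W_continuous] continuous_on_compose2[OF q scale_continuous]) auto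
  have p0: "0 \<le> p y" if "y \<in> {a<..<b}" for y
    unfolding p_def q_def using stopped_law_density(1)[OF t, of "s y"] that by auto
  have A: "{\<omega> \<in> space M. ?Y \<omega> \<noteq> None} = alive t"
  proof (intro set_eqI iffI)
    fix \<omega> assume "\<omega> \<in> {\<omega> \<in> space M. ?Y \<omega> \<noteq> None}"
    then show "\<omega> \<in> alive t" using killed_brox_eq[OF _ t0, of \<omega>] by (cases "\<omega> \<in> alive t") auto
  next
    fix \<omega> assume "\<omega> \<in> alive t"
    then show "\<omega> \<in> {\<omega> \<in> space M. ?Y \<omega> \<noteq> None}"
      using killed_brox_eq[OF _ t0, of \<omega>] alive_subset[of t] by auto
  qed
  have Aev: "alive t \<in> events" by (rule alive_event[OF t0])
  let ?R = "restrict_space M (alive t)"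
  have Ysome: "the (?Y \<omega>) = s_inv (B (stop t \<omega>) \<omega>)" if "\<omega> \<in> alive t" for \<omega>
    using that killed_brox_eq[OF _ t0, of \<omega>] alive_subset[of t] by auto
  have Yrange: "the (?Y \<omega>) \<in> {a<..<b}" "s (the (?Y \<omega>)) = B (stop t \<omega>) \<omega>" if "\<omega> \<in> alive t" for \<omega>
  proof -
    have pos: "B (stop t \<omega>) \<omega> \<in> {s a..s b}" using alive_position[OF that t0] by auto
    note inv = scale_inv[OF less_imp_le[OF ab] pos]
    show eq: "s (the (?Y \<omega>)) = B (stop t \<omega>) \<omega>" unfolding Ysome[OF that] by (rule inv(1))
    show "the (?Y \<omega>) \<in> {a<..<b}"
      using alive_position[OF that t0] unfolding eq[symmetric] by simp
  qed
  have Ym: "(\<lambda>\<omega>. the (?Y \<omega>)) \<in> borel_measurable ?R"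
  proof -
    \<comment> \<open>The inverse of \<open>s\<close> is controlled on \<open>[s(a),s(b)]\<close> only; on survival the clamping changes nothing.\<close>
    let ?c = "\<lambda>z. s_inv (max (s a) (min (s b) z))"
    have "continuous_on UNIV ?c"
      using ab by (intro continuous_on_compose2[OF inv_scale_continuous[of a b]] continuous_intros) auto
    then have "?c \<in> borel_measurable borel" by (rule borel_measurable_continuous_onI)
    from measurable_compose[OF measurable_restrict_space1[OF B_stop_measurable[OF t0]] this]
    have "(\<lambda>\<omega>. ?c (B (stop t \<omega>) \<omega>)) \<in> borel_measurable ?R" .
    moreover have "?c (B (stop t \<omega>) \<omega>) = the (?Y \<omega>)" if "\<omega> \<in> space ?R" for \<omega>
    proof -
      have "\<omega> \<in> alive t" using that by (simp add: space_restrict_space)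
      then show ?thesis using alive_position[of \<omega> t] t0 by (simp add: Ysome max_def min_def)
    qed
    ultimately show ?thesis by (simp cong: measurable_cong)
  qed
  let ?f = "\<lambda>y. indicator {a<..<b} y * ennreal (p y)"
  have fm: "?f \<in> borel_measurable borel"
  proof -
    have "?f = (\<lambda>y. ennreal (indicator {a<..<b} y *\<^sub>R p y))" by (auto simp: indicator_def)
    moreover have "(\<lambda>y. indicator {a<..<b} y *\<^sub>R p y) \<in> borel_measurable borel"
      by (intro borel_measurable_continuous_on_indicator continuous_on_subset[OF pc]) auto
    ultimately show ?thesis by simp
  qed
  have tail: "emeasure (distr ?R lborel (\<lambda>\<omega>. the (?Y \<omega>))) {c<..} = emeasure (density lborel ?f) {c<..}"
    if c: "a \<le> c" "c < b" for c
  proof -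
    have "emeasure (distr ?R lborel (\<lambda>\<omega>. the (?Y \<omega>))) {c<..} = emeasure ?R {\<omega> \<in> alive t. s c < B (stop t \<omega>) \<omega>}"
    proof (subst emeasure_distr)
      show "(\<lambda>\<omega>. the (?Y \<omega>)) \<in> measurable ?R lborel" using Ym by simp
      have "c < the (?Y \<omega>) \<longleftrightarrow> s c < B (stop t \<omega>) \<omega>" if "\<omega> \<in> alive t" for \<omega>
        using Yrange(2)[OF that] scale_less_iff[of c "the (?Y \<omega>)"] by simp
      then show "emeasure ?R ((\<lambda>\<omega>. the (?Y \<omega>)) -` {c<..} \<inter> space ?R) = emeasure ?R {\<omega> \<in> alive t. s c < B (stop t \<omega>) \<omega>}"
        using alive_subset by (intro arg_cong2[where f = emeasure] refl) (auto simp: space_restrict_space)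
    qed simp
    also have "\<dots> = emeasure M {\<omega> \<in> alive t. s c < B (stop t \<omega>) \<omega>}"
      by (rule emeasure_restrict_space) (use Aev alive_subset in \<open>auto simp: Int_absorb2\<close>)
    also have "\<dots> = ennreal (integral {s c..s b} (\<lambda>w. q w * speed_density w))"
      using c by (simp add: emeasure_eq_measure stopped_law_density(2)[OF t] q_def)
    also have "\<dots> = (\<integral>\<^sup>+ y. indicator {c<..<b} y * p y \<partial>lborel)"
    proof (rule nn_integral_has_integral_lebesgue[symmetric])
      show "0 \<le> p y" if "y \<in> {c<..<b}" for y using that c by (intro p0) auto
      have "(p has_integral integral {s c..s b} (\<lambda>w. q w * speed_density w)) {c..b}"
        unfolding p_eq[abs_def] using c
        by (intro integral_scale_substitution continuous_intros q speed_density_continuous) auto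
      then show "(p has_integral integral {s c..s b} (\<lambda>w. q w * speed_density w)) {c<..<b}"
        by (simp add: has_integral_Icc_iff_Ioo)
    qed
    also have "\<dots> = (\<integral>\<^sup>+ y. ?f y * indicator {c<..} y \<partial>lborel)"
      using c by (intro nn_integral_cong) (auto simp: indicator_def)
    also have "\<dots> = emeasure (density lborel ?f) {c<..}"
      by (rule emeasure_density[symmetric]) (use fm in auto)
    finally show ?thesis .
  qed
  have law: "distr ?R lborel (\<lambda>\<omega>. the (?Y \<omega>)) = density lborel ?f"
  proof (rule measure_eqI_lessThan)
    have le: "emeasure (distr ?R lborel (\<lambda>\<omega>. the (?Y \<omega>))) {c<..} \<le> emeasure M (space M)" for c
    proof -
      have "emeasure (distr ?R lborel (\<lambda>\<omega>. the (?Y \<omega>))) {c<..} = emeasure ?R ((\<lambda>\<omega>. the (?Y \<omega>)) -` {c<..} \<inter> space ?R)"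
        using Ym by (intro emeasure_distr) auto
      also have "\<dots> = emeasure M ((\<lambda>\<omega>. the (?Y \<omega>)) -` {c<..} \<inter> space ?R)"
        by (rule emeasure_restrict_space) (use Aev alive_subset in \<open>auto simp: Int_absorb2 space_restrict_space\<close>)
      also have "\<dots> \<le> emeasure M (space M)" by (rule emeasure_space)
      finally show ?thesis .
    qed
    show "emeasure (distr ?R lborel (\<lambda>\<omega>. the (?Y \<omega>))) {c<..} < \<infinity>" for c
      using le[of c] by (simp add: emeasure_space_1 order_le_less_trans[OF _ ennreal_one_less_top])
    show "emeasure (distr ?R lborel (\<lambda>\<omega>. the (?Y \<omega>))) {c<..} = emeasure (density lborel ?f) {c<..}" for c
    proof -
      consider "c < a" | "a \<le> c" "c < b" | "b \<le> c" by linarith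
      then show ?thesis
      proof cases
        case 1
        have "emeasure (distr ?R lborel (\<lambda>\<omega>. the (?Y \<omega>))) {c<..} = emeasure (distr ?R lborel (\<lambda>\<omega>. the (?Y \<omega>))) {a<..}"
          using 1 Ym Yrange(1) by (subst (1 2) emeasure_distr)
            (auto simp: space_restrict_space intro!: arg_cong2[where f = emeasure] dest: order_less_trans)
        also have "\<dots> = emeasure (density lborel ?f) {a<..}" using ab by (intro tail) auto
        also have "\<dots> = emeasure (density lborel ?f) {c<..}"
          using 1 fm by (subst (1 2) emeasure_density) (auto intro!: nn_integral_cong simp: indicator_def)
        finally show ?thesis .
      next
        case 2 then show ?thesis by (rule tail)
      next
        case 3
        have "(\<lambda>\<omega>. the (?Y \<omega>)) -` {c<..} \<inter> space ?R = {}"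
          using 3 Yrange(1) by (fastforce simp: space_restrict_space)
        then have "emeasure (distr ?R lborel (\<lambda>\<omega>. the (?Y \<omega>))) {c<..} = 0"
          using Ym by (simp add: emeasure_distr)
        moreover have "emeasure (density lborel ?f) {c<..} = 0"
        proof -
          have "emeasure (density lborel ?f) {c<..} = (\<integral>\<^sup>+ y. ?f y * indicator {c<..} y \<partial>lborel)"
            by (rule emeasure_density) (use fm in auto)
          also have "\<dots> = (\<integral>\<^sup>+ (y::real). 0 \<partial>lborel)"
            using 3 by (intro nn_integral_cong) (auto simp: indicator_def)
          finally show ?thesis by simp
        qed
        ultimately show ?thesis by simp
      qed
    qed
  qed simp_all
  have "alive_density M a b ?Y p"
    unfolding alive_density_def A
  proof (intro conjI ballI)
    show "continuous_on {a<..<b} p" by (rule continuous_on_subset[OF pc]) auto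
    show "distributed ?R lborel (\<lambda>\<omega>. the (?Y \<omega>)) ?f"
      unfolding distributed_def using law fm Ym by simp
  qed (use Aev p0 in auto)
  then show "alive_density M a b ?Y (\<lambda>y. 2 * exp (- W y) * (\<Sum>n. exp (- lam n * t) * phi n x * phi n y))"
    unfolding series p_def[abs_def] .
  show "summable (\<lambda>n. exp (- lam n * t) * phi n x * phi n y)" if "y \<in> {a<..<b}"
    using heat_summable[OF t zx, of "s y"] that by simp
qed

end

theorem theorem9:
  fixes a b x t :: real
    and P :: "'e measure" and E :: "real \<Rightarrow> 'e \<Rightarrow> real" and \<eta> :: 'e and W :: "real \<Rightarrow> real"
    and M :: "'w measure" and B :: "real \<Rightarrow> 'w \<Rightarrow> real"
    and lam :: "nat \<Rightarrow> real" and phi :: "nat \<Rightarrow> real \<Rightarrow> real"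
  assumes "a < b"
    and "brownian_motion P UNIV 0 E" and "\<eta> \<in> space P" and "W = (\<lambda>y. E y \<eta>)"
    and "eigensystem W a b lam phi"
    and "a < x" and "x < b" and "0 < t"
    and "brownian_motion M {0..} (scale_fun W x) B"
  shows "(\<exists>p. alive_density M a b (killed_brox W a b B t) p) \<and>
    (\<forall>p. alive_density M a b (killed_brox W a b B t) p \<longrightarrow>
      (\<forall>y\<in>{a<..<b}.
        summable (\<lambda>n. exp (- lam n * t) * phi n x * phi n y) \<and>
        p y = 2 * exp (- W y) * (\<Sum>n. exp (- lam n * t) * phi n x * phi n y)))"
proof -
  have "continuous_on UNIV W"
    using assms(2-4) unfolding brownian_motion_def by blast
  then interpret brox_setting W a b M B x
    using assms(1,6,7,9) by unfold_locales auto
  note density = brox_density[OF assms(5) \<open>0 < t\<close>]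
  show ?thesis
  proof (intro conjI allI impI ballI)
    show "\<exists>p. alive_density M a b (killed_brox W a b B t) p" using density(1) by blast
  next
    fix p y assume p: "alive_density M a b (killed_brox W a b B t) p" and y: "y \<in> {a<..<b}"
    show "summable (\<lambda>n. exp (- lam n * t) * phi n x * phi n y)" by (rule density(2)[OF y])
    show "p y = 2 * exp (- W y) * (\<Sum>n. exp (- lam n * t) * phi n x * phi n y)"
      using p density(1) unfolding alive_density_def distributed_def
      by (elim conjE) (rule continuous_AE_density_unique[OF _ _ _ _ _ y], auto)
  qed
qed

end
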